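(* Let $K/\mathbb{Q}$ be a number field of degree $n>5$. For a prime $p$ and $i\ge 1$ let $a_i(p)$ be the number of subrings with identity of $\mathcal{O}_K\otimes_{\mathbb{Z}}\mathbb{Z}_p$ which are full-rank $\mathbb{Z}_p$-sublattices of index $p^i$. Then there is a finite set $S$ of primes such that the series $$\sum_{p\notin S}\sum_{i=2}^\infty \frac{a_i(p)}{p^{i\sigma}}$$ converges for every real $\sigma>\frac{n}{2}-\frac{7}{6}$.
   Context: $\mathcal{O}_K$ is the ring of integers of $K$; the index is the index as additive groups. *)

theory Defs
  imports
    "HOL-Algebra.Free_Abelian_Groups"
    "HOL-Algebra.QuotRing"
    "HOL-Algebra.Subrings"
    "HOL-Algebra.Module"
    "HOL-Computational_Algebra.Polynomial"
    "HOL-Analysis.Infinite_Sum"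
begin

section \<open>Number fields and their rings of integers\<close>

text \<open>
  A number field is a subfield \<open>K\<close> of an arbitrary field of characteristic 0 that is
  finite-dimensional over \<open>\<rat>\<close>; the ambient type may also be \<open>K\<close> itself.
\<close>

definition number_field :: "'a::field_char_0 set \<Rightarrow> bool" where
  "number_field K \<longleftrightarrow>
     1 \<in> K \<and> (\<forall>x\<in>K. \<forall>y\<in>K. x - y \<in> K \<and> x * y \<in> K) \<and> (\<forall>x\<in>K. inverse x \<in> K) \<and>
     (\<exists>B. finite B \<and> K = module.span (\<lambda>(q::rat) x. of_rat q * x) B)"

definition field_degree :: "'a::field_char_0 set \<Rightarrow> nat" where
  "field_degree K = vector_space.dim (\<lambda>(q::rat) x. of_rat q * x) K"

definition ring_of_integers :: "'a::field_char_0 set \<Rightarrow> 'a ring" where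
  "ring_of_integers K =
     \<lparr>carrier = {x \<in> K. algebraic_int x}, monoid.mult = (*), one = 1, zero = 0, add = (+)\<rparr>"

section \<open>The ring of \<open>p\<close>-adic integers\<close>

text \<open>
  The inverse limit of the rings \<open>\<int>/p\<^sup>k\<close>, each represented by the residues \<open>0, \<dots>, p\<^sup>k - 1\<close>.
\<close>

definition padic_integers :: "nat \<Rightarrow> (nat \<Rightarrow> int) ring" where
  "padic_integers p =
     \<lparr>carrier = {x. \<forall>k. x k \<in> {0..<int p ^ k} \<and> x (Suc k) mod int p ^ k = x k},
      monoid.mult = (\<lambda>x y k. (x k * y k) mod int p ^ k),
      one = (\<lambda>k. 1 mod int p ^ k),
      zero = (\<lambda>k. 0),
      add = (\<lambda>x y k. (x k + y k) mod int p ^ k)\<rparr>"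

section \<open>Tensor products of commutative rings over \<open>\<int>\<close>\<close>

text \<open>
  \<open>A \<otimes>\<^sub>\<int> B\<close> is the free abelian group on \<open>A \<times> B\<close> modulo the subgroup generated by the
  biadditivity relations, with the product induced by \<open>(a, b) (a', b') = (a a', b b')\<close>.
\<close>

definition pair_ring ::
  "('a, 'm) ring_scheme \<Rightarrow> ('b, 'n) ring_scheme \<Rightarrow> ('a \<times> 'b \<Rightarrow>\<^sub>0 int) ring" where
  "pair_ring A B =
     \<lparr>carrier = carrier (free_Abelian_group (carrier A \<times> carrier B)),
      monoid.mult = (\<lambda>x y. frag_extend (\<lambda>(a, b).
        frag_extend (\<lambda>(a', b'). frag_of (a \<otimes>\<^bsub>A\<^esub> a', b \<otimes>\<^bsub>B\<^esub> b')) y) x),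
      one = frag_of (\<one>\<^bsub>A\<^esub>, \<one>\<^bsub>B\<^esub>),
      zero = 0,
      add = (+)\<rparr>"

definition biadditivity_relations ::
  "('a, 'm) ring_scheme \<Rightarrow> ('b, 'n) ring_scheme \<Rightarrow> ('a \<times> 'b \<Rightarrow>\<^sub>0 int) set" where
  "biadditivity_relations A B =
     {frag_of (a \<oplus>\<^bsub>A\<^esub> a', b) - frag_of (a, b) - frag_of (a', b) | a a' b.
        a \<in> carrier A \<and> a' \<in> carrier A \<and> b \<in> carrier B} \<union>
     {frag_of (a, b \<oplus>\<^bsub>B\<^esub> b') - frag_of (a, b) - frag_of (a, b') | a b b'.
        a \<in> carrier A \<and> b \<in> carrier B \<and> b' \<in> carrier B}"

definition tensor_kernel ::
  "('a, 'm) ring_scheme \<Rightarrow> ('b, 'n) ring_scheme \<Rightarrow> ('a \<times> 'b \<Rightarrow>\<^sub>0 int) set" where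
  "tensor_kernel A B =
     generate (free_Abelian_group (carrier A \<times> carrier B)) (biadditivity_relations A B)"

definition tensor_ring ::
  "('a, 'm) ring_scheme \<Rightarrow> ('b, 'n) ring_scheme \<Rightarrow> ('a \<times> 'b \<Rightarrow>\<^sub>0 int) set ring" where
  "tensor_ring A B = pair_ring A B Quot tensor_kernel A B"

definition pure_tensor ::
  "('a, 'm) ring_scheme \<Rightarrow> ('b, 'n) ring_scheme \<Rightarrow> 'a \<Rightarrow> 'b \<Rightarrow> ('a \<times> 'b \<Rightarrow>\<^sub>0 int) set" where
  "pure_tensor A B a b = tensor_kernel A B +>\<^bsub>pair_ring A B\<^esub> frag_of (a, b)"

text \<open>The tensor product as a \<open>B\<close>-algebra, \<open>z\<close> in \<open>B\<close> acting as multiplication by \<open>1 \<otimes> z\<close>.\<close>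

definition tensor_algebra ::
  "('a, 'm) ring_scheme \<Rightarrow> ('b, 'n) ring_scheme \<Rightarrow> ('b, ('a \<times> 'b \<Rightarrow>\<^sub>0 int) set) module" where
  "tensor_algebra A B = ring.extend (tensor_ring A B)
     (module.fields (\<lambda>z x. pure_tensor A B \<one>\<^bsub>A\<^esub> z \<otimes>\<^bsub>tensor_ring A B\<^esub> x))"

section \<open>Lattices and the numbers \<open>a\<^sub>i(p)\<close>\<close>

definition free_of_rank ::
  "('r, 'm) ring_scheme \<Rightarrow> ('r, 'v, 'n) module_scheme \<Rightarrow> 'v set \<Rightarrow> nat \<Rightarrow> bool" where
  "free_of_rank R M L r \<longleftrightarrow>
     submodule L R M \<and>
     (\<exists>b \<in> {..<r} \<rightarrow> L. \<forall>x\<in>L. \<exists>!c. c \<in> {..<r} \<rightarrow>\<^sub>E carrier R \<and>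
        x = (\<Oplus>\<^bsub>M\<^esub>j\<in>{..<r}. c j \<odot>\<^bsub>M\<^esub> b j))"

definition full_rank_sublattice ::
  "('r, 'm) ring_scheme \<Rightarrow> ('r, 'v, 'n) module_scheme \<Rightarrow> 'v set \<Rightarrow> bool" where
  "full_rank_sublattice R M L \<longleftrightarrow>
     (\<exists>r. free_of_rank R M L r \<and> free_of_rank R M (carrier M) r)"

definition additive_index :: "('v, 'm) ring_scheme \<Rightarrow> 'v set \<Rightarrow> nat" where
  "additive_index M L = card (rcosets\<^bsub>add_monoid M\<^esub> L)"

text \<open>
  \<^const>\<open>subring\<close> requires the identity of the whole ring. An infinite additive index has
  \<^const>\<open>card\<close> 0, which is never \<open>p\<^sup>i\<close> for a prime \<open>p\<close>.
\<close>

definition subring_count :: "'a::field_char_0 set \<Rightarrow> nat \<Rightarrow> nat \<Rightarrow> nat" where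
  "subring_count K p i =
     (let Zp = padic_integers p; M = tensor_algebra (ring_of_integers K) Zp
      in card {L. subring L M \<and> full_rank_sublattice Zp M L \<and> additive_index M L = p ^ i})"

end

theory Submission
  imports Defs "HOL-Analysis.Summation_Tests" "Jordan_Normal_Form.Char_Poly"
begin

text \<open>
  Extending scalars to \<open>\<int>\<^sub>p\<close> does not change the finite quotients of \<open>p\<close>-power order of the ring \<open>R\<close>
  of integers, so it suffices to count the subrings \<open>L\<close> of \<open>R\<close> of index \<open>p\<^sup>i\<close>. For almost all \<open>p\<close> the ring
  \<open>R/p\<close> is reduced; then ideals containing \<open>p\<^sup>i\<close> are described by at most \<open>n\<close> exponents, so that \<open>L\<close> has at
  most \<open>(i + 1)\<^sup>n\<close> possible conductors \<open>I\<close>.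

  For given \<open>I\<close>, at least half of the characters \<open>\<xi>\<close> of \<open>R/L\<close> induce a nondegenerate form \<open>\<xi>(x y)\<close> on
  \<open>R/I\<close>, and \<open>L\<close> is isotropic for each of them. If the elements \<open>y\<^sub>1 = 1, y\<^sub>2, \<dots>\<close> generate \<open>L/I\<close> and their
  orders \<open>p\<^sup>\<nu>\<close> decrease, then every \<open>y\<^sub>j\<close> lies in the orthogonal complement of its predecessors, while
  \<open>L\<close> itself contains many possible choices of \<open>y\<^sub>j\<close>. Double counting bounds the number of \<open>L\<close> with given
  orders by a power of \<open>p\<close>, and maximising its exponent over all sequences of orders gives
  \<open>(n/2 - 7/6) i - 1\<close>. When \<open>R/I\<close> has exponent \<open>p\<close>, this needs an additional factor \<open>1/p\<close>, which comes
  from \<open>y\<^sub>2\<close> being a zero of the quadratic form \<open>\<xi>(y y)\<close>.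
\<close>

section \<open>Indices of additive subgroups\<close>

text \<open>The term -1 in the exponent is there for the sum over the primes: a bound by p^((n/2 -
  7/6) i - 1), up to a polynomial in i, leaves p^(-1 - 2 \<epsilon>) times a geometric series in i.
  Every character of R/L is trivial on the conductor I, so the radical of the form \<xi>(x y)
  contains I, and nondegeneracy on R/I is the most that can be asked. Characters are used because
  R/I need not be free over Z/p^k; they treat elements of all orders alike. In the exponent, the
  orthogonality of two generators couples the layer a of L/I with the layer k - 1 - a, where p^k is
  the exponent of R/I. Each layer together with its partner gains 1, so all k layers gain k/2. This
  reaches the required 1 for k \<ge> 2 and is only 1/2 for k = 1, hence the quadric in that case.
  For n = 6 the estimate for a pair of layers is attained, for instance by two layers with two
  generators and colength 4 each.\<close>

definition add_subgroup :: "'a::ab_group_add set \<Rightarrow> bool" where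
  "add_subgroup H \<longleftrightarrow> 0 \<in> H \<and> (\<forall>x\<in>H. \<forall>y\<in>H. x - y \<in> H)"

text \<open>\<open>T\<close> may be any set and need not contain \<open>H\<close>: for a subgroup
  \<open>H\<close> these are the cosets of \<open>H\<close> that meet \<open>T\<close>. The same
  index thus measures images of homomorphisms and sets of candidates modulo an ideal.\<close>

definition cosets :: "'a::ab_group_add set \<Rightarrow> 'a set \<Rightarrow> 'a set set" where
  "cosets T H = (\<lambda>x. (+) x ` H) ` T"

definition idx :: "'a::ab_group_add set \<Rightarrow> 'a set \<Rightarrow> nat" where
  "idx T H = card (cosets T H)"

lemma add_subgroupD:
  assumes "add_subgroup H"
  shows "0 \<in> H" "\<And>x y. x \<in> H \<Longrightarrow> y \<in> H \<Longrightarrow> x - y \<in> H" "\<And>x. x \<in> H \<Longrightarrow> - x \<in> H"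
    "\<And>x y. x \<in> H \<Longrightarrow> y \<in> H \<Longrightarrow> x + y \<in> H"
proof -
  show z: "0 \<in> H" and d: "\<And>x y. x \<in> H \<Longrightarrow> y \<in> H \<Longrightarrow> x - y \<in> H"
    using assms unfolding add_subgroup_def by auto
  show m: "- x \<in> H" if "x \<in> H" for x using d[OF z that] by simp
  show "x + y \<in> H" if "x \<in> H" "y \<in> H" for x y using d[OF that(1) m[OF that(2)]] by simp
qed

lemma add_subgroup_of_nat:
  fixes H :: "'a::ring_1 set"
  assumes "add_subgroup H" "x \<in> H"
  shows "of_nat m * x \<in> H"
  by (induction m) (use assms in \<open>auto simp: algebra_simps intro: add_subgroupD\<close>)

lemma add_subgroup_of_int:
  fixes H :: "'a::ring_1 set"
  assumes "add_subgroup H" "x \<in> H"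
  shows "of_int m * x \<in> H"
  proof (cases "m \<ge> 0")
  case True
  then show ?thesis using add_subgroup_of_nat[OF assms, of "nat m"] by simp
next
  case False
  then show ?thesis using add_subgroupD(3)[OF assms(1) add_subgroup_of_nat[OF assms, of "nat (- m)"]] by simp
qed

lemma add_subgroup_sum:
  assumes "add_subgroup H" "\<And>i. i \<in> A \<Longrightarrow> f i \<in> H"
  shows "sum f A \<in> H"
  using assms(2) by (induction A rule: infinite_finite_induct) (auto intro: add_subgroupD assms(1))

lemma coset_eq_iff:
  assumes "add_subgroup H"
  shows "(+) x ` H = (+) y ` H \<longleftrightarrow> x - y \<in> H"
proof
  assume "(+) x ` H = (+) y ` H"
  moreover have "x \<in> (+) x ` H" using add_subgroupD(1)[OF assms] by force
  ultimately obtain h where "h \<in> H" "x = y + h" by auto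
  then show "x - y \<in> H" by simp
next
  have *: "(+) a ` H \<subseteq> (+) b ` H" if "a - b \<in> H" for a b
  proof
    fix z assume "z \<in> (+) a ` H"
    then obtain h where h: "h \<in> H" "z = a + h" by auto
    have "z = b + ((a - b) + h)" using h by simp
    moreover have "(a - b) + h \<in> H" using that h add_subgroupD(4)[OF assms] by blast
    ultimately show "z \<in> (+) b ` H" by blast
  qed
  assume "x - y \<in> H"
  moreover from this have "y - x \<in> H" using add_subgroupD(3)[OF assms, of "x - y"] by simp
  ultimately show "(+) x ` H = (+) y ` H" using * by blast
qed

lemma coset_cong:
  assumes "add_subgroup H" "c \<in> cosets T H" "x \<in> c"
  shows "c = (+) x ` H"
proof -
  obtain t h where "t \<in> T" "c = (+) t ` H" "h \<in> H" "x = t + h"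
    using assms(2,3) unfolding cosets_def by auto
  then show ?thesis using coset_eq_iff[OF assms(1), of t x] add_subgroupD(3)[OF assms(1)] by simp
qed

lemma finite_cosets_mono:
  "finite (cosets T H) \<Longrightarrow> S \<subseteq> T \<Longrightarrow> finite (cosets S H)"
  unfolding cosets_def by (meson finite_subset image_mono)

lemma idx_mono:
  "finite (cosets T H) \<Longrightarrow> S \<subseteq> T \<Longrightarrow> idx S H \<le> idx T H"
  unfolding idx_def cosets_def by (meson card_mono image_mono)

lemma idx_self:
  assumes "add_subgroup H"
  shows "idx H H = 1"
proof -
  have "cosets H H = {(+) 0 ` H}"
  proof -
    have "(+) x ` H = (+) 0 ` H" if "x \<in> H" for x
      using coset_eq_iff[OF assms, of x 0] that by (metis diff_zero)
    then have "cosets H H = (\<lambda>x. (+) 0 ` H) ` H" unfolding cosets_def by (rule image_cong[OF refl])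
    also have "\<dots> = {(+) 0 ` H}" using add_subgroupD(1)[OF assms] by (metis image_constant)
    finally show ?thesis .
  qed
  then show ?thesis unfolding idx_def by simp
qed

lemma finite_cosets_self: "add_subgroup H \<Longrightarrow> finite (cosets H H)"
  using idx_self[of H] unfolding idx_def by (intro card_ge_0_finite) simp

lemma idx_pos:
  "finite (cosets T H) \<Longrightarrow> T \<noteq> {} \<Longrightarrow> idx T H > 0"
  unfolding idx_def cosets_def by (simp add: card_gt_0_iff)

lemma idx_1_iff:
  assumes "add_subgroup H" "add_subgroup T" "H \<subseteq> T" "idx T H = 1"
  shows "T = H"
proof -
  obtain c where c: "cosets T H = {c}" using assms(4) unfolding idx_def by (auto simp: card_1_singleton_iff)
  have "x \<in> H" if "x \<in> T" for x
  proof -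
    have "(+) t ` H = c" if "t \<in> T" for t
      using c imageI[OF that, of "\<lambda>x. (+) x ` H"] unfolding cosets_def by simp
    from this[OF that] this[OF add_subgroupD(1)[OF assms(2)]] have "(+) x ` H = (+) 0 ` H" by simp
    then show ?thesis using coset_eq_iff[OF assms(1), of x 0] by simp
  qed
  then show ?thesis using assms(3) by blast
qed

text \<open>Cosets of \<open>H\<close> in \<open>T\<close> and in a larger group are compared by choosing representatives; when
  an index is infinite both sides are the junk value \<open>0\<close>.\<close>

lemma bij_betw_cosets_tower:
  assumes H: "add_subgroup H" and U: "add_subgroup U" and T: "add_subgroup T"
    and "H \<subseteq> U" "U \<subseteq> T"
  shows "\<exists>f. bij_betw f (cosets T U \<times> cosets U H) (cosets T H)"
proof -
  define r where "r c = (SOME x. x \<in> c)" for c :: "'a set"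
  have r: "r c \<in> c" if "c \<in> cosets T U" for c
  proof -
    have "c \<noteq> {}" using that add_subgroupD(1)[OF U] unfolding cosets_def by auto
    then show ?thesis unfolding r_def by (simp add: some_in_eq)
  qed
  have rT: "r c \<in> T" if c: "c \<in> cosets T U" for c
  proof -
    obtain t u where "t \<in> T" "u \<in> U" "r c = t + u" using r[OF c] c unfolding cosets_def by auto
    then show ?thesis using assms(5) add_subgroupD(4)[OF T] by auto
  qed
  have rc: "c = (+) (r c) ` U" if "c \<in> cosets T U" for c
    using coset_cong[OF U that r[OF that]] .
  define f where "f = (\<lambda>(c, d). (+) (r c) ` d :: 'a set)"
  have shift: "(+) a ` (+) b ` H = (+) (a + b) ` H" for a b by (simp add: image_image add.assoc)
  have "inj_on f (cosets T U \<times> cosets U H)"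
  proof (rule inj_onI, clarify)
    fix c d c' d' assume c: "c \<in> cosets T U" "c' \<in> cosets T U" and d: "d \<in> cosets U H" "d' \<in> cosets U H"
      and e: "f (c, d) = f (c', d')"
    obtain u u' where u: "u \<in> U" "u' \<in> U" "d = (+) u ` H" "d' = (+) u' ` H"
      using d unfolding cosets_def by auto
    have "(+) (r c + u) ` H = (+) (r c' + u') ` H" using e unfolding f_def u by (simp add: shift)
    then have 1: "(r c + u) - (r c' + u') \<in> H" using coset_eq_iff[OF H] by blast
    then have "(r c + u) - (r c' + u') \<in> U" using assms(4) by blast
    then have "(r c + u) - (r c' + u') - u + u' \<in> U" using u add_subgroupD(2,4)[OF U] by blast
    then have "r c - r c' \<in> U" by (simp add: algebra_simps)
    then have "(+) (r c) ` U = (+) (r c') ` U" using coset_eq_iff[OF U] by blast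
    then have cc: "c = c'" using rc[OF c(1)] rc[OF c(2)] by simp
    then have "u - u' \<in> H" using 1 by simp
    then show "c = c' \<and> d = d'" using cc u coset_eq_iff[OF H] by blast
  qed
  moreover have "f ` (cosets T U \<times> cosets U H) = cosets T H"
  proof (intro equalityI subsetI)
    fix z assume "z \<in> f ` (cosets T U \<times> cosets U H)"
    then obtain c u where c: "c \<in> cosets T U" "u \<in> U" "z = (+) (r c + u) ` H"
      unfolding f_def cosets_def[of U] by (auto simp: shift)
    have "r c + u \<in> T" using rT[OF c(1)] c(2) assms(5) add_subgroupD(4)[OF T] by blast
    then show "z \<in> cosets T H" unfolding cosets_def c(3) by blast
  next
    fix z assume "z \<in> cosets T H"
    then obtain t where t: "t \<in> T" "z = (+) t ` H" unfolding cosets_def by auto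
    define c where "c = (+) t ` U"
    have c: "c \<in> cosets T U" unfolding c_def cosets_def using t by blast
    have "t \<in> c" unfolding c_def using add_subgroupD(1)[OF U] by force
    then obtain u where u: "u \<in> U" "t = r c + u" using rc[OF c] by auto
    have "z = f (c, (+) u ` H)" unfolding f_def t u by (simp add: shift flip: u(2))
    then show "z \<in> f ` (cosets T U \<times> cosets U H)" using c u(1) unfolding cosets_def[of U] by blast
  qed
  ultimately show ?thesis unfolding bij_betw_def by blast
qed

lemma idx_tower:
  assumes "add_subgroup H" "add_subgroup U" "add_subgroup T" "H \<subseteq> U" "U \<subseteq> T"
  shows "idx T U * idx U H = idx T H"
  using bij_betw_cosets_tower[OF assms] unfolding idx_def
  by (metis bij_betw_same_card card_cartesian_product)

lemma finite_cosets_tower: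
  assumes "add_subgroup H" "add_subgroup U" "add_subgroup T" "H \<subseteq> U" "U \<subseteq> T"
  shows "finite (cosets T H) \<longleftrightarrow> finite (cosets T U) \<and> finite (cosets U H)"
proof -
  have "cosets T U \<noteq> {}" "cosets U H \<noteq> {}"
    using add_subgroupD(1)[OF assms(2)] add_subgroupD(1)[OF assms(3)] unfolding cosets_def by auto
  then show ?thesis
    using bij_betw_cosets_tower[OF assms] bij_betw_finite finite_cartesian_product_iff by metis
qed

text \<open>The isomorphism theorem: T modulo the preimage of I is (f(T) + I)/I, with
  \<open>f\<close> additive on \<open>T\<close> only. For the identity map it compares T/(T \<inter>
  I) with (T + I)/I.\<close>

lemma idx_hom:
  assumes T: "add_subgroup T" and I: "add_subgroup I"
    and f: "\<And>x y. x \<in> T \<Longrightarrow> y \<in> T \<Longrightarrow> f (x - y) = f x - f y"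
  shows "idx T {x\<in>T. f x \<in> I} = idx (f ` T) I"
    and "add_subgroup {x\<in>T. f x \<in> I}"
proof -
  let ?K = "{x\<in>T. f x \<in> I}"
  have f0: "f 0 = 0" using f[of 0 0] add_subgroupD(1)[OF T] by simp
  show K: "add_subgroup ?K"
    unfolding add_subgroup_def using f f0 T I by (auto simp: add_subgroup_def)
  have "bij_betw (\<lambda>c. (+) (f (SOME x. x \<in> c \<and> x \<in> T)) ` I) (cosets T ?K) (cosets (f ` T) I)"
  proof -
    have s: "f (SOME y. y \<in> (+) x ` ?K \<and> y \<in> T) - f x \<in> I" if "x \<in> T" for x
    proof -
      let ?y = "SOME y. y \<in> (+) x ` ?K \<and> y \<in> T"
      have "x \<in> (+) x ` ?K \<and> x \<in> T" using add_subgroupD(1)[OF K] that by force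
      then have y: "?y \<in> (+) x ` ?K \<and> ?y \<in> T" by (rule someI)
      then obtain h where h: "h \<in> T" "f h \<in> I" "?y = x + h" by auto
      have "f h = f ?y - f x" using f[of ?y x] y that h by simp
      then show ?thesis using h by simp
    qed
    have eq: "(+) (f (SOME y. y \<in> (+) x ` ?K \<and> y \<in> T)) ` I = (+) (f x) ` I" if "x \<in> T" for x
      using s[OF that] coset_eq_iff[OF I] by blast
    show ?thesis unfolding bij_betw_def
    proof
      show "inj_on (\<lambda>c. (+) (f (SOME x. x \<in> c \<and> x \<in> T)) ` I) (cosets T ?K)"
        unfolding cosets_def
      proof (rule inj_onI, clarify)
        fix x y assume xy: "x \<in> T" "y \<in> T"
          and "(+) (f (SOME z. z \<in> (+) x ` ?K \<and> z \<in> T)) ` I = (+) (f (SOME z. z \<in> (+) y ` ?K \<and> z \<in> T)) ` I"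
        then have "(+) (f x) ` I = (+) (f y) ` I" using eq by simp
        then have "f x - f y \<in> I" using coset_eq_iff[OF I] by blast
        then have "x - y \<in> ?K" using f xy add_subgroupD(2)[OF T] by auto
        then show "(+) x ` ?K = (+) y ` ?K" using coset_eq_iff[OF K] by blast
      qed
      show "(\<lambda>c. (+) (f (SOME x. x \<in> c \<and> x \<in> T)) ` I) ` cosets T ?K = cosets (f ` T) I"
        unfolding cosets_def image_image by (rule image_cong[OF refl]) (rule eq)
    qed
  qed
  then show "idx T ?K = idx (f ` T) I" unfolding idx_def by (rule bij_betw_same_card)
qed

section \<open>Additive (not ring) extension of a subgroup by one element\<close>

definition adjoin :: "'a::ring_1 set \<Rightarrow> 'a \<Rightarrow> 'a set" where
  "adjoin H z = {h + of_int m * z | h m. h \<in> H}"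

lemma adjoin_mem: "h \<in> H \<Longrightarrow> h + of_int m * z \<in> adjoin H z"
  unfolding adjoin_def by blast

lemma adjoin_subset:
  assumes "add_subgroup T" "H \<subseteq> T" "z \<in> T"
  shows "adjoin H z \<subseteq> T"
  using assms add_subgroup_of_int[OF assms(1,3)] add_subgroupD(4)[OF assms(1)]
  unfolding adjoin_def by blast

lemma subset_adjoin: "H \<subseteq> adjoin H z"
  using adjoin_mem[of _ H 0 z] by auto

lemma adjoin_self: "add_subgroup H \<Longrightarrow> z \<in> adjoin H z"
  using adjoin_mem[of 0 H 1 z] add_subgroupD(1)[of H] by simp

lemma add_subgroup_adjoin:
  assumes "add_subgroup H"
  shows "add_subgroup (adjoin H z)"
  unfolding add_subgroup_def
proof safe
  show "0 \<in> adjoin H z" using subset_adjoin add_subgroupD(1)[OF assms] by blast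
  fix x y assume "x \<in> adjoin H z" "y \<in> adjoin H z"
  then obtain h m h' m' where *: "h \<in> H" "h' \<in> H" "x = h + of_int m * z" "y = h' + of_int m' * z"
    unfolding adjoin_def by blast
  then have "x - y = (h - h') + of_int (m - m') * z" by (simp add: algebra_simps)
  then show "x - y \<in> adjoin H z" using adjoin_mem add_subgroupD(2)[OF assms *(1,2)] by metis
qed

text \<open>The second hypothesis on m says that \<open>z\<close> has order m modulo
  \<open>H\<close>, so the cosets are represented by the multiples j z with 0 \<le> j < m.\<close>

lemma idx_adjoin:
  fixes m :: nat
  assumes H: "add_subgroup H" and m: "m > 0" "\<And>j::int. of_int j * z \<in> H \<longleftrightarrow> int m dvd j"
  shows "idx (adjoin H z) H = m" "finite (cosets (adjoin H z) H)"
proof -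
  have "bij_betw (\<lambda>j. (+) (of_int j * z) ` H) {0..<int m} (cosets (adjoin H z) H)"
    unfolding bij_betw_def
  proof
    show "inj_on (\<lambda>j. (+) (of_int j * z) ` H) {0..<int m}"
    proof (rule inj_onI)
      fix i j assume ij: "i \<in> {0..<int m}" "j \<in> {0..<int m}"
        and "(+) (of_int i * z) ` H = (+) (of_int j * z) ` H"
      then have "of_int i * z - of_int j * z \<in> H" using coset_eq_iff[OF H] by blast
      then have "of_int (i - j) * z \<in> H" by (simp add: algebra_simps)
      then have "int m dvd i - j" using m(2) by blast
      then have "i mod int m = j mod int m" by (simp add: mod_eq_dvd_iff)
      then show "i = j" using ij by simp
    qed
    show "(\<lambda>j. (+) (of_int j * z) ` H) ` {0..<int m} = cosets (adjoin H z) H"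
    proof (intro equalityI subsetI)
      fix c assume "c \<in> (\<lambda>j. (+) (of_int j * z) ` H) ` {0..<int m}"
      moreover have "of_int j * z \<in> adjoin H z" for j
        using adjoin_mem[OF add_subgroupD(1)[OF H], of j z] by simp
      ultimately show "c \<in> cosets (adjoin H z) H" unfolding cosets_def by blast
    next
      fix c assume "c \<in> cosets (adjoin H z) H"
      then obtain h j where hj: "h \<in> H" "c = (+) (h + of_int j * z) ` H"
        unfolding cosets_def adjoin_def by auto
      have e: "of_int j = (of_int (j mod int m) + of_int (int m * (j div int m)) :: 'a)"
        by (metis add.commute mult_div_mod_eq of_int_add)
      have "h + of_int j * z - of_int (j mod int m) * z = h + of_int (int m * (j div int m)) * z"
        by (subst e) (simp add: algebra_simps)
      moreover have "of_int (int m * (j div int m)) * z \<in> H" using m(2)[of "int m * (j div int m)"] by simp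
      ultimately have "h + of_int j * z - of_int (j mod int m) * z \<in> H"
        using hj add_subgroupD(4)[OF H] by metis
      then have "c = (+) (of_int (j mod int m) * z) ` H" using coset_eq_iff[OF H] hj by blast
      then show "c \<in> (\<lambda>j. (+) (of_int j * z) ` H) ` {0..<int m}" using m(1) by auto
    qed
  qed
  then show "idx (adjoin H z) H = m" "finite (cosets (adjoin H z) H)"
    unfolding idx_def using bij_betw_same_card[of _ "{0..<int m}"] bij_betw_finite[of _ "{0..<int m}"] by auto
qed

lemma order_mod_subgroup:
  fixes H :: "'a::ring_1 set"
  assumes H: "add_subgroup H" and N: "N > 0" "of_nat N * z \<in> H"
  obtains m :: nat where "m > 0" "\<And>j::int. of_int j * z \<in> H \<longleftrightarrow> int m dvd j"
proof -
  define m where "m = (LEAST m. m > 0 \<and> of_nat m * z \<in> H)"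
  have m: "m > 0" "of_nat m * z \<in> H"
    using LeastI[of "\<lambda>m. m > 0 \<and> of_nat m * z \<in> H" N] N unfolding m_def by auto
  have "of_int j * z \<in> H \<longleftrightarrow> int m dvd j" for j
  proof
    assume "int m dvd j"
    then obtain q where "j = q * int m" by (metis dvd_def mult.commute)
    then have "of_int j * z = of_int q * (of_nat m * z)" by (simp add: mult.assoc)
    then show "of_int j * z \<in> H" using add_subgroup_of_int[OF H m(2)] by simp
  next
    assume j: "of_int j * z \<in> H"
    have "j = (j mod int m) + (j div int m) * int m" by simp
    then have "of_int j * z = (of_int (j mod int m) + of_int (j div int m) * of_nat m) * z"
      by (metis of_int_add of_int_mult of_int_of_nat_eq)
    then have "of_int (j mod int m) * z = of_int j * z - of_int (j div int m) * (of_nat m * z)"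
      by (simp add: algebra_simps)
    then have "of_int (j mod int m) * z \<in> H"
      using add_subgroupD(2)[OF H j add_subgroup_of_int[OF H m(2)]] by metis
    moreover have "of_int (j mod int m) = (of_nat (nat (j mod int m)) :: 'a)" using m(1) by simp
    ultimately have "of_nat (nat (j mod int m)) * z \<in> H" by simp
    moreover have "nat (j mod int m) < m" using m(1) by (simp add: nat_less_iff)
    ultimately have "nat (j mod int m) = 0"
      using not_less_Least[of "nat (j mod int m)" "\<lambda>m. m > 0 \<and> of_nat m * z \<in> H"] unfolding m_def by auto
    then show "int m dvd j" using m(1) by (simp add: dvd_eq_mod_eq_0 nat_eq_iff split: if_splits)
  qed
  then show ?thesis using that m(1) by blast
qed

lemma order_mod_finite_index:
  fixes H T :: "'a::ring_1 set"
  assumes H: "add_subgroup H" and T: "add_subgroup T" and fin: "finite (cosets T H)" and x: "x \<in> T"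
  obtains m :: nat where "m > 0" "\<And>j::int. of_int j * x \<in> H \<longleftrightarrow> int m dvd j"
proof -
  let ?f = "\<lambda>j::nat. (+) (of_nat j * x) ` H"
  have "range ?f \<subseteq> cosets T H"
    unfolding cosets_def using add_subgroup_of_nat[OF T x] by blast
  then have "\<not> inj ?f" using finite_subset[OF _ fin] finite_imageD[of ?f UNIV] by auto
  then obtain i j where ij: "i < j" "?f i = ?f j" unfolding inj_def by (metis linorder_neqE_nat)
  then have "of_nat j * x - of_nat i * x \<in> H" using coset_eq_iff[OF H] by metis
  then have "of_nat (j - i) * x \<in> H" using ij by (simp add: of_nat_diff algebra_simps)
  then show ?thesis using order_mod_subgroup[OF H _ \<open>of_nat (j - i) * x \<in> H\<close>] that ij by auto
qed

text \<open>The order of \<open>z\<close> modulo \<open>H\<close> divides p^c but not p^(c - 1), so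
  it is p^c; for c = 0 there is nothing to exclude.\<close>

lemma idx_adjoin_prime_power:
  fixes H :: "'a::ring_1 set"
  assumes H: "add_subgroup H" and p: "prime p" and c: "of_nat (p ^ c) * z \<in> H"
    "c > 0 \<Longrightarrow> of_nat (p ^ (c - 1)) * z \<notin> H"
  shows "idx (adjoin H z) H = p ^ c" "finite (cosets (adjoin H z) H)"
proof -
  obtain m where m: "m > 0" "\<And>j::int. of_int j * z \<in> H \<longleftrightarrow> int m dvd j"
    using order_mod_subgroup[OF H _ c(1)] p by (metis prime_gt_0_nat zero_less_power)
  have d: "of_nat j * z \<in> H \<longleftrightarrow> m dvd j" for j using m(2)[of "int j"] by simp
  obtain b where b: "b \<le> c" "m = p ^ b" using c(1) d divides_primepow_nat[OF p] by blast
  have "b = c"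
  proof (rule ccontr)
    assume "b \<noteq> c"
    then have "m dvd p ^ (c - 1)" "c > 0" using b by (auto intro: le_imp_power_dvd)
    then show False using c(2) d by blast
  qed
  then show "idx (adjoin H z) H = p ^ c" "finite (cosets (adjoin H z) H)"
    using idx_adjoin[OF H m] b by auto
qed

text \<open>A finite quotient T/H is exhausted by a chain of cyclic extensions; the induction is on
  the index that remains above the subgroup reached so far.\<close>

lemma adjoin_induct [consumes 4, case_names base step]:
  fixes H T :: "'a::ring_1 set"
  assumes "add_subgroup H" "add_subgroup T" "H \<subseteq> T" "finite (cosets T H)"
    and "P H"
    and step: "\<And>U z m. add_subgroup U \<Longrightarrow> H \<subseteq> U \<Longrightarrow> U \<subseteq> T \<Longrightarrow> z \<in> T \<Longrightarrow> z \<notin> U \<Longrightarrow> P U \<Longrightarrow> m > 0 \<Longrightarrow>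
      (\<And>j::int. of_int j * z \<in> U \<longleftrightarrow> int m dvd j) \<Longrightarrow> P (adjoin U z)"
  shows "P T"
proof -
  have "P T" if "add_subgroup U" "H \<subseteq> U" "U \<subseteq> T" "P U" for U
    using that
  proof (induction "idx T U" arbitrary: U rule: less_induct)
    case less
    have fin: "finite (cosets T U)"
      using finite_cosets_tower[OF assms(1) less.prems(1) assms(2) less.prems(2,3)] assms(4) by simp
    show ?case
    proof (cases "T = U")
      case False
      then obtain z where z: "z \<in> T" "z \<notin> U" using less.prems(3) by blast
      obtain m where m: "m > 0" "\<And>j::int. of_int j * z \<in> U \<longleftrightarrow> int m dvd j"
        using order_mod_finite_index[OF less.prems(1) assms(2) fin z(1)] by blast
      have m1: "m \<noteq> 1" using m(2)[of 1] z by auto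
      have A: "add_subgroup (adjoin U z)" "U \<subseteq> adjoin U z" "adjoin U z \<subseteq> T"
        using add_subgroup_adjoin[OF less.prems(1)] subset_adjoin adjoin_subset[OF assms(2) less.prems(3) z(1)]
        by blast+
      have e: "idx T (adjoin U z) * m = idx T U"
        using idx_tower[OF less.prems(1) A(1) assms(2) A(2,3)] idx_adjoin[OF less.prems(1) m] by simp
      then have "idx T (adjoin U z) > 0" using idx_pos[OF fin] z(1) by (intro gr0I) auto
      then have "idx T (adjoin U z) * 1 < idx T (adjoin U z) * m"
        using m(1) m1 by (intro mult_strict_left_mono) auto
      then have "idx T (adjoin U z) < idx T U" using e by simp
      moreover have "P (adjoin U z)" using step[OF less.prems(1-3) z less.prems(4) m] .
      ultimately show ?thesis using less.hyps A less.prems(2) by (meson subset_trans)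
    qed (use less in simp)
  qed
  then show ?thesis using assms by blast
qed

text \<open>Every order that occurs in a chain of cyclic extensions from H to T divides p^N.\<close>

lemma idx_prime_power:
  fixes H T :: "'a::ring_1 set"
  assumes "add_subgroup H" "add_subgroup T" "H \<subseteq> T" "finite (cosets T H)" and p: "prime p"
    and N: "\<And>x. x \<in> T \<Longrightarrow> of_nat (p ^ N) * x \<in> H"
  shows "\<exists>c. idx T H = p ^ c"
  using assms(1-4)
proof (induction rule: adjoin_induct)
  case base
  then show ?case using idx_self[OF assms(1)] by (metis power_0)
next
  case (step U z m)
  have "of_nat (p ^ N) * z \<in> U" using N[OF step.hyps(4)] step.hyps(2) by blast
  then have "m dvd p ^ N" using step.hyps(7)[of "int (p ^ N)"] by (metis int_dvd_int_iff of_int_of_nat_eq)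
  then obtain b where "m = p ^ b" using divides_primepow_nat[OF p] by blast
  moreover obtain c where "idx U H = p ^ c" using step.IH by blast
  moreover have "idx (adjoin U z) U * idx U H = idx (adjoin U z) H"
    using idx_tower[OF assms(1) step.hyps(1) add_subgroup_adjoin[OF step.hyps(1), of z] step.hyps(2) subset_adjoin] .
  ultimately have "idx (adjoin U z) H = p ^ (b + c)"
    using idx_adjoin[OF step.hyps(1,6,7)] by (simp add: power_add)
  then show ?case by blast
qed

lemma idx_annihilates:
  fixes H T :: "'a::ring_1 set"
  assumes H: "add_subgroup H" and T: "add_subgroup T" and HT: "H \<subseteq> T"
    and fin: "finite (cosets T H)" and x: "x \<in> T"
  shows "of_nat (idx T H) * x \<in> H"
proof -
  obtain m where m: "m > 0" "\<And>j::int. of_int j * x \<in> H \<longleftrightarrow> int m dvd j"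
    using order_mod_finite_index[OF H T fin x] by blast
  have "idx T (adjoin H x) * m = idx T H"
    using idx_tower[OF H add_subgroup_adjoin[OF H] T subset_adjoin adjoin_subset[OF T HT x]]
      idx_adjoin[OF H m] by simp
  then have "m dvd idx T H" by (metis dvd_triv_right)
  then show ?thesis using m(2)[of "int (idx T H)"] by simp
qed

section \<open>Characters\<close>

text \<open>The characters of T/U. Extensionality identifies those that agree on \<open>T\<close>,
  so that \<open>card\<close> counts them; values are nonzero by \<open>chars_diff\<close> once
  \<open>T\<close> and \<open>U\<close> are subgroups.\<close>

definition chars :: "'a::ring_1 set \<Rightarrow> 'a set \<Rightarrow> ('a \<Rightarrow> complex) set" where
  "chars T U = {\<xi> \<in> extensional T. (\<forall>x\<in>T. \<forall>y\<in>T. \<xi> (x + y) = \<xi> x * \<xi> y) \<and> (\<forall>x\<in>U. \<xi> x = 1)}"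

lemma charsD:
  assumes "\<xi> \<in> chars T U"
  shows "\<And>x y. x \<in> T \<Longrightarrow> y \<in> T \<Longrightarrow> \<xi> (x + y) = \<xi> x * \<xi> y" "\<And>x. x \<in> U \<Longrightarrow> \<xi> x = 1"
    "\<xi> \<in> extensional T"
  using assms unfolding chars_def by auto

lemma chars_diff:
  assumes "\<xi> \<in> chars T U" "add_subgroup T" "add_subgroup U" "x \<in> T" "y \<in> T"
  shows "\<xi> (x - y) * \<xi> y = \<xi> x" "\<xi> x \<noteq> 0"
proof -
  show "\<xi> (x - y) * \<xi> y = \<xi> x"
    using charsD(1)[OF assms(1), of "x - y" y] add_subgroupD(2)[OF assms(2,4,5)] assms(5) by simp
  have "\<xi> (x + (- x)) = \<xi> x * \<xi> (- x)"
    using charsD(1)[OF assms(1)] add_subgroupD(3)[OF assms(2)] assms(4) by blast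
  then show "\<xi> x \<noteq> 0" using charsD(2)[OF assms(1) add_subgroupD(1)[OF assms(3)]] by auto
qed

lemma chars_of_nat:
  assumes "\<xi> \<in> chars T U" "add_subgroup T" "add_subgroup U" "x \<in> T"
  shows "\<xi> (of_nat m * x) = \<xi> x ^ m"
proof (induction m)
  case 0
  then show ?case using charsD(2)[OF assms(1) add_subgroupD(1)[OF assms(3)]] by simp
next
  case (Suc m)
  then show ?case
    using charsD(1)[OF assms(1,4) add_subgroup_of_nat[OF assms(2,4), of m]] by (simp add: algebra_simps)
qed

lemma chars_of_int:
  assumes "\<xi> \<in> chars T U" "add_subgroup T" "add_subgroup U" "x \<in> T"
  shows "\<xi> (of_int m * x) = \<xi> x powi m"
proof (cases "m \<ge> 0")
  case True
  then show ?thesis using chars_of_nat[OF assms, of "nat m"] by (simp add: power_int_def)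
next
  case False
  have "\<xi> (of_int m * x) * \<xi> x ^ nat (- m) = \<xi> 0"
    using charsD(1)[OF assms(1) add_subgroup_of_int[OF assms(2,4), of m] add_subgroup_of_nat[OF assms(2,4), of "nat (- m)"]]
      chars_of_nat[OF assms, of "nat (- m)"] False by simp
  also have "\<dots> = 1" using charsD(2)[OF assms(1) add_subgroupD(1)[OF assms(3)]] .
  finally show ?thesis using False chars_diff(2)[OF assms(1-4,4)] by (simp add: power_int_def field_simps)
qed

lemma chars_mono: "U \<subseteq> V \<Longrightarrow> chars T V \<subseteq> chars T U"
  unfolding chars_def by blast

lemma restrict_chars:
  assumes "\<xi> \<in> chars T U" "H \<subseteq> T" "U \<subseteq> H" "add_subgroup H"
  shows "restrict \<xi> H \<in> chars H U"
proof -
  have "x + y \<in> H" if "x \<in> H" "y \<in> H" for x y using add_subgroupD(4)[OF assms(4) that] .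
  then show ?thesis using assms(1-3) unfolding chars_def by (auto simp: subset_iff)
qed

text \<open>An extension of \<xi> to H + Zz is determined by its value w at \<open>z\<close>, and
  the only condition on w is w^m = \<xi>(m z), where m is the order of \<open>z\<close> modulo
  \<open>H\<close>.\<close>

lemma chars_adjoin:
  assumes H: "add_subgroup H" and U: "U \<subseteq> H" "add_subgroup U" and m: "m > 0"
    "\<And>j::int. of_int j * z \<in> H \<longleftrightarrow> int m dvd j" and \<xi>: "\<xi> \<in> chars H U"
  shows "bij_betw (\<lambda>\<psi>. \<psi> z) {\<psi> \<in> chars (adjoin H z) U. restrict \<psi> H = \<xi>} {w. w ^ m = \<xi> (of_nat m * z)}"
proof -
  let ?A = "adjoin H z"
  have A: "add_subgroup ?A" "H \<subseteq> ?A" "z \<in> ?A"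
    using add_subgroup_adjoin[OF H] subset_adjoin adjoin_self[OF H] by auto
  have mz: "of_nat m * z \<in> H" using m(2)[of "int m"] by simp
  have val: "\<psi> (h + of_int j * z) = \<xi> h * \<psi> z powi j"
    if "\<psi> \<in> chars ?A U" "restrict \<psi> H = \<xi>" "h \<in> H" for \<psi> h j
  proof -
    have "h \<in> ?A" using that(3) A(2) by blast
    then have "\<psi> (h + of_int j * z) = \<psi> h * \<psi> (of_int j * z)"
      using charsD(1)[OF that(1)] add_subgroup_of_int[OF A(1,3)] by blast
    then show ?thesis using chars_of_int[OF that(1) A(1) U(2) A(3)] that(2,3) by (metis restrict_apply')
  qed
  show ?thesis unfolding bij_betw_def
  proof
    show "inj_on (\<lambda>\<psi>. \<psi> z) {\<psi> \<in> chars ?A U. restrict \<psi> H = \<xi>}"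
    proof (rule inj_onI, clarify)
      fix \<psi> \<psi>' assume *: "\<psi> \<in> chars ?A U" "\<psi>' \<in> chars ?A U" "\<psi> z = \<psi>' z" "\<xi> = restrict \<psi> H"
        "restrict \<psi>' H = restrict \<psi> H"
      show "\<psi> = \<psi>'"
      proof (rule extensionalityI[OF charsD(3)[OF *(1)] charsD(3)[OF *(2)]])
        fix x assume "x \<in> ?A"
        then obtain h j where "h \<in> H" "x = h + of_int j * z" unfolding adjoin_def by blast
        then show "\<psi> x = \<psi>' x" using val[of \<psi> h j] val[of \<psi>' h j] * by simp
      qed
    qed
    show "(\<lambda>\<psi>. \<psi> z) ` {\<psi> \<in> chars ?A U. restrict \<psi> H = \<xi>} = {w. w ^ m = \<xi> (of_nat m * z)}"
    proof (intro equalityI subsetI)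
      fix w assume "w \<in> (\<lambda>\<psi>. \<psi> z) ` {\<psi> \<in> chars ?A U. restrict \<psi> H = \<xi>}"
      then obtain \<psi> where \<psi>: "\<psi> \<in> chars ?A U" "restrict \<psi> H = \<xi>" "w = \<psi> z" by blast
      then show "w \<in> {w. w ^ m = \<xi> (of_nat m * z)}"
        using chars_of_nat[OF \<psi>(1) A(1) U(2) A(3), of m] mz by auto
    next
      fix w assume "w \<in> {w. w ^ m = \<xi> (of_nat m * z)}"
      then have w: "w ^ m = \<xi> (of_nat m * z)" by simp
      have w0: "w \<noteq> 0" using w chars_diff(2)[OF \<xi> H U(2) mz mz] m(1) by (auto simp: power_0_left)
      \<comment> \<open>Well-definedness: two expressions of one element differ by a multiple of m
        z, and there \<xi> agrees with the powers of w by the choice of w.\<close>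
      have wd: "\<xi> h * w powi j = \<xi> h' * w powi j'"
        if h: "h \<in> H" "h' \<in> H" and e: "h + of_int j * z = h' + of_int j' * z" for h h' j j'
      proof -
        have e1: "of_int (j - j') * z = h' - h" using e by (simp add: algebra_simps)
        then have "of_int (j - j') * z \<in> H" using add_subgroupD(2)[OF H] h by simp
        then obtain q where q: "j - j' = int m * q" using m(2) by blast
        have "h' - h = of_int q * (of_nat m * z)" using e1 q by (metis mult.assoc mult.commute of_int_mult of_int_of_nat_eq)
        then have "\<xi> (h' - h) = (w ^ m) powi q" using chars_of_int[OF \<xi> H U(2) mz] w by simp
        also have "\<dots> = w powi (j - j')" unfolding q by (simp add: power_int_mult)
        finally have "\<xi> h' = w powi (j - j') * \<xi> h" using chars_diff(1)[OF \<xi> H U(2) h(2,1)] by simp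
        then show ?thesis using w0 by (simp add: power_int_diff)
      qed
      define \<psi> where "\<psi> = (\<lambda>x\<in>?A. THE v. \<exists>h\<in>H. \<exists>j::int. x = h + of_int j * z \<and> v = \<xi> h * w powi j)"
      have \<psi>: "\<psi> (h + of_int j * z) = \<xi> h * w powi j" if "h \<in> H" for h j
      proof -
        have "(THE v. \<exists>h'\<in>H. \<exists>j'::int. h + of_int j * z = h' + of_int j' * z \<and> v = \<xi> h' * w powi j') = \<xi> h * w powi j"
          using that wd by (intro the_equality) (blast, metis)
        then show ?thesis unfolding \<psi>_def using adjoin_mem[OF that] by simp
      qed
      have \<psi>H: "\<psi> h = \<xi> h" if "h \<in> H" for h using \<psi>[OF that, of 0] by simp
      have "\<psi> (x + y) = \<psi> x * \<psi> y" if xy: "x \<in> ?A" "y \<in> ?A" for x y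
      proof -
        obtain h j h' j' where *: "h \<in> H" "x = h + of_int j * z" "h' \<in> H" "y = h' + of_int j' * z"
          using xy unfolding adjoin_def by blast
        have "x + y = (h + h') + of_int (j + j') * z" using * by (simp add: algebra_simps)
        then have "\<psi> (x + y) = \<xi> (h + h') * w powi (j + j')"
          using \<psi>[OF add_subgroupD(4)[OF H *(1,3)], of "j + j'"] by simp
        then show ?thesis using * \<psi> charsD(1)[OF \<xi> *(1,3)] w0 by (simp add: power_int_add)
      qed
      moreover have "\<psi> \<in> extensional ?A" unfolding \<psi>_def by simp
      moreover have "\<psi> x = 1" if "x \<in> U" for x using \<psi>H charsD(2)[OF \<xi> that] U(1) that by auto
      ultimately have 1: "\<psi> \<in> chars ?A U" unfolding chars_def by blast
      have 2: "restrict \<psi> H = \<xi>"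
        by (rule extensionalityI[OF restrict_extensional charsD(3)[OF \<xi>]]) (simp add: \<psi>H)
      have "\<psi> z = w" using \<psi>[OF add_subgroupD(1)[OF H], of 1] charsD(2)[OF \<xi> add_subgroupD(1)[OF U(2)]] by simp
      then show "w \<in> (\<lambda>\<psi>. \<psi> z) ` {\<psi> \<in> chars ?A U. restrict \<psi> H = \<xi>}" using 1 2 by blast
    qed
  qed
qed

text \<open>In a chain of cyclic extensions each step of order m multiplies the number of characters
  by m, because a nonzero complex number has m roots of order m.\<close>

lemma card_chars:
  fixes U T :: "'a::ring_1 set"
  assumes "add_subgroup U" "add_subgroup T" "U \<subseteq> T" "finite (cosets T U)"
  shows "finite (chars T U) \<and> card (chars T U) = idx T U"
  using assms
proof (induction rule: adjoin_induct)
  case base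
  have "chars U U = {\<lambda>x\<in>U. 1}"
  proof (intro equalityI subsetI)
    fix \<xi> assume "\<xi> \<in> chars U U"
    then have "\<xi> = (\<lambda>x\<in>U. 1)" by (intro extensionalityI[OF charsD(3) restrict_extensional]) (auto dest: charsD)
    then show "\<xi> \<in> {\<lambda>x\<in>U. 1}" by simp
  qed (use add_subgroupD(4)[OF assms(1)] in \<open>auto simp: chars_def\<close>)
  then show ?case using idx_self[OF assms(1)] by simp
next
  case (step H z m)
  let ?A = "adjoin H z"
  let ?F = "\<lambda>\<xi>. {\<psi> \<in> chars ?A U. restrict \<psi> H = \<xi>}"
  have mz: "of_nat m * z \<in> H" using step.hyps(7)[of "int m"] by simp
  have F: "finite (?F \<xi>) \<and> card (?F \<xi>) = m" if "\<xi> \<in> chars H U" for \<xi>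
  proof -
    note b = chars_adjoin[OF step.hyps(1,2) assms(1) step.hyps(6,7) that]
    have "\<xi> (of_nat m * z) \<noteq> 0" using chars_diff(2)[OF that step.hyps(1) assms(1) mz mz] .
    then have "card {w. w ^ m = \<xi> (of_nat m * z)} = m" using card_nth_roots step.hyps(6) by blast
    then have "card (?F \<xi>) = m" using bij_betw_same_card[OF b] by simp
    then show ?thesis using step.hyps(6) card_ge_0_finite[of "?F \<xi>"] by simp
  qed
  have "chars ?A U = (\<Union>\<xi>\<in>chars H U. ?F \<xi>)"
    using restrict_chars[OF _ subset_adjoin step.hyps(2,1)] by blast
  moreover have "finite (\<Union>\<xi>\<in>chars H U. ?F \<xi>)" using step.IH F by blast
  moreover have "card (\<Union>\<xi>\<in>chars H U. ?F \<xi>) = (\<Sum>\<xi>\<in>chars H U. card (?F \<xi>))"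
    using step.IH F by (intro card_UN_disjoint) auto
  ultimately have "finite (chars ?A U)" "card (chars ?A U) = idx H U * m" using F step.IH by auto
  moreover have "idx ?A H * idx H U = idx ?A U"
    using idx_tower[OF assms(1) step.hyps(1) add_subgroup_adjoin[OF step.hyps(1), of z] step.hyps(2) subset_adjoin] .
  ultimately show ?case using idx_adjoin[OF step.hyps(1,6,7)] by (simp add: mult.commute)
qed

text \<open>The map sending \<open>x\<close> to \<open>\<beta> x\<close> embeds \<open>X/X0\<close> into the characters of \<open>H/Y\<close>.\<close>

lemma idx_pairing:
  fixes X X0 H Y :: "'a::ring_1 set"
  assumes X: "add_subgroup X" and H: "add_subgroup H" and Y: "add_subgroup Y" "Y \<subseteq> H" "finite (cosets H Y)"
    and X0: "add_subgroup X0"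
    and b: "\<And>x y y'. x \<in> X \<Longrightarrow> y \<in> H \<Longrightarrow> y' \<in> H \<Longrightarrow> \<beta> x (y + y') = \<beta> x y * \<beta> x y'"
      "\<And>x x' y. x \<in> X \<Longrightarrow> x' \<in> X \<Longrightarrow> y \<in> H \<Longrightarrow> \<beta> (x - x') y * \<beta> x' y = \<beta> x y"
      "\<And>x y. x \<in> X \<Longrightarrow> y \<in> Y \<Longrightarrow> \<beta> x y = (1::complex)"
    and k: "\<And>x. x \<in> X \<Longrightarrow> (\<And>y. y \<in> H \<Longrightarrow> \<beta> x y = 1) \<Longrightarrow> x \<in> X0"
  shows "idx X X0 \<le> idx H Y" "finite (cosets X X0)"
proof -
  have mem: "restrict (\<beta> x) H \<in> chars H Y" if "x \<in> X" for x
    using that b(1)[OF that] b(3)[OF that] Y(2) add_subgroupD(4)[OF H] unfolding chars_def by auto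
  have eq: "x - x' \<in> X0" if x: "x \<in> X" "x' \<in> X" "restrict (\<beta> x) H = restrict (\<beta> x') H" for x x'
  proof (rule k)
    show "x - x' \<in> X" using add_subgroupD(2)[OF X x(1,2)] .
    fix y assume y: "y \<in> H"
    have "\<beta> x' y \<noteq> 0"
      using chars_diff(2)[OF mem[OF x(2)] H Y(1) y y] y by simp
    moreover have "\<beta> x y = \<beta> x' y" using x(3) y by (metis restrict_apply')
    ultimately show "\<beta> (x - x') y = 1" using b(2)[OF x(1,2) y] by simp
  qed
  define r where "r c = restrict (\<beta> (SOME x. x \<in> X \<and> (+) x ` X0 = c)) H" for c
  have r: "\<exists>x\<in>X. (+) x ` X0 = c \<and> r c = restrict (\<beta> x) H" if "c \<in> cosets X X0" for c
  proof -
    have "\<exists>x. x \<in> X \<and> (+) x ` X0 = c" using that unfolding cosets_def by blast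
    from someI_ex[OF this] show ?thesis unfolding r_def by blast
  qed
  have "inj_on r (cosets X X0)"
  proof (rule inj_onI)
    fix c d assume cd: "c \<in> cosets X X0" "d \<in> cosets X X0" "r c = r d"
    obtain x y where "x \<in> X" "y \<in> X" "(+) x ` X0 = c" "(+) y ` X0 = d" "r c = restrict (\<beta> x) H" "r d = restrict (\<beta> y) H"
      using r[OF cd(1)] r[OF cd(2)] by blast
    then show "c = d" using eq cd(3) coset_eq_iff[OF X0] by metis
  qed
  moreover have "r ` cosets X X0 \<subseteq> chars H Y"
  proof
    fix \<psi> assume "\<psi> \<in> r ` cosets X X0"
    then obtain c where c: "c \<in> cosets X X0" "\<psi> = r c" by blast
    then show "\<psi> \<in> chars H Y" using r[OF c(1)] mem by metis
  qed
  ultimately show "idx X X0 \<le> idx H Y" "finite (cosets X X0)"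
    using card_chars[OF Y(1) H Y(2,3)] card_inj_on_le[of r _ "chars H Y"]
      inj_on_finite[of r _ "chars H Y"] unfolding idx_def by simp_all
qed

section \<open>Ideals of a ring that is reduced modulo a prime\<close>

definition ideal_of :: "'a::comm_ring_1 set \<Rightarrow> 'a set \<Rightarrow> bool" where
  "ideal_of R I \<longleftrightarrow> add_subgroup I \<and> I \<subseteq> R \<and> (\<forall>x\<in>I. \<forall>y\<in>R. x * y \<in> I)"

lemma ideal_ofD:
  assumes "ideal_of R I"
  shows "add_subgroup I" "I \<subseteq> R" "\<And>x y. x \<in> I \<Longrightarrow> y \<in> R \<Longrightarrow> x * y \<in> I"
    "\<And>x y. x \<in> I \<Longrightarrow> y \<in> R \<Longrightarrow> y * x \<in> I"
  using assms unfolding ideal_of_def by (auto simp: mult.commute)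

text \<open>The properties of the ring of integers from which the bounds are derived: R/p has at
  most p^n elements and no nonzero nilpotents (\<open>reduced\<close> says this for squares,
  \<open>power_in_pw_1\<close> for all powers).\<close>

locale prime_reduced =
  fixes R :: "'a::comm_ring_1 set" and p n :: nat
  assumes R_sub: "add_subgroup R" and R_1: "1 \<in> R"
    and R_mult: "\<And>x y. x \<in> R \<Longrightarrow> y \<in> R \<Longrightarrow> x * y \<in> R"
    and p: "prime p"
    and fin_p: "finite (cosets R ((*) (of_nat p) ` R))"
    and idx_p: "idx R ((*) (of_nat p) ` R) \<le> p ^ n"
    and reduced: "\<And>x. x \<in> R \<Longrightarrow> x * x \<in> (*) (of_nat p) ` R \<Longrightarrow> x \<in> (*) (of_nat p) ` R"
begin

definition pw :: "nat \<Rightarrow> 'a set" where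
  "pw i = (*) (of_nat (p ^ i)) ` R"

lemmas R_closed = add_subgroupD[OF R_sub] R_mult R_1

lemma R_of_nat: "of_nat m \<in> R"
  using add_subgroup_of_nat[OF R_sub R_1, of m] by simp

lemma R_power: "x \<in> R \<Longrightarrow> x ^ m \<in> R"
  by (induction m) (auto intro: R_closed)

lemma pwI: "x \<in> R \<Longrightarrow> of_nat (p ^ i) * x \<in> pw i"
  unfolding pw_def by blast

lemma ideal_pw: "ideal_of R (pw i)"
  unfolding ideal_of_def add_subgroup_def
proof (intro conjI ballI)
  show "0 \<in> pw i" using pwI[of 0 i] R_closed by simp
  show "pw i \<subseteq> R" unfolding pw_def using R_mult R_of_nat by blast
next
  fix x y assume "x \<in> pw i" "y \<in> pw i"
  then obtain a b where ab: "a \<in> R" "b \<in> R" "x = of_nat (p ^ i) * a" "y = of_nat (p ^ i) * b"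
    unfolding pw_def by blast
  then show "x - y \<in> pw i" using pwI[OF R_closed(2)[OF ab(1,2)], of i] by (simp add: algebra_simps)
next
  fix x y assume "x \<in> pw i" "y \<in> R"
  then obtain a where a: "a \<in> R" "x = of_nat (p ^ i) * a" "y \<in> R"
    unfolding pw_def by blast
  then show "x * y \<in> pw i" using pwI[OF R_mult[OF a(1,3)], of i] by (simp add: algebra_simps)
qed

lemmas pw = ideal_ofD[OF ideal_pw]

lemma pw_antimono: "j \<le> i \<Longrightarrow> pw i \<subseteq> pw j"
proof
  fix x assume "j \<le> i" "x \<in> pw i"
  then obtain a where a: "a \<in> R" "x = of_nat (p ^ i) * a" unfolding pw_def by blast
  have "p ^ i = p ^ j * p ^ (i - j)" using \<open>j \<le> i\<close> by (simp flip: power_add)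
  then have "x = of_nat (p ^ j) * (of_nat (p ^ (i - j)) * a)"
    unfolding a(2) by (metis mult.assoc of_nat_mult)
  then show "x \<in> pw j" using pwI[OF R_mult[OF R_of_nat a(1)]] by metis
qed

lemma pw_mult: "x \<in> pw i \<Longrightarrow> y \<in> pw j \<Longrightarrow> x * y \<in> pw (i + j)"
proof -
  assume "x \<in> pw i" "y \<in> pw j"
  then obtain a b where ab: "a \<in> R" "b \<in> R" "x = of_nat (p ^ i) * a" "y = of_nat (p ^ j) * b"
    unfolding pw_def by blast
  then have "x * y = of_nat (p ^ (i + j)) * (a * b)" by (simp add: power_add algebra_simps)
  then show ?thesis using pwI[OF R_mult[OF ab(1,2)]] by simp
qed

lemma pw_1: "pw 1 = (*) (of_nat p) ` R"
  unfolding pw_def by simp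

lemma idx_pos_finite: "idx T H > 0 \<Longrightarrow> finite (cosets T H)"
  unfolding idx_def by (rule card_ge_0_finite)

lemma finite_cosets_antimono:
  assumes "add_subgroup H" "add_subgroup U" "add_subgroup T" "H \<subseteq> U" "U \<subseteq> T" "finite (cosets T H)"
  shows "finite (cosets T U)" "idx T U \<le> idx T H"
proof -
  have f: "finite (cosets T U)" "finite (cosets U H)" using finite_cosets_tower[OF assms(1-5)] assms(6) by auto
  then show "finite (cosets T U)" by blast
  have "idx U H > 0" using idx_pos[OF f(2)] add_subgroupD(1)[OF assms(2)] by blast
  then have "idx T U * 1 \<le> idx T U * idx U H" by (intro mult_le_mono) auto
  then show "idx T U \<le> idx T H" using idx_tower[OF assms(1-5)] by simp
qed

text \<open>Multiplication by p^i maps R onto \<open>pw i\<close> and pR into the next power, so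
  every successive quotient is an image of R/p.\<close>

lemma finite_pw: "finite (cosets R (pw i))"
proof (induction i)
  case 0
  have "pw 0 = R" unfolding pw_def by simp
  then show ?case using finite_cosets_self[OF R_sub] by simp
next
  case (Suc i)
  let ?f = "(*) (of_nat (p ^ i)) :: 'a \<Rightarrow> 'a"
  let ?K = "{x\<in>R. ?f x \<in> pw (Suc i)}"
  have h: "idx R ?K = idx (?f ` R) (pw (Suc i))" "add_subgroup ?K"
    using idx_hom[OF R_sub pw(1), of ?f "Suc i"] by (auto simp: algebra_simps)
  have "pw 1 \<subseteq> ?K"
    using pw_mult[OF pwI[OF R_1, of i], of _ 1] pw(2)[of 1] by auto
  then have "finite (cosets R ?K)"
    using finite_cosets_antimono(1)[OF pw(1) h(2) R_sub, of 1] fin_p pw_1 by auto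
  then have "idx R ?K > 0" using idx_pos R_1 by blast
  then have "finite (cosets (pw i) (pw (Suc i)))"
    using idx_pos_finite[of "?f ` R" "pw (Suc i)"] h(1) unfolding pw_def[of i] by simp
  then show ?case using finite_cosets_tower[OF pw(1) pw(1) R_sub pw_antimono pw(2), of i "Suc i"] Suc by simp
qed

text \<open>The exponent 2^N is at least N, and \<open>reduced\<close> removes one squaring at a
  time.\<close>

lemma power_in_pw_1:
  assumes "w \<in> R" "w ^ N \<in> pw 1"
  shows "w \<in> pw 1"
proof -
  have step: "w ^ (2 ^ m) \<in> pw 1 \<Longrightarrow> w \<in> pw 1" for m
  proof (induction m)
    case (Suc m)
    have "w ^ (2 ^ m) * w ^ (2 ^ m) \<in> pw 1" using Suc.prems by (simp add: mult_2 flip: power_add)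
    then have "w ^ (2 ^ m) \<in> pw 1" unfolding pw_1 by (rule reduced[OF R_power[OF assms(1)]])
    then show ?case by (rule Suc.IH)
  qed simp
  have "N \<le> 2 ^ N" using less_exp[of N] by simp
  then have "w ^ (2 ^ N) = w ^ N * w ^ (2 ^ N - N)" by (simp flip: power_add)
  then show ?thesis using step[of N] pw(3)[OF assms(2) R_power[OF assms(1)]] by simp
qed

text \<open>The powers of w become periodic in the finite ring R/p^i; an exponent that is a multiple
  of the period, beyond the start of periodicity, gives an idempotent.\<close>

lemma power_idempotent:
  assumes w: "w \<in> R"
  shows "\<exists>N\<ge>1. w ^ N * w ^ N - w ^ N \<in> pw i"
proof -
  let ?f = "\<lambda>m. (+) (w ^ m) ` pw i"
  have "range ?f \<subseteq> cosets R (pw i)" unfolding cosets_def using R_power[OF w] by blast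
  then have "\<not> inj ?f" using finite_subset[OF _ finite_pw] finite_imageD[of ?f UNIV] by auto
  then obtain m l where ml: "m < l" "?f m = ?f l" unfolding inj_def by (metis linorder_neqE_nat)
  then have d: "w ^ l - w ^ m \<in> pw i" using coset_eq_iff[OF pw(1)] by metis
  have per: "w ^ (t + (l - m) * q) - w ^ t \<in> pw i" if "t \<ge> m" for t q
  proof (induction q)
    case 0
    then show ?case using add_subgroupD(1)[OF pw(1)] by simp
  next
    case (Suc q)
    let ?t = "t + (l - m) * q"
    have "t + (l - m) * Suc q = l + (?t - m)" "?t = m + (?t - m)" using that ml(1) by auto
    then have "w ^ (t + (l - m) * Suc q) - w ^ ?t = (w ^ l - w ^ m) * w ^ (?t - m)"
      by (metis left_diff_distrib power_add)
    then have "w ^ (t + (l - m) * Suc q) - w ^ ?t \<in> pw i" using pw(3)[OF d R_power[OF w]] by simp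
    then show ?case using add_subgroupD(4)[OF pw(1) _ Suc, of "w ^ (t + (l - m) * Suc q) - w ^ ?t"] by simp
  qed
  \<comment> \<open>A multiple of the period l - m that is at least m and at least 1.\<close>
  define N where "N = (l - m) * Suc m"
  have "N \<ge> Suc m" unfolding N_def using ml(1) by (cases "l - m") auto
  then have "N \<ge> m" "N \<ge> 1" by auto
  then show ?thesis using per[of N "Suc m"] unfolding N_def[symmetric]
    by (intro exI[of _ N]) (simp add: power_add)
qed

definition local_idempotent :: "nat \<Rightarrow> 'a \<Rightarrow> bool" where
  "local_idempotent i e \<longleftrightarrow> e \<in> R \<and> e * e - e \<in> pw i \<and>
     (\<forall>x\<in>R. e * x \<in> pw 1 \<or> (\<exists>y\<in>R. e * x * y - e \<in> pw i))"

text \<open>This is eR + pR. Its index over pR is the size of the component of \<open>e\<close>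
  modulo p; the splitting is by induction on that size, which also bounds the number of
  idempotents.\<close>

definition span_mod_p :: "'a \<Rightarrow> 'a set" where
  "span_mod_p e = {e * x + y | x y. x \<in> R \<and> y \<in> pw 1}"

lemma add_subgroup_span_mod_p: "e \<in> R \<Longrightarrow> add_subgroup (span_mod_p e)"
  unfolding add_subgroup_def span_mod_p_def
proof safe
  show "\<exists>x y. 0 = e * x + y \<and> x \<in> R \<and> y \<in> pw 1"
    using R_closed(1) add_subgroupD(1)[OF pw(1), of 1] by (intro exI[of _ 0]) simp
  fix x y x' y' assume "x \<in> R" "x' \<in> R" "y \<in> pw 1" "y' \<in> pw 1"
  then show "\<exists>u v. e * x + y - (e * x' + y') = e * u + v \<and> u \<in> R \<and> v \<in> pw 1"
    using R_closed(2) add_subgroupD(2)[OF pw(1), of y 1 y']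
    by (intro exI[of _ "x - x'"] exI[of _ "y - y'"]) (auto simp: algebra_simps)
qed

lemma span_mod_p_sub:
  assumes "e \<in> R"
  shows "pw 1 \<subseteq> span_mod_p e" "span_mod_p e \<subseteq> R" "e \<in> span_mod_p e"
proof -
  have mem: "e * x + y \<in> span_mod_p e" if "x \<in> R" "y \<in> pw 1" for x y
    using that unfolding span_mod_p_def by blast
  show "pw 1 \<subseteq> span_mod_p e" using mem[OF R_closed(1)] by auto
  show "span_mod_p e \<subseteq> R"
  proof
    fix z assume "z \<in> span_mod_p e"
    then obtain x y where "x \<in> R" "y \<in> pw 1" "z = e * x + y" unfolding span_mod_p_def by blast
    then show "z \<in> R" using R_mult[OF assms] R_closed(4) pw(2) by blast
  qed
  show "e \<in> span_mod_p e" using mem[OF R_1 add_subgroupD(1)[OF pw(1)]] by simp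
qed

text \<open>If p divides \<open>e\<close>, then p^i divides e^i, and an idempotent is congruent to
  all its powers.\<close>

lemma idempotent_notin_pw_1:
  assumes i: "i \<ge> 1" and e: "e \<in> R" "e * e - e \<in> pw i" "e \<in> pw 1"
  shows "e \<in> pw i"
proof -
  have "e ^ m \<in> pw m" for m
    by (induction m) (use e pw_mult[of e 1] in \<open>auto simp: pw_def R_1\<close>)
  moreover have "e ^ m - e \<in> pw i" if "m \<ge> 1" for m
    using that
  proof (induction m rule: dec_induct)
    case base
    then show ?case using add_subgroupD(1)[OF pw(1)] by simp
  next
    case (step m)
    have "e ^ Suc m - e = e * (e ^ m - e) + (e * e - e)" by (simp add: algebra_simps)
    then show ?case using add_subgroupD(4)[OF pw(1) pw(4)[OF step.IH e(1)] e(2)] by metis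
  qed
  ultimately show ?thesis using add_subgroupD(2)[OF pw(1), of "e ^ i" i "e ^ i - e"] i by simp
qed

text \<open>If \<open>e\<close> is not local, some multiple e x is neither zero modulo p nor
  invertible in the component; an idempotent power of it splits \<open>e\<close> into two nonzero
  idempotents with smaller components.\<close>

lemma local_decomposition:
  assumes i: "i \<ge> 1" and e: "e \<in> R" "e * e - e \<in> pw i"
  shows "\<exists>es. (\<forall>f\<in>set es. local_idempotent i f) \<and> sum_list es - e \<in> pw i \<and>
    p ^ length es \<le> idx (span_mod_p e) (pw 1)"
  using e
proof (induction "idx (span_mod_p e) (pw 1)" arbitrary: e rule: less_induct)
  case less
  note e = less.prems
  have fin: "finite (cosets (span_mod_p f) (pw 1))" if "f \<in> R" for f
    using finite_cosets_mono[OF finite_pw span_mod_p_sub(2)[OF that]] .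
  have pos: "idx (span_mod_p f) (pw 1) > 0" if "f \<in> R" for f
    using idx_pos[OF fin[OF that]] span_mod_p_sub(3)[OF that] by blast
  have gep: "p \<le> idx (span_mod_p f) (pw 1)" if f: "f \<in> R" "f * f - f \<in> pw i" "f \<notin> pw i" for f
  proof -
    note sub = add_subgroup_span_mod_p[OF f(1)]
    obtain c where c: "idx (span_mod_p f) (pw 1) = p ^ c"
      using idx_prime_power[OF pw(1) sub span_mod_p_sub(1)[OF f(1)] fin[OF f(1)] p, of 1]
        pwI[of _ 1] span_mod_p_sub(2)[OF f(1)] by blast
    have "c \<noteq> 0"
    proof
      assume "c = 0"
      then have "span_mod_p f = pw 1"
        using idx_1_iff[OF pw(1) sub span_mod_p_sub(1)[OF f(1)]] c by simp
      then show False using span_mod_p_sub(3)[OF f(1)] idempotent_notin_pw_1[OF i f(1,2)] f(3) by blast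
    qed
    then show ?thesis unfolding c using prime_gt_0_nat[OF p] by (metis Suc_leI gr0I power_increasing power_one_right One_nat_def)
  qed
  show ?case
  proof (cases "e \<in> pw i")
    case True
    then show ?thesis using pos[OF e(1)] add_subgroupD(3)[OF pw(1)] by (intro exI[of _ "[]"]) auto
  next
    case enz: False
    show ?thesis
    proof (cases "local_idempotent i e")
      case True
      then show ?thesis using gep[OF e enz] add_subgroupD(1)[OF pw(1)] by (intro exI[of _ "[e]"]) simp
    next
      case False
      then obtain x where x: "x \<in> R" "e * x \<notin> pw 1" "\<And>y. y \<in> R \<Longrightarrow> e * x * y - e \<notin> pw i"
        unfolding local_idempotent_def using e by blast
      obtain N where N: "N \<ge> 1" "(e * x) ^ N * (e * x) ^ N - (e * x) ^ N \<in> pw i"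
        using power_idempotent[OF R_mult[OF e(1) x(1)]] by blast
      define w where "w = (e * x) ^ N"
      have w: "w \<in> R" "w * w - w \<in> pw i" using N R_power[OF R_mult[OF e(1) x(1)]] unfolding w_def by auto
      define f where "f = e * w"
      define g where "g = e - f"
      have ew: "e * w - w \<in> pw i"
      proof -
        have "e * w - w = (e * e - e) * (x * (e * x) ^ (N - 1))"
          unfolding w_def using N(1) by (cases N) (auto simp: algebra_simps)
        then show ?thesis using pw(3)[OF e(2) R_mult[OF x(1) R_power[OF R_mult[OF e(1) x(1)]]]] by simp
      qed
      have fR: "f \<in> R" "g \<in> R" unfolding f_def g_def using e w R_closed by auto
      have ef: "e * f - f \<in> pw i"
        using pw(4)[OF ew e(1)] unfolding f_def by (simp add: algebra_simps)
      have ff: "f * f - f \<in> pw i"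
      proof -
        have "f * f - f = (e * e - e) * (w * w) + e * (w * w - w)" unfolding f_def by (simp add: algebra_simps)
        then show ?thesis using pw(3)[OF e(2) R_mult[OF w(1,1)]] pw(4)[OF w(2) e(1)] add_subgroupD(4)[OF pw(1)] by simp
      qed
      have fg: "f * g \<in> pw i"
      proof -
        have "f * g = (e * f - f) - (f * f - f)" unfolding g_def by (simp add: algebra_simps)
        then show ?thesis using add_subgroupD(2)[OF pw(1) ef ff] by simp
      qed
      have gg: "g * g - g \<in> pw i"
      proof -
        have "g * g - g = (e * e - e) - (e * f - f) - f * g" unfolding g_def by (simp add: algebra_simps)
        then show ?thesis using add_subgroupD(2)[OF pw(1) add_subgroupD(2)[OF pw(1) e(2) ef] fg] by simp
      qed
      \<comment> \<open>Here reducedness enters: a nonzero element modulo p has no power that is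
        zero modulo p.\<close>
      have fnz: "f \<notin> pw i"
      proof
        assume "f \<in> pw i"
        then have "f - (e * w - w) \<in> pw i" using add_subgroupD(2)[OF pw(1) _ ew] by blast
        then have "(e * x) ^ N \<in> pw 1" using pw_antimono[OF i] unfolding f_def w_def by auto
        then show False using power_in_pw_1[OF R_mult[OF e(1) x(1)]] x(2) by blast
      qed
      \<comment> \<open>Otherwise the power (e x)^N is the identity of the component and (e x)^(N -
        1) inverts e x.\<close>
      have gnz: "g \<notin> pw i"
      proof
        assume g: "g \<in> pw i"
        let ?y = "(e * x) ^ (N - 1)"
        have "e * x * ?y - e = - g - (e * w - w)"
          unfolding g_def f_def w_def using N(1) by (cases N) (auto simp: algebra_simps)
        then have "e * x * ?y - e \<in> pw i" using add_subgroupD(2)[OF pw(1) add_subgroupD(3)[OF pw(1) g] ew] by simp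
        then show False using x(3) R_power[OF R_mult[OF e(1) x(1)]] by blast
      qed
      have "h \<in> span_mod_p e" if "e * h - h \<in> pw i" "h \<in> R" for h
      proof -
        have "h = e * h + - (e * h - h)" by simp
        then show ?thesis unfolding span_mod_p_def
          using that add_subgroupD(3)[OF pw(1), of "e * h - h" 1] pw_antimono[OF i] by blast
      qed
      have sub: "span_mod_p h \<subseteq> span_mod_p e" if h: "e * h - h \<in> pw i" "h \<in> R" for h
      proof
        fix z assume "z \<in> span_mod_p h"
        then obtain a b where ab: "a \<in> R" "b \<in> pw 1" "z = h * a + b" unfolding span_mod_p_def by blast
        have "z = e * (h * a) + (b - (e * h - h) * a)" using ab by (simp add: algebra_simps)
        moreover have "b - (e * h - h) * a \<in> pw 1"
          using add_subgroupD(2)[OF pw(1) ab(2)] pw(3)[OF h(1) ab(1)] pw_antimono[OF i] by blast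
        ultimately show "z \<in> span_mod_p e" unfolding span_mod_p_def using R_mult[OF h(2) ab(1)] by blast
      qed
      have eg: "e * g - g \<in> pw i"
      proof -
        have "e * g - g = (e * e - e) - (e * f - f)" unfolding g_def by (simp add: algebra_simps)
        then show ?thesis using add_subgroupD(2)[OF pw(1) e(2) ef] by simp
      qed
      \<comment> \<open>The components of f and g meet only in pR, because f g vanishes modulo p^i;
        hence the product of their sizes is at most the size for e.\<close>
      have "idx (span_mod_p g) (pw 1) \<le> idx (span_mod_p e) (span_mod_p f)"
      proof -
        have "{z \<in> span_mod_p g. z \<in> span_mod_p f} = pw 1"
        proof (intro equalityI subsetI)
          fix z assume "z \<in> {z \<in> span_mod_p g. z \<in> span_mod_p f}"
          then obtain a b c d where z: "a \<in> R" "b \<in> pw 1" "z = g * a + b" "c \<in> R" "d \<in> pw 1" "z = f * c + d"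
            unfolding span_mod_p_def by blast
          have "z = - ((g * g - g) * a) + f * g * c + g * d - g * b + b"
          proof -
            have "g * z = g * (g * a) + g * b" by (subst z(3)) (simp add: algebra_simps)
            moreover have "g * z = f * g * c + g * d" by (subst z(6)) (simp add: algebra_simps)
            ultimately have "g * (g * a) = f * g * c + g * d - g * b" by (simp add: algebra_simps)
            moreover have "z = g * (g * a) - (g * g - g) * a + b" using z(3) by (simp add: algebra_simps)
            ultimately show ?thesis by simp
          qed
          moreover have "(g * g - g) * a \<in> pw 1" "f * g * c \<in> pw 1" "g * d \<in> pw 1" "g * b \<in> pw 1"
            using pw(3)[OF gg z(1)] pw(3)[OF fg z(4)] pw(4)[OF z(5) fR(2)] pw(4)[OF z(2) fR(2)] pw_antimono[OF i] by auto
          ultimately show "z \<in> pw 1" using z(2) add_subgroupD(2-4)[OF pw(1)[of 1]] by metis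
        qed (use span_mod_p_sub(1) fR in blast)
        then have "idx (span_mod_p g) (pw 1) = idx (span_mod_p g) (span_mod_p f)"
          using idx_hom(1)[OF add_subgroup_span_mod_p[OF fR(2)] add_subgroup_span_mod_p[OF fR(1)], of "\<lambda>x. x"] by simp
        also have "\<dots> \<le> idx (span_mod_p e) (span_mod_p f)"
        proof (rule idx_mono[OF _ sub[OF eg fR(2)]])
          show "finite (cosets (span_mod_p e) (span_mod_p f))"
            using finite_cosets_antimono(1)[OF pw(1) add_subgroup_span_mod_p[OF fR(1)] add_subgroup_span_mod_p[OF e(1)]
                span_mod_p_sub(1)[OF fR(1)] sub[OF ef fR(1)] fin[OF e(1)]] .
        qed
        finally show ?thesis .
      qed
      then have prod: "idx (span_mod_p g) (pw 1) * idx (span_mod_p f) (pw 1) \<le> idx (span_mod_p e) (pw 1)"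
        using idx_tower[OF pw(1) add_subgroup_span_mod_p[OF fR(1)] add_subgroup_span_mod_p[OF e(1)]
                span_mod_p_sub(1)[OF fR(1)] sub[OF ef fR(1)]] by (metis mult_le_mono1)
      have ge2: "idx (span_mod_p f) (pw 1) \<ge> 2" "idx (span_mod_p g) (pw 1) \<ge> 2"
        using gep[OF fR(1) ff fnz] gep[OF fR(2) gg gnz] prime_ge_2_nat[OF p] by auto
      have lt: "idx (span_mod_p f) (pw 1) < idx (span_mod_p e) (pw 1)"
        "idx (span_mod_p g) (pw 1) < idx (span_mod_p e) (pw 1)"
      proof -
        have "2 * idx (span_mod_p f) (pw 1) \<le> idx (span_mod_p g) (pw 1) * idx (span_mod_p f) (pw 1)"
          "idx (span_mod_p g) (pw 1) * 2 \<le> idx (span_mod_p g) (pw 1) * idx (span_mod_p f) (pw 1)"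
          using ge2 by (auto intro: mult_le_mono)
        then show "idx (span_mod_p f) (pw 1) < idx (span_mod_p e) (pw 1)"
          "idx (span_mod_p g) (pw 1) < idx (span_mod_p e) (pw 1)" using prod ge2 by linarith+
      qed
      obtain fs where fs: "\<forall>h\<in>set fs. local_idempotent i h" "sum_list fs - f \<in> pw i"
        "p ^ length fs \<le> idx (span_mod_p f) (pw 1)" using less.hyps[OF lt(1) fR(1) ff] by blast
      obtain gs where gs: "\<forall>h\<in>set gs. local_idempotent i h" "sum_list gs - g \<in> pw i"
        "p ^ length gs \<le> idx (span_mod_p g) (pw 1)" using less.hyps[OF lt(2) fR(2) gg] by blast
      have "sum_list (fs @ gs) - e = (sum_list fs - f) + (sum_list gs - g)" unfolding g_def by simp
      then have "sum_list (fs @ gs) - e \<in> pw i" using add_subgroupD(4)[OF pw(1) fs(2) gs(2)] by metis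
      moreover have "p ^ length (fs @ gs) \<le> idx (span_mod_p e) (pw 1)"
        using prod mult_le_mono[OF gs(3) fs(3)] by (simp add: power_add mult.commute)
      ultimately show ?thesis using fs(1) gs(1) by (intro exI[of _ "fs @ gs"]) auto
    qed
  qed
qed

text \<open>In a local component x can be divided by p until a unit is left or the exponent i is
  reached; so e x and some p^b e divide each other modulo p^i.\<close>

lemma local_idempotent_divisor:
  assumes e: "local_idempotent i e" and x: "x \<in> R"
  shows "\<exists>b\<le>i. \<exists>y\<in>R. \<exists>z\<in>R. e * x - of_nat (p ^ b) * e * y \<in> pw i \<and> of_nat (p ^ b) * e - e * x * z \<in> pw i"
proof -
  have eR: "e \<in> R" and ee: "e * e - e \<in> pw i" using e unfolding local_idempotent_def by auto
  let ?good = "\<lambda>b. \<exists>y\<in>R. \<exists>z\<in>R. e * x - of_nat (p ^ b) * e * y \<in> pw i \<and> of_nat (p ^ b) * e - e * x * z \<in> pw i"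
  have "(\<exists>b<c. ?good b) \<or> (\<exists>x'\<in>R. e * x - of_nat (p ^ c) * e * x' \<in> pw i)" for c
  proof (induction c)
    case 0
    then show ?case using x add_subgroupD(1)[OF pw(1)] by (intro disjI2 bexI[of _ x]) auto
  next
    case (Suc c)
    show ?case
    proof (cases "\<exists>b<c. ?good b")
      case True
      then show ?thesis using less_SucI by blast
    next
      case False
      then obtain x' where x': "x' \<in> R" "e * x - of_nat (p ^ c) * e * x' \<in> pw i" using Suc by blast
      consider "e * x' \<in> pw 1" | y where "y \<in> R" "e * x' * y - e \<in> pw i"
        using e x'(1) unfolding local_idempotent_def by blast
      then show ?thesis
      proof cases
        case 1
        then obtain u where u: "u \<in> R" "e * x' = of_nat p * u" unfolding pw_def by auto
        have "e * x - of_nat (p ^ Suc c) * e * u =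
          (e * x - of_nat (p ^ c) * e * x') - of_nat (p ^ c) * ((e * e - e) * x')"
        proof -
          have "of_nat (p ^ Suc c) * e * u = of_nat (p ^ c) * e * (of_nat p * u)" by (simp add: algebra_simps)
          also have "\<dots> = of_nat (p ^ c) * e * (e * x')" by (simp add: u(2))
          finally show ?thesis by (simp add: algebra_simps)
        qed
        then have "e * x - of_nat (p ^ Suc c) * e * u \<in> pw i"
          using add_subgroupD(2)[OF pw(1) x'(2) add_subgroup_of_nat[OF pw(1) pw(3)[OF ee x'(1)]]] by metis
        then show ?thesis using u(1) by blast
      next
        case 2
        have "of_nat (p ^ c) * e - e * x * y =
            - ((e * x - of_nat (p ^ c) * e * x') * y) - of_nat (p ^ c) * (e * x' * y - e)"
          by (simp add: algebra_simps)
        then have "of_nat (p ^ c) * e - e * x * y \<in> pw i"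
          using add_subgroupD(2)[OF pw(1) add_subgroupD(3)[OF pw(1) pw(3)[OF x'(2) 2(1)]]
              add_subgroup_of_nat[OF pw(1) 2(2)]] by metis
        then have "?good c" using 2(1) x' by blast
        then show ?thesis by blast
      qed
    qed
  qed
  from this[of i] show ?thesis
  proof
    assume "\<exists>x'\<in>R. e * x - of_nat (p ^ i) * e * x' \<in> pw i"
    then have "?good i"
      using pwI[OF eR, of i] add_subgroupD(1)[OF pw(1)] by (metis R_closed(1) diff_zero mult_zero_right)
    then show ?thesis by blast
  qed (meson less_imp_le)
qed

text \<open>An ideal containing \<open>p\<^sup>i\<close> is determined by the exponents \<open>a\<close> for which \<open>p\<^sup>a e\<close> first lies
  in it, \<open>e\<close> running through the local idempotents.\<close>

context
  fixes i es
  assumes es: "\<And>e. e \<in> set es \<Longrightarrow> local_idempotent i e" "sum_list es - 1 \<in> pw i"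
begin

definition ideal_exponent :: "'a set \<Rightarrow> 'a \<Rightarrow> nat" where
  "ideal_exponent I e = (LEAST a. of_nat (p ^ a) * e \<in> I)"

lemma es_R: "e \<in> set es \<Longrightarrow> e \<in> R"
  using es(1) unfolding local_idempotent_def by blast

lemma ideal_exponent:
  assumes I: "ideal_of R I" "pw i \<subseteq> I" and e: "e \<in> set es"
  shows "of_nat (p ^ a) * e \<in> I \<longleftrightarrow> ideal_exponent I e \<le> a" "ideal_exponent I e \<le> i"
proof -
  have i: "of_nat (p ^ i) * e \<in> I" using pwI[OF es_R[OF e]] I by blast
  then show "ideal_exponent I e \<le> i" unfolding ideal_exponent_def by (rule Least_le)
  show "of_nat (p ^ a) * e \<in> I \<longleftrightarrow> ideal_exponent I e \<le> a"
  proof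
    assume "of_nat (p ^ a) * e \<in> I"
    then show "ideal_exponent I e \<le> a" unfolding ideal_exponent_def by (rule Least_le)
  next
    assume le: "ideal_exponent I e \<le> a"
    have "of_nat (p ^ ideal_exponent I e) * e \<in> I"
      unfolding ideal_exponent_def by (rule LeastI[of "\<lambda>a. of_nat (p ^ a) * e \<in> I", OF i])
    then have "of_nat (p ^ (a - ideal_exponent I e)) * (of_nat (p ^ ideal_exponent I e) * e) \<in> I"
      by (rule add_subgroup_of_nat[OF ideal_ofD(1)[OF I(1)]])
    then show "of_nat (p ^ a) * e \<in> I" using le by (simp add: mult.assoc[symmetric] flip: of_nat_mult power_add)
  qed
qed

text \<open>The idempotents sum to 1 modulo p^i, and p^i R lies in the ideal.\<close>

lemma mem_ideal_iff:
  assumes I: "ideal_of R I" "pw i \<subseteq> I" and x: "x \<in> R"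
  shows "x \<in> I \<longleftrightarrow> (\<forall>e\<in>set es. e * x \<in> I)"
proof
  assume "\<forall>e\<in>set es. e * x \<in> I"
  then have "sum_list (map (\<lambda>e. e * x) es) \<in> I"
    by (induction es) (auto intro: add_subgroupD[OF ideal_ofD(1)[OF I(1)]])
  then have 1: "sum_list es * x \<in> I" by (simp add: sum_list_mult_const)
  have "(sum_list es - 1) * x \<in> I" using pw(3)[OF es(2) x] I(2) by blast
  from add_subgroupD(2)[OF ideal_ofD(1)[OF I(1)] 1 this] show "x \<in> I" by (simp add: algebra_simps)
qed (use ideal_ofD(4)[OF I(1)] es_R in blast)

text \<open>On each component x is associated to a power p^b, and whether p^b e lies in an ideal is
  read off from the exponent.\<close>

lemma ideal_subset:
  assumes I: "ideal_of R I" "pw i \<subseteq> I" and I': "ideal_of R I'" "pw i \<subseteq> I'"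
    and eq: "\<And>e. e \<in> set es \<Longrightarrow> ideal_exponent I e = ideal_exponent I' e"
  shows "I \<subseteq> I'"
proof
  fix x assume x: "x \<in> I"
  then have xR: "x \<in> R" using ideal_ofD(2)[OF I(1)] by blast
  have "e * x \<in> I'" if e: "e \<in> set es" for e
  proof -
    obtain b y z where b: "y \<in> R" "z \<in> R" "e * x - of_nat (p ^ b) * e * y \<in> pw i"
      "of_nat (p ^ b) * e - e * x * z \<in> pw i"
      using local_idempotent_divisor[OF es(1)[OF e] xR] by blast
    have "e * x * z \<in> I" using ideal_ofD(3)[OF I(1) ideal_ofD(4)[OF I(1) x es_R[OF e]] b(2)] .
    then have "(of_nat (p ^ b) * e - e * x * z) + e * x * z \<in> I"
      using add_subgroupD(4)[OF ideal_ofD(1)[OF I(1)]] b(4) I(2) by blast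
    then have "of_nat (p ^ b) * e \<in> I'"
      using ideal_exponent(1)[OF I e, of b] ideal_exponent(1)[OF I' e, of b] eq[OF e] by simp
    then have "of_nat (p ^ b) * e * y \<in> I'" using ideal_ofD(3)[OF I'(1)] b(1) by blast
    then have "(e * x - of_nat (p ^ b) * e * y) + of_nat (p ^ b) * e * y \<in> I'"
      using add_subgroupD(4)[OF ideal_ofD(1)[OF I'(1)]] b(3) I'(2) by blast
    then show ?thesis by simp
  qed
  then show "x \<in> I'" using mem_ideal_iff[OF I' xR] by blast
qed

text \<open>Some component of x lies outside I; there x is associated to p^b e with b below the
  exponent a of I, so a multiple of x is the last power p^(a - 1) e outside I.\<close>

lemma socle_generator:
  assumes I: "ideal_of R I" "pw i \<subseteq> I" and x: "x \<in> R" "x \<notin> I"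
  shows "\<exists>e\<in>set es. ideal_exponent I e > 0 \<and> (\<exists>y\<in>R. of_nat (p ^ (ideal_exponent I e - 1)) * e - x * y \<in> I)"
proof -
  obtain e where e: "e \<in> set es" "e * x \<notin> I" using mem_ideal_iff[OF I x(1)] x(2) by blast
  obtain b y z where b: "y \<in> R" "z \<in> R" "e * x - of_nat (p ^ b) * e * y \<in> pw i"
    "of_nat (p ^ b) * e - e * x * z \<in> pw i"
    using local_idempotent_divisor[OF es(1)[OF e(1)] x(1)] by blast
  let ?a = "ideal_exponent I e"
  have "of_nat (p ^ b) * e \<notin> I"
  proof
    assume "of_nat (p ^ b) * e \<in> I"
    then have "of_nat (p ^ b) * e * y \<in> I" using ideal_ofD(3)[OF I(1)] b(1) by blast
    then have "(e * x - of_nat (p ^ b) * e * y) + of_nat (p ^ b) * e * y \<in> I"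
      using add_subgroupD(4)[OF ideal_ofD(1)[OF I(1)]] b(3) I(2) by blast
    then show False using e(2) by simp
  qed
  then have ba: "b < ?a" using ideal_exponent(1)[OF I e(1), of b] by simp
  define q where "q = (of_nat (p ^ (?a - 1 - b)) :: 'a)"
  have q: "q * of_nat (p ^ b) = of_nat (p ^ (?a - 1))"
    using ba unfolding q_def by (simp flip: of_nat_mult power_add)
  have "q * (of_nat (p ^ b) * e - e * x * z) \<in> I"
    using add_subgroup_of_nat[OF pw(1) b(4)] I(2) unfolding q_def by blast
  moreover have "q * (of_nat (p ^ b) * e - e * x * z) = of_nat (p ^ (?a - 1)) * e - x * (q * e * z)"
    unfolding q[symmetric] by (simp add: algebra_simps)
  moreover have "q * e * z \<in> R"
    unfolding q_def using R_mult[OF R_mult[OF R_of_nat es_R[OF e(1)]] b(2)] .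
  ultimately have "\<exists>y\<in>R. of_nat (p ^ (?a - 1)) * e - x * y \<in> I" by metis
  moreover have "?a > 0" using ba by simp
  ultimately show ?thesis using e(1) by blast
qed

end

lemma local_idempotents_exist:
  assumes "i \<ge> 1"
  obtains es where "\<And>e. e \<in> set es \<Longrightarrow> local_idempotent i e" "sum_list es - 1 \<in> pw i" "length es \<le> n"
proof -
  have "(1::'a) * 1 - 1 \<in> pw i" using add_subgroupD(1)[OF pw(1)] by simp
  then obtain es where es: "\<forall>f\<in>set es. local_idempotent i f" "sum_list es - 1 \<in> pw i"
    "p ^ length es \<le> idx (span_mod_p 1) (pw 1)"
    using local_decomposition[OF assms R_1] by blast
  have "idx (span_mod_p 1) (pw 1) \<le> p ^ n"
    using idx_mono[OF finite_pw span_mod_p_sub(2)[OF R_1]] idx_p unfolding pw_1[symmetric] by (meson order_trans)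
  then have "length es \<le> n" using es(3) prime_gt_1_nat[OF p] by (meson order_trans power_le_imp_le_exp)
  then show ?thesis using that es by blast
qed

lemma card_ideals:
  assumes "i \<ge> 1"
  shows "finite {I. ideal_of R I \<and> pw i \<subseteq> I}" "card {I. ideal_of R I \<and> pw i \<subseteq> I} \<le> (i + 1) ^ n"
proof -
  obtain es where es: "\<And>e. e \<in> set es \<Longrightarrow> local_idempotent i e" "sum_list es - 1 \<in> pw i" "length es \<le> n"
    using local_idempotents_exist[OF assms] by blast
  let ?S = "{I. ideal_of R I \<and> pw i \<subseteq> I}"
  let ?F = "\<lambda>I. restrict (ideal_exponent I) (set es)"
  have inj: "inj_on ?F ?S"
  proof (rule inj_onI)
    fix I I' assume *: "I \<in> ?S" "I' \<in> ?S" "?F I = ?F I'"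
    then have "ideal_exponent I e = ideal_exponent I' e" if "e \<in> set es" for e
      using that by (metis restrict_apply')
    then show "I = I'" using ideal_subset[OF es(1,2)] * by (metis (no_types, lifting) mem_Collect_eq subset_antisym)
  qed
  have sub: "?F ` ?S \<subseteq> set es \<rightarrow>\<^sub>E {..i}"
    using ideal_exponent(2)[OF es(1,2)] by auto
  have fin: "finite (set es \<rightarrow>\<^sub>E {..i})" by (intro finite_PiE) auto
  show "finite ?S" using inj_on_finite[OF inj sub fin] .
  have "card ?S \<le> card (set es \<rightarrow>\<^sub>E {..i})" using card_inj_on_le[OF inj sub fin] .
  also have "\<dots> = (i + 1) ^ card (set es)" by (simp add: card_PiE)
  also have "\<dots> \<le> (i + 1) ^ n" using card_length[of es] es(3) by (intro power_increasing) auto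
  finally show "card ?S \<le> (i + 1) ^ n" .
qed

text \<open>The elements p^(a - 1) e generate the minimal ideals of R/I: every nonzero ideal of R/I
  contains one of these at most n elements.\<close>

lemma socle:
  assumes "i \<ge> 1" "ideal_of R I" "pw i \<subseteq> I"
  obtains Z where "finite Z" "card Z \<le> n" "Z \<subseteq> R - I" "\<And>x. x \<in> R \<Longrightarrow> x \<notin> I \<Longrightarrow> \<exists>z\<in>Z. \<exists>y\<in>R. z - x * y \<in> I"
proof -
  obtain es where es: "\<And>e. e \<in> set es \<Longrightarrow> local_idempotent i e" "sum_list es - 1 \<in> pw i" "length es \<le> n"
    using local_idempotents_exist[OF assms(1)] by blast
  define Z where "Z = (\<lambda>e. of_nat (p ^ (ideal_exponent I e - 1)) * e) ` {e \<in> set es. ideal_exponent I e > 0}"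
  have "card Z \<le> card {e \<in> set es. ideal_exponent I e > 0}" unfolding Z_def by (rule card_image_le) simp
  also have "\<dots> \<le> card (set es)" by (rule card_mono) auto
  also have "\<dots> \<le> n" using card_length[of es] es(3) by simp
  finally have "card Z \<le> n" .
  moreover have "Z \<subseteq> R - I"
  proof
    fix z assume "z \<in> Z"
    then obtain e where e: "e \<in> set es" "ideal_exponent I e > 0" "z = of_nat (p ^ (ideal_exponent I e - 1)) * e"
      unfolding Z_def by blast
    then show "z \<in> R - I"
      using ideal_exponent(1)[OF es(1,2) assms(2,3) e(1), of "ideal_exponent I e - 1"]
        R_mult[OF R_of_nat[of "p ^ (ideal_exponent I e - 1)"] es_R[OF es(1,2) e(1)]] by auto
  qed
  moreover have "\<exists>z\<in>Z. \<exists>y\<in>R. z - x * y \<in> I" if x: "x \<in> R" "x \<notin> I" for x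
  proof -
    obtain e y where e: "e \<in> set es" "ideal_exponent I e > 0" "y \<in> R"
      "of_nat (p ^ (ideal_exponent I e - 1)) * e - x * y \<in> I"
      using socle_generator[OF es(1,2) assms(2,3) x] by blast
    then have "of_nat (p ^ (ideal_exponent I e - 1)) * e \<in> Z" unfolding Z_def by (intro imageI) simp
    then show ?thesis using e(3,4) by blast
  qed
  moreover have "finite Z" unfolding Z_def by simp
  ultimately show ?thesis using that by blast
qed

end

section \<open>The optimisation of the exponent\<close>

text \<open>A layer with \<open>X + 1\<close> generators and colength \<open>E\<close> contributes \<open>X E\<close> to the exponent and is
  charged \<open>(n/2 - 7/6) E\<close>; \<open>n/4 - 1/12\<close> is the Lagrange multiplier of the constraint that
  the total number of generators is at most the total colength.\<close>

definition layer_excess :: "nat \<Rightarrow> nat \<Rightarrow> nat \<Rightarrow> real" where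
  "layer_excess n X E = (real X - (real n / 2 - 7/6)) * real E + (real n / 4 - 1/12) * (real E - real X - 1)"

text \<open>The excess is affine in \<open>E\<close>. If the coefficient X - n/4 + 13/12 is
  nonnegative, the largest value E = n - 1 - X yields the completed square. Otherwise the excess is
  so negative that together with any second layer, which has at most n/12, the sum is at most
  -1.\<close>

lemma layer_excess_cases:
  assumes "n \<ge> 6" "E + X + 1 \<le> n" "E + X \<ge> 1"
  shows "layer_excess n X E \<le> real n / 12 - (real n / 2 - 1 - real X)\<^sup>2 \<or>
    layer_excess n X E \<le> - (real n / 12) - 1"
proof (cases "real X - real n / 4 + 13/12 \<ge> 0")
  case True
  have E: "real E \<le> real n - 1 - real X" using assms(2) by linarith
  have "layer_excess n X E = (real X - real n / 4 + 13/12) * real E - (real n / 4 - 1/12) * (real X + 1)"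
    unfolding layer_excess_def by (simp add: field_simps)
  also have "\<dots> \<le> (real X - real n / 4 + 13/12) * (real n - 1 - real X) - (real n / 4 - 1/12) * (real X + 1)"
    using mult_left_mono[OF E True] by simp
  also have "\<dots> = real n / 12 - (real n / 2 - 1 - real X)\<^sup>2"
    by (simp add: field_simps power2_eq_square)
  finally show ?thesis by blast
next
  case False
  have eq: "layer_excess n X E = (real X - real n / 4 + 13/12) * real E - (real n / 4 - 1/12) * (real X + 1)"
    unfolding layer_excess_def by (simp add: field_simps)
  show ?thesis
  proof (cases "X = 0")
    case True
    then have "1 \<le> real E" using assms(3) by simp
    from mult_left_mono_neg[OF this, of "real X - real n / 4 + 13/12"] False
    have "(real X - real n / 4 + 13/12) * real E \<le> (real X - real n / 4 + 13/12) * 1" by linarith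
    then have "layer_excess n X E \<le> (real X - real n / 4 + 13/12) * 1 - (real n / 4 - 1/12) * (real X + 1)"
      unfolding eq by simp
    then show ?thesis using True assms(1) by simp
  next
    case X: False
    have "(real X - real n / 4 + 13/12) * real E \<le> 0" using False by (intro mult_nonpos_nonneg) auto
    moreover have "(real n / 4 - 1/12) * (real X + 1) \<ge> (real n / 4 - 1/12) * 2"
      using X assms(1) by (intro mult_left_mono) auto
    moreover have "(real n / 4 - 1/12) * 2 \<ge> real n / 12 + 1" using assms(1) by simp
    ultimately show ?thesis unfolding eq by (intro disjI2) linarith
  qed
qed

text \<open>A completed square suffices for n \<ge> 7. For n = 6 the minimum over the reals is 5/4
  and falls short of the required 2, so integrality is used; equality holds for X = Y = 1.\<close>

lemma layer_pair_quadratic: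
  fixes X Y :: nat
  assumes n: "n \<ge> 6" and XY: "X \<le> Y"
  shows "(real n / 2 - 1 - real X)\<^sup>2 + (real n / 2 - 1 - real Y)\<^sup>2 + real X * (real Y - 1) \<ge> real n / 6 + 1"
proof (cases "n = 6")
  case True
  consider "X = 0" | "X = 1" "Y = 1" | "X = 1" "Y \<ge> 2" | "X \<ge> 2" using XY by linarith
  then show ?thesis
  proof cases
    case 3
    then have "real X * (real Y - 1) \<ge> 1" by simp
    moreover have "(real n / 2 - 1 - real X)\<^sup>2 = 1" using True 3 by simp
    moreover have "(real n / 2 - 1 - real Y)\<^sup>2 \<ge> 0" by simp
    ultimately show ?thesis using True by linarith
  next
    case 4
    then have "2 * 1 \<le> real X * (real Y - 1)" using XY by (intro mult_mono) auto
    moreover have "(real n / 2 - 1 - real X)\<^sup>2 \<ge> 0" "(real n / 2 - 1 - real Y)\<^sup>2 \<ge> 0" by simp_all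
    ultimately show ?thesis using True by linarith
  qed (use True in \<open>auto simp: power2_eq_square\<close>)
next
  case False
  \<comment> \<open>Mean and half difference of X and Y remove the mixed term of the quadratic
    polynomial; n \<ge> 7 means y \<ge> 5/2.\<close>
  define y t \<delta> where "y = real n / 2 - 1" and "t = (real X + real Y) / 2" and "\<delta> = (real Y - real X) / 2"
  have y: "y \<ge> 5/2" using n False unfolding y_def by simp
  have \<delta>: "\<delta> \<ge> 0" using XY unfolding \<delta>_def by simp
  have "(y - real X)\<^sup>2 + (y - real Y)\<^sup>2 + real X * (real Y - 1) =
      3 * (t - (4 * y + 1) / 6)\<^sup>2 + (8 * y\<^sup>2 - 8 * y - 1) / 12 + \<delta>\<^sup>2 + \<delta>"
    unfolding t_def \<delta>_def by (simp add: field_simps power2_eq_square)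
  moreover have "(8 * y\<^sup>2 - 8 * y - 1) / 12 \<ge> (y + 4) / 3"
  proof -
    have "(y - 5/2) * (8 * y + 8) \<ge> 0" using y by simp
    then show ?thesis by (simp add: field_simps power2_eq_square)
  qed
  moreover have "3 * (t - (4 * y + 1) / 6)\<^sup>2 \<ge> 0" "\<delta>\<^sup>2 \<ge> 0" by simp_all
  ultimately have "(y - real X)\<^sup>2 + (y - real Y)\<^sup>2 + real X * (real Y - 1) \<ge> (y + 4) / 3"
    using \<delta> by linarith
  then show ?thesis unfolding y_def by (simp add: field_simps)
qed

text \<open>The term min X Y bounds the diagonal contribution q of \<open>exponent_bound\<close>. If
  both layers are in the first case of \<open>layer_excess_cases\<close>, the quadratic estimate
  decides; otherwise one layer is negative enough by itself.\<close>

lemma layer_pair_excess: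
  assumes n: "n \<ge> 6" and X: "E + X + 1 \<le> n" "E + X \<ge> 1" and Y: "F + Y + 1 \<le> n" "F + Y \<ge> 1"
  shows "layer_excess n X E + layer_excess n Y F - real X * real Y + real (min X Y) \<le> - 1"
proof -
  have *: "layer_excess n X E + layer_excess n Y F - real X * real Y + real (min X Y) \<le> - 1"
    if h: "X \<le> Y" "E + X + 1 \<le> n" "E + X \<ge> 1" "F + Y + 1 \<le> n" "F + Y \<ge> 1" for X Y E F
  proof -
    have le: "layer_excess n X E \<le> real n / 12" "layer_excess n Y F \<le> real n / 12"
      using layer_excess_cases[OF n h(2,3)] layer_excess_cases[OF n h(4,5)]
        zero_le_power2[of "real n / 2 - 1 - real X"] zero_le_power2[of "real n / 2 - 1 - real Y"] by linarith+
    define u where "u = real X * (real Y - 1)"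
    have g: "layer_excess n X E + layer_excess n Y F - real X * real Y + real (min X Y) =
        layer_excess n X E + layer_excess n Y F - u"
      using h(1) unfolding u_def by (simp add: algebra_simps)
    have u: "u \<ge> 0" using h(1) unfolding u_def by (cases X) (auto intro!: mult_nonneg_nonneg)
    note quad = layer_pair_quadratic[OF n h(1), folded u_def]
    show "layer_excess n X E + layer_excess n Y F - real X * real Y + real (min X Y) \<le> - 1"
      unfolding g using layer_excess_cases[OF n h(2,3)] layer_excess_cases[OF n h(4,5)]
      by (elim disjE) (use quad le u in linarith)+
  qed
  show ?thesis
  proof (cases "X \<le> Y")
    case False
    then show ?thesis using *[of Y X F E] X Y by (simp add: min.commute mult.commute)
  qed (use * X Y in blast)
qed

lemma sum_of_bool_less:
  fixes v k :: nat
  shows "v \<le> k \<Longrightarrow> (\<Sum>a<k. of_bool (a < v) * f a) = (\<Sum>a<v. f a :: real)"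
  by (rule sum.mono_neutral_cong_right) auto


text \<open>The conjugate partition of \<nu>, that is, the number of cyclic factors whose order
  exceeds p^a.\<close>

definition layer_size :: "nat \<Rightarrow> (nat \<Rightarrow> nat) \<Rightarrow> nat \<Rightarrow> nat" where
  "layer_size n \<nu> a = card {l\<in>{1..n}. a < \<nu> l}"

text \<open>The left side is s - k, from the number of characters per subring, plus the weights of
  the generators 2, ..., n. Written as sums over layers, only the orthogonality terms \<nu> l +
  \<nu> j - k mix layers, and they join a with k - 1 - a; after averaging over this reflection
  \<open>layer_pair_excess\<close> applies to each pair.\<close>

theorem exponent_bound:
  fixes n k :: nat and \<nu> \<gamma> :: "nat \<Rightarrow> nat"
  assumes n: "n \<ge> 6" and \<nu>: "\<nu> 1 = k" "\<And>l. l \<in> {1..n} \<Longrightarrow> \<nu> l \<le> k"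
    and \<gamma>: "\<And>a. a < k \<Longrightarrow> 2 \<le> \<gamma> a" "\<And>a. a < k \<Longrightarrow> \<gamma> a \<le> n" "\<And>a. a < k \<Longrightarrow> layer_size n \<nu> a \<le> \<gamma> a"
    and le: "2 * (\<Sum>l\<in>{1..n}. \<nu> l) \<le> (\<Sum>a<k. \<gamma> a)"
  shows "real (\<Sum>l\<in>{1..n}. \<nu> l) - real k + (\<Sum>j\<in>{2..n}. real (\<Sum>a<\<nu> j. \<gamma> a) -
      (\<Sum>l\<in>{1..<j}. real (\<nu> l + \<nu> j - k)) - (\<Sum>l\<in>{1..n}. real (min (\<nu> l) (\<nu> j)))) \<le>
    (real n / 2 - 7/6) * (real (\<Sum>a<k. \<gamma> a) - real (\<Sum>l\<in>{1..n}. \<nu> l)) - real k / 2"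
proof -
  define t where "t l a = (of_bool (a < \<nu> l) :: real)" for l a
  \<comment> \<open>The first generator is 1, of full order p^k, and lies in every layer; X counts
    the other ones.\<close>
  define X where "X a = card {l\<in>{2..n}. a < \<nu> l}" for a
  define E where "E a = \<gamma> a - layer_size n \<nu> a" for a
  let ?r = "\<lambda>a. k - 1 - a"
  have ins: "{1..n} = insert 1 {2..n}" using n by auto
  have d: "layer_size n \<nu> a = X a + 1" if "a < k" for a
  proof -
    have "{l\<in>{1..n}. a < \<nu> l} = insert 1 {l\<in>{2..n}. a < \<nu> l}" using that \<nu>(1) n by auto
    then show ?thesis unfolding layer_size_def X_def by simp
  qed
  have tX: "(\<Sum>l\<in>{2..n}. t l a) = real (X a)" for a
    unfolding t_def X_def by (simp add: sum.If_cases of_bool_def Int_def)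
  have t1: "t 1 a = 1" if "a < k" for a using that \<nu>(1) unfolding t_def by simp
  have tD: "(\<Sum>l\<in>{1..n}. t l a) = real (X a) + 1" if "a < k" for a
    unfolding ins using t1[OF that] tX[of a] by simp
  have \<nu>t: "real (\<nu> l) = (\<Sum>a<k. t l a)" if "l \<in> {1..n}" for l
    using sum_of_bool_less[OF \<nu>(2)[OF that], of "\<lambda>_. 1"] unfolding t_def by simp
  have \<gamma>t: "real (\<Sum>a<\<nu> j. \<gamma> a) = (\<Sum>a<k. t j a * real (\<gamma> a))" if "j \<in> {1..n}" for j
    using sum_of_bool_less[OF \<nu>(2)[OF that], of "\<lambda>a. real (\<gamma> a)"] unfolding t_def by simp
  have mint: "real (min (\<nu> l) (\<nu> j)) = (\<Sum>a<k. t l a * t j a)" if "l \<in> {1..n}" for l j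
  proof -
    have "(\<Sum>a<k. t l a * t j a) = (\<Sum>a<k. of_bool (a < min (\<nu> l) (\<nu> j)) * 1)"
      unfolding t_def by (intro sum.cong) auto
    also have "\<dots> = real (min (\<nu> l) (\<nu> j))"
      using \<nu>(2)[OF that] by (subst sum_of_bool_less) auto
    finally show ?thesis ..
  qed
  \<comment> \<open>Both indicators are 1 exactly for k - \<nu> j \<le> a < \<nu> l, an interval
    whose length is the truncated difference.\<close>
  have subt: "real (\<nu> l + \<nu> j - k) = (\<Sum>a<k. t l a * t j (?r a))" if "l \<in> {1..n}" "j \<in> {1..n}" for l j
  proof -
    have "(\<Sum>a<k. t l a * t j (?r a)) = (\<Sum>a<k. of_bool (a \<in> {k - \<nu> j..<\<nu> l}))"
      using \<nu>(2)[OF that(2)] unfolding t_def by (intro sum.cong) (auto simp: less_diff_conv2)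
    also have "\<dots> = (\<Sum>a\<in>{k - \<nu> j..<\<nu> l}. 1)"
      using \<nu>(2)[OF that(1)] by (intro sum.mono_neutral_cong_right) auto
    also have "\<dots> = real (\<nu> l + \<nu> j - k)" using \<nu>(2)[OF that(2)] by simp
    finally show ?thesis ..
  qed
  have reflk: "(\<Sum>a<k. f (?r a)) = (\<Sum>a<k. f a)" for f :: "nat \<Rightarrow> real"
    using sum.nat_diff_reindex[of f k] by simp
  define P where "P = (\<Sum>a<k. \<Sum>j\<in>{2..n}. \<Sum>l\<in>{2..<j}. t l a * t j (?r a))"
  define q where "q a = (\<Sum>l\<in>{2..n}. t l a * t l (?r a))" for a
  \<comment> \<open>P runs over l < j only; with its reflected copy it covers all pairs except the
    diagonal, which is q.\<close>
  have "2 * P = (\<Sum>a<k. (\<Sum>j\<in>{2..n}. \<Sum>l\<in>{2..<j}. t l a * t j (?r a)) + (\<Sum>j\<in>{2..n}. \<Sum>l\<in>{2..<j}. t l (?r a) * t j a))"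
  proof -
    have "P = (\<Sum>a<k. \<Sum>j\<in>{2..n}. \<Sum>l\<in>{2..<j}. t l (?r a) * t j (?r (?r a)))"
      unfolding P_def by (rule reflk[symmetric])
    also have "\<dots> = (\<Sum>a<k. \<Sum>j\<in>{2..n}. \<Sum>l\<in>{2..<j}. t l (?r a) * t j a)"
      by (intro sum.cong) auto
    finally show ?thesis unfolding P_def by (simp add: sum.distrib)
  qed
  also have "\<dots> = (\<Sum>a<k. real (X a) * real (X (?r a)) - q a)"
  proof (rule sum.cong[OF refl])
    fix a
    have "real (X a) * real (X (?r a)) = (\<Sum>j\<in>{2..n}. \<Sum>l\<in>{2..n}. t l a * t j (?r a))"
      by (simp add: sum_product mult.commute flip: tX) (rule sum.swap)
    also have "\<dots> = (\<Sum>j\<in>{2..n}. (\<Sum>l\<in>{2..<j}. t l a * t j (?r a)) + t j a * t j (?r a) + (\<Sum>l\<in>{j<..n}. t l a * t j (?r a)))"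
    proof (rule sum.cong[OF refl])
      fix j assume j: "j \<in> {2..n}"
      have "{2..n} = ({2..<j} \<union> {j}) \<union> {j<..n}" using j by auto
      then have "sum f {2..n} = sum f {2..<j} + f j + sum f {j<..n}" for f :: "nat \<Rightarrow> real"
      proof -
        have "sum f {2..n} = sum f (({2..<j} \<union> {j}) \<union> {j<..n})"
          by (rule arg_cong[of _ _ "sum f"]) fact
        also have "\<dots> = sum f ({2..<j} \<union> {j}) + sum f {j<..n}"
          by (rule sum.union_disjoint) auto
        also have "sum f ({2..<j} \<union> {j}) = sum f {2..<j} + sum f {j}"
          by (rule sum.union_disjoint) auto
        finally show ?thesis by simp
      qed
      then show "(\<Sum>l\<in>{2..n}. t l a * t j (?r a)) =
          (\<Sum>l\<in>{2..<j}. t l a * t j (?r a)) + t j a * t j (?r a) + (\<Sum>l\<in>{j<..n}. t l a * t j (?r a))"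
        by simp
    qed
    also have "\<dots> = (\<Sum>j\<in>{2..n}. \<Sum>l\<in>{2..<j}. t l a * t j (?r a)) + q a + (\<Sum>j\<in>{2..n}. \<Sum>l\<in>{j<..n}. t l a * t j (?r a))"
      unfolding q_def by (simp add: sum.distrib)
    also have "(\<Sum>j\<in>{2..n}. \<Sum>l\<in>{j<..n}. t l a * t j (?r a)) = (\<Sum>l\<in>{2..n}. \<Sum>j\<in>{2..<l}. t l a * t j (?r a))"
    proof -
      have "(\<Sum>j\<in>{2..n}. \<Sum>l\<in>{j<..n}. t l a * t j (?r a)) = (\<Sum>j\<in>{2..n}. \<Sum>l\<in>{l\<in>{2..n}. j < l}. t l a * t j (?r a))"
        by (intro sum.cong refl) auto
      also have "\<dots> = (\<Sum>l\<in>{2..n}. \<Sum>j\<in>{j\<in>{2..n}. j < l}. t l a * t j (?r a))"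
        by (rule sum.swap_restrict) auto
      also have "\<dots> = (\<Sum>l\<in>{2..n}. \<Sum>j\<in>{2..<l}. t l a * t j (?r a))"
        by (intro sum.cong refl) auto
      finally show ?thesis .
    qed
    finally show "(\<Sum>j\<in>{2..n}. \<Sum>l\<in>{2..<j}. t l a * t j (?r a)) + (\<Sum>j\<in>{2..n}. \<Sum>l\<in>{2..<j}. t l (?r a) * t j a) =
        real (X a) * real (X (?r a)) - q a" by (simp add: mult.commute)
  qed
  finally have P: "2 * P = (\<Sum>a<k. real (X a) * real (X (?r a)) - q a)" .
  have q: "q a \<le> real (min (X a) (X (?r a)))" for a
  proof -
    have "q a \<le> (\<Sum>l\<in>{2..n}. t l a)" "q a \<le> (\<Sum>l\<in>{2..n}. t l (?r a))"
      unfolding q_def t_def by (intro sum_mono; simp)+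
    then show ?thesis unfolding tX by simp
  qed
  define s where "s = real (\<Sum>l\<in>{1..n}. \<nu> l)"
  have s: "s = (\<Sum>a<k. real (X a) + 1)"
  proof -
    have "s = (\<Sum>l\<in>{1..n}. \<Sum>a<k. t l a)" unfolding s_def using \<nu>t by simp
    also have "\<dots> = (\<Sum>a<k. \<Sum>l\<in>{1..n}. t l a)" by (rule sum.swap)
    finally show ?thesis using tD by simp
  qed
  have EX: "real (\<gamma> a) = real (E a) + real (X a) + 1" if "a < k" for a
    using \<gamma>(3)[OF that] d[OF that] unfolding E_def by simp
  have i: "real (\<Sum>a<k. \<gamma> a) - s = (\<Sum>a<k. real (E a))"
    unfolding s using EX by (simp add: sum.distrib)
  have S1: "(\<Sum>j\<in>{2..n}. real (\<Sum>a<\<nu> j. \<gamma> a)) = (\<Sum>a<k. real (X a) * real (\<gamma> a))"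
  proof -
    have "(\<Sum>j\<in>{2..n}. real (\<Sum>a<\<nu> j. \<gamma> a)) = (\<Sum>j\<in>{2..n}. \<Sum>a<k. t j a * real (\<gamma> a))"
      using \<gamma>t by (intro sum.cong) auto
    also have "\<dots> = (\<Sum>a<k. \<Sum>j\<in>{2..n}. t j a * real (\<gamma> a))" by (rule sum.swap)
    finally show ?thesis by (simp add: tX flip: sum_distrib_right)
  qed
  have S2: "(\<Sum>j\<in>{2..n}. \<Sum>l\<in>{1..n}. real (min (\<nu> l) (\<nu> j))) = (\<Sum>a<k. (real (X a) + 1) * real (X a))"
  proof -
    have "(\<Sum>j\<in>{2..n}. \<Sum>l\<in>{1..n}. real (min (\<nu> l) (\<nu> j))) = (\<Sum>j\<in>{2..n}. \<Sum>l\<in>{1..n}. \<Sum>a<k. t l a * t j a)"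
      using mint by (intro sum.cong) auto
    also have "\<dots> = (\<Sum>j\<in>{2..n}. \<Sum>a<k. (real (X a) + 1) * t j a)"
    proof (rule sum.cong[OF refl])
      fix j
      have "(\<Sum>l\<in>{1..n}. \<Sum>a<k. t l a * t j a) = (\<Sum>a<k. (\<Sum>l\<in>{1..n}. t l a) * t j a)"
        unfolding sum_distrib_right by (rule sum.swap)
      also have "\<dots> = (\<Sum>a<k. (real (X a) + 1) * t j a)"
        using tD by (intro sum.cong refl) auto
      finally show "(\<Sum>l\<in>{1..n}. \<Sum>a<k. t l a * t j a) = (\<Sum>a<k. (real (X a) + 1) * t j a)" .
    qed
    also have "\<dots> = (\<Sum>a<k. (real (X a) + 1) * real (X a))"
      by (subst sum.swap, simp add: tX flip: sum_distrib_left)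
    finally show ?thesis .
  qed
  have S3: "(\<Sum>j\<in>{2..n}. \<Sum>l\<in>{1..<j}. real (\<nu> l + \<nu> j - k)) = (\<Sum>a<k. real (X a)) + P"
  proof -
    have "(\<Sum>j\<in>{2..n}. \<Sum>l\<in>{1..<j}. real (\<nu> l + \<nu> j - k)) =
        (\<Sum>j\<in>{2..n}. (\<Sum>a<k. t j (?r a)) + (\<Sum>l\<in>{2..<j}. \<Sum>a<k. t l a * t j (?r a)))"
    proof (rule sum.cong[OF refl])
      fix j assume j: "j \<in> {2..n}"
      have "(\<Sum>l\<in>{1..<j}. real (\<nu> l + \<nu> j - k)) = (\<Sum>l\<in>{1..<j}. \<Sum>a<k. t l a * t j (?r a))"
        using subt j by (intro sum.cong) auto
      also have "\<dots> = (\<Sum>a<k. t 1 a * t j (?r a)) + (\<Sum>l\<in>{2..<j}. \<Sum>a<k. t l a * t j (?r a))"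
      proof -
        have "{1..<j} = insert 1 {2..<j}" using j by auto
        then show ?thesis by simp
      qed
      also have "(\<Sum>a<k. t 1 a * t j (?r a)) = (\<Sum>a<k. t j (?r a))"
        using t1 by (intro sum.cong refl) auto
      finally show "(\<Sum>l\<in>{1..<j}. real (\<nu> l + \<nu> j - k)) =
          (\<Sum>a<k. t j (?r a)) + (\<Sum>l\<in>{2..<j}. \<Sum>a<k. t l a * t j (?r a))" .
    qed
    also have "\<dots> = (\<Sum>j\<in>{2..n}. \<Sum>a<k. t j a) + (\<Sum>j\<in>{2..n}. \<Sum>a<k. \<Sum>l\<in>{2..<j}. t l a * t j (?r a))"
      unfolding sum.distrib reflk by (rule arg_cong2[OF refl, of _ _ "(+)"]) (intro sum.cong refl sum.swap)
    also have "(\<Sum>j\<in>{2..n}. \<Sum>a<k. t j a) = (\<Sum>a<k. real (X a))"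
      unfolding tX[symmetric] by (rule sum.swap)
    also have "(\<Sum>j\<in>{2..n}. \<Sum>a<k. \<Sum>l\<in>{2..<j}. t l a * t j (?r a)) = P"
      unfolding P_def by (rule sum.swap)
    finally show ?thesis .
  qed
  have K: "(\<Sum>a<k. layer_excess n (X a) (E a) + layer_excess n (X (?r a)) (E (?r a)) -
      real (X a) * real (X (?r a)) + q a) \<le> (\<Sum>a<k. - 1)"
  proof (rule sum_mono)
    fix a assume "a \<in> {..<k}"
    then have a: "a < k" "?r a < k" by auto
    have *: "E b + X b + 1 \<le> n" "E b + X b \<ge> 1" if "b < k" for b
      using EX[OF that] \<gamma>(1,2)[OF that] by linarith+
    show "layer_excess n (X a) (E a) + layer_excess n (X (?r a)) (E (?r a)) -
      real (X a) * real (X (?r a)) + q a \<le> - 1"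
      using layer_pair_excess[OF n *[OF a(1)] *[OF a(2)]] q[of a] by linarith
  qed
  have "(\<Sum>a<k. layer_excess n (X a) (E a) + layer_excess n (X (?r a)) (E (?r a)) -
      real (X a) * real (X (?r a)) + q a) = 2 * (\<Sum>a<k. layer_excess n (X a) (E a)) - 2 * P"
    unfolding P using reflk[of "\<lambda>a. layer_excess n (X a) (E a)"] by (simp add: sum.distrib sum_subtractf)
  \<comment> \<open>In K every layer is counted twice, which is why the gain is k/2.\<close>
  then have B: "(\<Sum>a<k. layer_excess n (X a) (E a)) - P \<le> - real k / 2" using K by simp
  have "(\<Sum>a<k. layer_excess n (X a) (E a)) =
      (\<Sum>a<k. real (X a) * real (E a)) - (real n / 2 - 7/6) * (\<Sum>a<k. real (E a)) +
      (real n / 4 - 1/12) * ((\<Sum>a<k. real (E a)) - s)"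
    unfolding s sum_distrib_left sum_subtractf[symmetric] sum.distrib[symmetric]
    by (intro sum.cong refl) (simp add: layer_excess_def algebra_simps)
  \<comment> \<open>The multiplier term of the excess may be dropped by the isotropy constraint
    \<open>le\<close>.\<close>
  moreover have "(real n / 4 - 1/12) * ((\<Sum>a<k. real (E a)) - s) \<ge> 0"
  proof -
    have "2 * s \<le> real (\<Sum>a<k. \<gamma> a)" unfolding s_def using le by (metis of_nat_le_iff of_nat_mult of_nat_numeral)
    then show ?thesis using n i by (intro mult_nonneg_nonneg) auto
  qed
  ultimately have B': "(\<Sum>a<k. real (X a) * real (E a)) - P \<le> (real n / 2 - 7/6) * (\<Sum>a<k. real (E a)) - real k / 2"
    using B by linarith
  have "(\<Sum>a<k. real (X a) * real (\<gamma> a)) = (\<Sum>a<k. real (X a) * real (E a)) + (\<Sum>a<k. (real (X a) + 1) * real (X a))"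
    using EX by (simp add: algebra_simps flip: sum.distrib)
  moreover have "s - real k = (\<Sum>a<k. real (X a))" unfolding s by (simp add: sum.distrib)
  ultimately show ?thesis
    using B' S1 S2 S3 i unfolding s_def[symmetric] by (simp add: sum_subtractf)
qed

section \<open>Counting subrings with a given conductor\<close>

lemma double_counting:
  fixes m M :: nat
  assumes "finite A" "finite B" "\<And>a. a \<in> A \<Longrightarrow> m \<le> card {b\<in>B. r a b}"
    "\<And>b. b \<in> B \<Longrightarrow> card {a\<in>A. r a b} \<le> M"
  shows "card A * m \<le> card B * M"
proof -
  have "card A * m \<le> (\<Sum>a\<in>A. card {b\<in>B. r a b})"
    using sum_mono[of A "\<lambda>_. m"] assms(3) by simp
  also have "\<dots> = (\<Sum>a\<in>A. \<Sum>b\<in>{b\<in>B. r a b}. 1)" by simp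
  also have "\<dots> = (\<Sum>b\<in>B. \<Sum>a\<in>{a\<in>A. r a b}. 1)" using assms(1,2) by (rule sum.swap_restrict)
  also have "\<dots> = (\<Sum>b\<in>B. card {a\<in>A. r a b})" by simp
  also have "\<dots> \<le> card B * M" using sum_mono[of B "\<lambda>b. card {a\<in>A. r a b}" "\<lambda>_. M"] assms(4) by simp
  finally show ?thesis .
qed

lemma sum_layer_size:
  "(\<Sum>b<a. layer_size n \<nu> b) = (\<Sum>l\<in>{1..n}. min (\<nu> l) a)"
proof -
  have "(\<Sum>b<a. layer_size n \<nu> b) = (\<Sum>b\<in>{..<a}. \<Sum>l\<in>{l\<in>{1..n}. b < \<nu> l}. 1)"
    unfolding layer_size_def by simp
  also have "\<dots> = (\<Sum>l\<in>{1..n}. \<Sum>b\<in>{b\<in>{..<a}. b < \<nu> l}. 1)" by (rule sum.swap_restrict) auto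
  also have "\<dots> = (\<Sum>l\<in>{1..n}. min (\<nu> l) a)"
  proof (rule sum.cong[OF refl])
    fix l
    have "{b\<in>{..<a}. b < \<nu> l} = {..<min (\<nu> l) a}" by auto
    then show "(\<Sum>b\<in>{b\<in>{..<a}. b < \<nu> l}. 1) = min (\<nu> l) a" by simp
  qed
  finally show ?thesis .
qed

text \<open>The preimage in H of the m-torsion of H/I.\<close>

definition tor :: "'a::comm_ring_1 set \<Rightarrow> nat \<Rightarrow> 'a set \<Rightarrow> 'a set" where
  "tor I m H = {x\<in>H. of_nat m * x \<in> I}"

text \<open>The subgroup mH + I, the preimage of m (H/I).\<close>

definition lev :: "'a::comm_ring_1 set \<Rightarrow> nat \<Rightarrow> 'a set \<Rightarrow> 'a set" where
  "lev I m H = {of_nat m * x + y | x y. x \<in> H \<and> y \<in> I}"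

section \<open>Subrings, their conductors, and the quotient by a fixed conductor\<close>

context prime_reduced
begin

definition subring_of :: "'a set \<Rightarrow> bool" where
  "subring_of L \<longleftrightarrow> add_subgroup L \<and> 1 \<in> L \<and> L \<subseteq> R \<and> (\<forall>x\<in>L. \<forall>y\<in>L. x * y \<in> L)"

text \<open>For a subring L this is the largest ideal of R contained in L.\<close>

definition conductor :: "'a set \<Rightarrow> 'a set" where
  "conductor L = {x\<in>R. \<forall>y\<in>R. x * y \<in> L}"

lemma subring_ofD:
  assumes "subring_of L"
  shows "add_subgroup L" "1 \<in> L" "L \<subseteq> R" "\<And>x y. x \<in> L \<Longrightarrow> y \<in> L \<Longrightarrow> x * y \<in> L"
  using assms unfolding subring_of_def by auto

lemma pw_subset_subring:
  assumes "subring_of L" "idx R L = p ^ i"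
  shows "pw i \<subseteq> L" "finite (cosets R L)"
proof -
  show fin: "finite (cosets R L)" using assms(2) prime_gt_0_nat[OF p] by (intro idx_pos_finite) simp
  show "pw i \<subseteq> L"
    using idx_annihilates[OF subring_ofD(1)[OF assms(1)] R_sub subring_ofD(3)[OF assms(1)] fin] assms(2)
    unfolding pw_def by auto
qed

lemma ideal_conductor:
  assumes L: "subring_of L"
  shows "ideal_of R (conductor L)" "conductor L \<subseteq> L"
proof -
  have "add_subgroup (conductor L)"
    unfolding add_subgroup_def conductor_def
    using R_closed(1,2) add_subgroupD(1,2)[OF subring_ofD(1)[OF L]] by (auto simp: algebra_simps)
  moreover have "x * y \<in> conductor L" if "x \<in> conductor L" "y \<in> R" for x y
    using that R_mult unfolding conductor_def by (auto simp: mult.assoc)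
  ultimately show "ideal_of R (conductor L)" unfolding ideal_of_def conductor_def by auto
  show "conductor L \<subseteq> L" unfolding conductor_def using R_1 by force
qed

lemma pw_subset_conductor:
  assumes "subring_of L" "idx R L = p ^ i"
  shows "pw i \<subseteq> conductor L"
  using pw_subset_subring(1)[OF assms] pw(2,3) unfolding conductor_def by blast

end

text \<open>p^k is the additive order of 1 in R/I and hence the exponent of R/I. The bound 2 n \<le>
  p keeps the characters discarded in \<open>many_nondegenerate\<close> down to at most one
  half.\<close>

locale conductor_quotient = prime_reduced +
  fixes I :: "'a set" and i k :: nat
  assumes n6: "n \<ge> 6" and pn: "2 * n \<le> p" and i1: "i \<ge> 1"
    and I: "ideal_of R I" and pwI_sub: "pw i \<subseteq> I"
    and k: "of_nat (p ^ k) \<in> I" "of_nat (p ^ (k - 1)) \<notin> I" "k \<ge> 1"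
begin

lemmas I_sub = ideal_ofD(1)[OF I]

text \<open>The subgroups of R/I, represented by their preimages in R.\<close>

definition mid :: "'a set \<Rightarrow> bool" where
  "mid H \<longleftrightarrow> add_subgroup H \<and> I \<subseteq> H \<and> H \<subseteq> R"

lemma midD: "mid H \<Longrightarrow> add_subgroup H" "mid H \<Longrightarrow> I \<subseteq> H" "mid H \<Longrightarrow> H \<subseteq> R"
  unfolding mid_def by auto

lemma mid_R: "mid R" and mid_I: "mid I"
  unfolding mid_def using R_sub I_sub ideal_ofD(2)[OF I] by auto

lemma finite_R_I: "finite (cosets R I)"
  using finite_cosets_antimono(1)[OF pw(1) I_sub R_sub pwI_sub ideal_ofD(2)[OF I] finite_pw] .

lemma finite_mid: "mid H \<Longrightarrow> finite (cosets H I)"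
  using finite_cosets_mono[OF finite_R_I] midD(3) by blast

lemma tower_mid: "mid H \<Longrightarrow> mid U \<Longrightarrow> H \<subseteq> U \<Longrightarrow> idx U H * idx H I = idx U I"
  using idx_tower[OF I_sub] unfolding mid_def by blast

lemma finite_mid_mid: "mid H \<Longrightarrow> mid U \<Longrightarrow> H \<subseteq> U \<Longrightarrow> finite (cosets U H)"
  using finite_cosets_tower[OF I_sub] finite_mid unfolding mid_def by blast

lemma idx_mid_pos: "mid H \<Longrightarrow> mid U \<Longrightarrow> H \<subseteq> U \<Longrightarrow> idx U H > 0"
  using idx_pos[OF finite_mid_mid] add_subgroupD(1)[OF midD(1)] by blast

lemma pk_mult: "x \<in> R \<Longrightarrow> of_nat (p ^ k) * x \<in> I"
  using ideal_ofD(3)[OF I k(1)] .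

lemma of_nat_mult_I: "x \<in> I \<Longrightarrow> of_nat m * x \<in> I"
  by (rule add_subgroup_of_nat[OF I_sub])

lemma idx_mid_power: "mid H \<Longrightarrow> mid U \<Longrightarrow> H \<subseteq> U \<Longrightarrow> \<exists>c. idx U H = p ^ c"
  using idx_prime_power[of H U p k] finite_mid_mid p pk_mult midD by (metis subset_iff)

lemma tor_sub: "tor I m H \<subseteq> H"
  unfolding tor_def by auto

lemma mid_tor: "mid H \<Longrightarrow> mid (tor I m H)"
  unfolding mid_def tor_def add_subgroup_def
  using add_subgroupD(1,2)[OF I_sub] of_nat_mult_I by (auto simp: algebra_simps)

lemma tor_1: "mid H \<Longrightarrow> tor I 1 H = I"
  unfolding tor_def mid_def by auto

lemma tor_pk: "mid H \<Longrightarrow> tor I (p ^ k) H = H"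
  unfolding tor_def using pk_mult midD(3) by blast

lemma tor_mono: "m dvd m' \<Longrightarrow> tor I m H \<subseteq> tor I m' H"
proof
  fix x assume "m dvd m'" "x \<in> tor I m H"
  then obtain c where "m' = c * m" "x \<in> H" "of_nat m * x \<in> I" unfolding tor_def by (metis (no_types, lifting) dvd_def mem_Collect_eq mult.commute)
  then show "x \<in> tor I m' H" unfolding tor_def using of_nat_mult_I[of "of_nat m * x" c] by (simp add: mult.assoc)
qed

lemma mid_lev: "mid H \<Longrightarrow> mid (lev I m H)"
proof -
  assume H: "mid H"
  have mem: "of_nat m * x + y \<in> lev I m H" if "x \<in> H" "y \<in> I" for x y
    using that unfolding lev_def by blast
  have "add_subgroup (lev I m H)"
    unfolding add_subgroup_def
  proof (intro conjI ballI)
    show "0 \<in> lev I m H" using mem[OF add_subgroupD(1)[OF midD(1)[OF H]] add_subgroupD(1)[OF I_sub]] by simp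
    fix a b assume "a \<in> lev I m H" "b \<in> lev I m H"
    then obtain x y x' y' where *: "x \<in> H" "y \<in> I" "x' \<in> H" "y' \<in> I" "a = of_nat m * x + y" "b = of_nat m * x' + y'"
      unfolding lev_def by blast
    have "a - b = of_nat m * (x - x') + (y - y')" using * by (simp add: algebra_simps)
    then show "a - b \<in> lev I m H"
      using mem[OF add_subgroupD(2)[OF midD(1)[OF H] *(1,3)] add_subgroupD(2)[OF I_sub *(2,4)]] by simp
  qed
  moreover have "I \<subseteq> lev I m H" using mem[OF add_subgroupD(1)[OF midD(1)[OF H]]] by auto
  moreover have "lev I m H \<subseteq> R"
  proof
    fix z assume "z \<in> lev I m H"
    then obtain x y where "x \<in> H" "y \<in> I" "z = of_nat m * x + y" unfolding lev_def by blast
    then show "z \<in> R" using midD(3)[OF H] ideal_ofD(2)[OF I] R_closed(4) R_mult[OF R_of_nat] by blast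
  qed
  ultimately show ?thesis unfolding mid_def by blast
qed

lemma lev_sub: "mid H \<Longrightarrow> lev I m H \<subseteq> H"
proof
  fix z assume H: "mid H" and "z \<in> lev I m H"
  then obtain x y where "x \<in> H" "y \<in> I" "z = of_nat m * x + y" unfolding lev_def by blast
  then show "z \<in> H" using midD(1,2)[OF H] add_subgroupD(4) add_subgroup_of_nat by blast
qed

lemma lev_I: "lev I m I = I"
  using lev_sub[OF mid_I] midD(2)[OF mid_lev[OF mid_I]] by blast

lemma lev_1: "mid H \<Longrightarrow> lev I 1 H = H"
proof -
  assume H: "mid H"
  have "x \<in> lev I 1 H" if "x \<in> H" for x
    unfolding lev_def using that add_subgroupD(1)[OF I_sub] by force
  then show ?thesis using lev_sub[OF H] by blast
qed

lemma idx_lev: "idx ((*) (of_nat m) ` H) I = idx (lev I m H) I"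
proof -
  have "cosets ((*) (of_nat m) ` H) I = cosets (lev I m H) I"
  proof (intro equalityI subsetI)
    fix c assume "c \<in> cosets ((*) (of_nat m) ` H) I"
    then obtain x where "x \<in> H" "c = (+) (of_nat m * x + 0) ` I" unfolding cosets_def by auto
    then show "c \<in> cosets (lev I m H) I"
      unfolding cosets_def lev_def using add_subgroupD(1)[OF I_sub] by blast
  next
    fix c assume "c \<in> cosets (lev I m H) I"
    then obtain x y where x: "x \<in> H" "y \<in> I" "c = (+) (of_nat m * x + y) ` I" unfolding cosets_def lev_def by auto
    then have "c = (+) (of_nat m * x) ` I" using coset_eq_iff[OF I_sub, of "of_nat m * x + y" "of_nat m * x"] by simp
    then show "c \<in> cosets ((*) (of_nat m) ` H) I" unfolding cosets_def using x by blast
  qed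
  then show ?thesis unfolding idx_def by simp
qed

lemma idx_tor: "mid H \<Longrightarrow> idx H (tor I m H) = idx (lev I m H) I"
  using idx_hom(1)[OF midD(1) I_sub, of H "(*) (of_nat m)"] unfolding idx_lev[symmetric] tor_def
  by (simp add: algebra_simps)

lemma tor_lev: "mid H \<Longrightarrow> idx (lev I m H) I * idx (tor I m H) I = idx H I"
  using idx_tor tower_mid[OF mid_tor _ tor_sub] by metis

text \<open>Multiplication by p^a has the p^a-torsion as its kernel, so it identifies each torsion
  layer with a subgroup of R/I; layers can then be compared by inclusion.\<close>

lemma idx_tor_step: "mid H \<Longrightarrow> idx (tor I (p ^ Suc a) H) (tor I (p ^ a) H) = idx (lev I (p ^ a) (tor I (p ^ Suc a) H)) I"
proof -
  assume H: "mid H"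
  have "tor I (p ^ a) (tor I (p ^ Suc a) H) = tor I (p ^ a) H"
    using tor_mono[of "p ^ a" "p ^ Suc a" H] unfolding tor_def by auto
  then show ?thesis using idx_tor[OF mid_tor[OF H], of "p ^ Suc a" "p ^ a"] by simp
qed

lemma lev_mono: "H \<subseteq> U \<Longrightarrow> lev I m H \<subseteq> lev I m U"
  unfolding lev_def by blast

lemma idx_I_mono: "mid U \<Longrightarrow> H \<subseteq> U \<Longrightarrow> idx H I \<le> idx U I"
  using idx_mono[OF finite_mid] by blast

text \<open>If p^(a + 2) kills x, then p^(a + 1) kills p x, so each layer, pushed down by its power
  of p, lies in the previous one.\<close>

lemma idx_tor_step_decreasing:
  assumes H: "mid H"
  shows "idx (tor I (p ^ Suc (Suc a)) H) (tor I (p ^ Suc a) H) \<le> idx (tor I (p ^ Suc a) H) (tor I (p ^ a) H)"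
proof -
  have "lev I (p ^ Suc a) (tor I (p ^ Suc (Suc a)) H) \<subseteq> lev I (p ^ a) (tor I (p ^ Suc a) H)"
  proof
    fix z assume "z \<in> lev I (p ^ Suc a) (tor I (p ^ Suc (Suc a)) H)"
    then obtain x y where z: "x \<in> H" "of_nat (p ^ Suc (Suc a)) * x \<in> I" "y \<in> I" "z = of_nat (p ^ Suc a) * x + y"
      unfolding lev_def tor_def by blast
    have 1: "of_nat (p ^ Suc a) * x = of_nat (p ^ a) * (of_nat p * x)"
      "of_nat (p ^ Suc (Suc a)) * x = of_nat (p ^ Suc a) * (of_nat p * x)"
      by (simp_all add: mult.assoc mult.left_commute)
    have "of_nat p * x \<in> tor I (p ^ Suc a) H"
      using z(2) add_subgroup_of_nat[OF midD(1)[OF H] z(1)] unfolding tor_def 1(2) by blast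
    then show "z \<in> lev I (p ^ a) (tor I (p ^ Suc a) H)" unfolding lev_def z(4) 1(1) using z(3) by blast
  qed
  then show ?thesis unfolding idx_tor_step[OF H] by (rule idx_I_mono[OF mid_lev[OF mid_tor[OF H]]])
qed

lemma idx_tor_step_mono:
  assumes "mid H" "mid U" "H \<subseteq> U"
  shows "idx (tor I (p ^ Suc a) H) (tor I (p ^ a) H) \<le> idx (tor I (p ^ Suc a) U) (tor I (p ^ a) U)"
proof -
  have "tor I m H \<subseteq> tor I m U" for m using assms(3) unfolding tor_def by blast
  then show ?thesis
    unfolding idx_tor_step[OF assms(1)] idx_tor_step[OF assms(2)]
    by (intro idx_I_mono mid_lev mid_tor assms lev_mono)
qed

text \<open>In the finite group R/I the p-torsion is as large as the quotient by p, and that is a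
  quotient of R/p.\<close>

lemma idx_tor_p: "idx (tor I p R) I \<le> p ^ n"
proof -
  have "pw 1 \<subseteq> lev I p R"
    unfolding pw_def lev_def using add_subgroupD(1)[OF I_sub] by force
  then have "idx R (lev I p R) \<le> idx R (pw 1)"
    by (rule finite_cosets_antimono(2)[OF pw(1) midD(1)[OF mid_lev[OF mid_R]] R_sub _ lev_sub[OF mid_R] finite_pw])
  then have "idx R (lev I p R) \<le> p ^ n" using idx_p unfolding pw_1 by simp
  moreover have "idx R (lev I p R) * idx (lev I p R) I = idx (tor I p R) I * idx (lev I p R) I"
    using tower_mid[OF mid_lev[OF mid_R] mid_R lev_sub[OF mid_R]] tor_lev[OF mid_R] by (metis mult.commute)
  moreover have "idx (lev I p R) I > 0" using idx_mid_pos[OF mid_I mid_lev[OF mid_R]] midD(2)[OF mid_lev[OF mid_R]] by blast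
  ultimately show ?thesis by simp
qed

lemma idx_tor_step_le: "mid H \<Longrightarrow> idx (tor I (p ^ Suc a) H) (tor I (p ^ a) H) \<le> p ^ n"
proof (induction a)
  case 0
  then show ?case using idx_tor_step_mono[OF 0 mid_R midD(3)[OF 0], of 0] idx_tor_p tor_1[OF mid_R] by simp
next
  case (Suc a)
  then show ?case using idx_tor_step_decreasing[OF Suc(2), of a] by simp
qed

lemma mid_adjoin: "mid X \<Longrightarrow> z \<in> R \<Longrightarrow> mid (adjoin X z)"
  unfolding mid_def using add_subgroup_adjoin adjoin_subset[OF R_sub] subset_adjoin by blast

lemma lev_adjoin: "lev I m (adjoin X z) = adjoin (lev I m X) (of_nat m * z)"
proof (intro equalityI subsetI)
  fix w assume "w \<in> lev I m (adjoin X z)"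
  then obtain x j y where "x \<in> X" "y \<in> I" "w = of_nat m * (x + of_int j * z) + y"
    unfolding lev_def adjoin_def by blast
  then have "x \<in> X" "y \<in> I" "w = (of_nat m * x + y) + of_int j * (of_nat m * z)" by (auto simp: algebra_simps)
  then show "w \<in> adjoin (lev I m X) (of_nat m * z)" unfolding adjoin_def lev_def by blast
next
  fix w assume "w \<in> adjoin (lev I m X) (of_nat m * z)"
  then obtain x j y where "x \<in> X" "y \<in> I" "w = (of_nat m * x + y) + of_int j * (of_nat m * z)"
    unfolding lev_def adjoin_def by blast
  then have "x \<in> X" "y \<in> I" "w = of_nat m * (x + of_int j * z) + y" by (auto simp: algebra_simps)
  then show "w \<in> lev I m (adjoin X z)" unfolding adjoin_def lev_def by blast
qed

text \<open>The hypotheses make z generate, modulo I, a cyclic group of order p^c that meets X/I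
  trivially; multiplying the direct sum by p^t shortens the new factor to p^(c - t).\<close>

lemma idx_lev_adjoin:
  assumes X: "mid X" and z: "z \<in> R" "of_nat (p ^ c) * z \<in> I" "c > 0 \<Longrightarrow> of_nat (p ^ (c - 1)) * z \<notin> X"
  shows "idx (lev I (p ^ t) (adjoin X z)) I = idx (lev I (p ^ t) X) I * p ^ (c - t)"
proof -
  let ?U = "lev I (p ^ t) X" and ?z = "of_nat (p ^ t) * z"
  have U: "mid ?U" using mid_lev[OF X] .
  have "of_nat (p ^ (c - t)) * ?z \<in> ?U"
  proof -
    \<comment> \<open>Since subtraction truncates, c - t + t is the maximum of c and t.\<close>
    have "c - t + t = (c - t + t - c) + c" by simp
    then have "p ^ (c - t) * p ^ t = p ^ (c - t + t - c) * p ^ c" by (metis power_add)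
    then have "of_nat (p ^ (c - t)) * ?z = of_nat (p ^ (c - t + t - c)) * (of_nat (p ^ c) * z)"
      unfolding mult.assoc[symmetric] of_nat_mult[symmetric] by (rule arg_cong)
    then show ?thesis using of_nat_mult_I[OF z(2)] midD(2)[OF U] by (metis subset_iff)
  qed
  moreover have "of_nat (p ^ (c - t - 1)) * ?z \<notin> ?U" if "c - t > 0"
  proof -
    have "c - t - 1 + t = c - 1" using that by simp
    then have "p ^ (c - t - 1) * p ^ t = p ^ (c - 1)" by (metis power_add)
    then have "of_nat (p ^ (c - t - 1)) * ?z = of_nat (p ^ (c - 1)) * z"
      unfolding mult.assoc[symmetric] of_nat_mult[symmetric] by (rule arg_cong)
    then show ?thesis using z(3) that lev_sub[OF X, of "p ^ t"] by (metis subset_iff zero_less_diff gr_zeroI not_less_zero)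
  qed
  ultimately have "idx (adjoin ?U ?z) ?U = p ^ (c - t)"
    by (rule idx_adjoin_prime_power(1)[OF midD(1)[OF U] p])
  moreover have "idx (adjoin ?U ?z) ?U * idx ?U I = idx (adjoin ?U ?z) I"
    using tower_mid[OF U mid_adjoin[OF U] subset_adjoin] R_mult[OF R_of_nat z(1)] by blast
  ultimately show ?thesis unfolding lev_adjoin by (simp add: mult.commute)
qed

definition adjoin_1 :: "'a set" where "adjoin_1 = adjoin I 1"

lemma mid_adjoin_1: "mid adjoin_1"
  unfolding adjoin_1_def by (rule mid_adjoin[OF mid_I R_1])

lemma idx_lev_adjoin_1: "idx (lev I (p ^ t) adjoin_1) I = p ^ (k - t)"
  unfolding adjoin_1_def using idx_lev_adjoin[OF mid_I R_1, of k t] k idx_self[OF I_sub] lev_I by simp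

lemma idx_adjoin_1: "idx adjoin_1 I = p ^ k"
  using idx_lev_adjoin_1[of 0] lev_1[OF mid_adjoin_1] by simp

subsection \<open>Nondegenerate characters\<close>

text \<open>The form \<xi>(x y) has radical I. Triviality on I + Z is imposed because every subring
  with conductor I contains I + Z.\<close>

definition nondegenerate :: "('a \<Rightarrow> complex) set" where
  "nondegenerate = {\<xi> \<in> chars R adjoin_1. \<forall>x\<in>R. (\<forall>y\<in>R. \<xi> (x * y) = 1) \<longrightarrow> x \<in> I}"

lemma nondegenerateD:
  assumes "\<xi> \<in> nondegenerate"
  shows "\<xi> \<in> chars R adjoin_1" "\<And>x. x \<in> R \<Longrightarrow> (\<And>y. y \<in> R \<Longrightarrow> \<xi> (x * y) = 1) \<Longrightarrow> x \<in> I"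
    "\<And>x. x \<in> I \<Longrightarrow> \<xi> x = 1" "\<And>x y. x \<in> R \<Longrightarrow> y \<in> R \<Longrightarrow> \<xi> (x + y) = \<xi> x * \<xi> y"
proof -
  show c: "\<xi> \<in> chars R adjoin_1" using assms unfolding nondegenerate_def by blast
  show "x \<in> I" if "x \<in> R" "\<And>y. y \<in> R \<Longrightarrow> \<xi> (x * y) = 1" for x
    using assms that unfolding nondegenerate_def by blast
  show "\<xi> x = 1" if "x \<in> I" for x using charsD(2)[OF c] midD(2)[OF mid_adjoin_1] that by blast
  show "\<xi> (x + y) = \<xi> x * \<xi> y" if "x \<in> R" "y \<in> R" for x y using charsD(1)[OF c that] .
qed

lemma nondegenerate_diff:
  assumes "\<xi> \<in> nondegenerate" "x \<in> R" "y \<in> R"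
  shows "\<xi> (x - y) * \<xi> y = \<xi> x"
  using chars_diff(1)[OF nondegenerateD(1)[OF assms(1)] R_sub midD(1)[OF mid_adjoin_1] assms(2,3)] .

text \<open>The factor p^k is the size of (I + Z)/I, on which these characters are trivial; it
  becomes the term -k of the exponent.\<close>

lemma card_nondegenerate:
  "finite nondegenerate" "card nondegenerate * p ^ k \<le> idx R I"
proof -
  have c: "finite (chars R adjoin_1)" "card (chars R adjoin_1) = idx R adjoin_1"
    using card_chars[OF midD(1)[OF mid_adjoin_1] R_sub midD(3)[OF mid_adjoin_1]
        finite_mid_mid[OF mid_adjoin_1 mid_R midD(3)[OF mid_adjoin_1]]] by auto
  have s: "nondegenerate \<subseteq> chars R adjoin_1" unfolding nondegenerate_def by blast
  show "finite nondegenerate" using finite_subset[OF s c(1)] .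
  have "card nondegenerate * p ^ k \<le> idx R adjoin_1 * idx adjoin_1 I"
    using card_mono[OF c(1) s] c(2) idx_adjoin_1 by simp
  then show "card nondegenerate * p ^ k \<le> idx R I"
    using tower_mid[OF mid_adjoin_1 mid_R midD(3)[OF mid_adjoin_1]] by simp
qed

text \<open>A subring of conductor \<open>I\<close> is killed by many nondegenerate characters: those characters of
  \<open>R/L\<close> that are degenerate vanish on one of the few minimal ideals of \<open>R/I\<close>.\<close>

lemma many_nondegenerate:
  assumes L: "subring_of L" "idx R L = p ^ i" "conductor L = I"
  shows "p ^ i \<le> 2 * card {\<xi>\<in>nondegenerate. \<forall>x\<in>L. \<xi> x = 1}"
proof -
  note Ls = subring_ofD[OF L(1)]
  have IL: "I \<subseteq> L" using ideal_conductor(2)[OF L(1)] L(3) by simp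
  have midL: "mid L" unfolding mid_def using Ls IL by blast
  have a1L: "adjoin_1 \<subseteq> L" unfolding adjoin_1_def by (rule adjoin_subset[OF Ls(1) IL Ls(2)])
  obtain Z where Z: "finite Z" "card Z \<le> n" "Z \<subseteq> R - I" "\<And>x. x \<in> R \<Longrightarrow> x \<notin> I \<Longrightarrow> \<exists>z\<in>Z. \<exists>y\<in>R. z - x * y \<in> I"
    using socle[OF i1 I pwI_sub] by blast
  define D where "D = chars R L"
  have D: "finite D" "card D = p ^ i"
    using card_chars[OF Ls(1) R_sub Ls(3) pw_subset_subring(2)[OF L(1,2)]] L(2) unfolding D_def by auto
  \<comment> \<open>The subgroup L + zR; a degenerate character of R/L is trivial on one of
    these.\<close>
  define W where "W z = {l + z * y | l y. l \<in> L \<and> y \<in> R}" for z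
  have W: "p * card (chars R (W z)) \<le> p ^ i" "\<And>l y. l \<in> L \<Longrightarrow> y \<in> R \<Longrightarrow> l + z * y \<in> W z" if z: "z \<in> Z" for z
  proof -
    show mem: "\<And>l y. l \<in> L \<Longrightarrow> y \<in> R \<Longrightarrow> l + z * y \<in> W z" unfolding W_def by blast
    have zR: "z \<in> R" "z \<notin> I" using Z(3) z by auto
    have "add_subgroup (W z)"
      unfolding add_subgroup_def
    proof (intro conjI ballI)
      show "0 \<in> W z" using mem[OF add_subgroupD(1)[OF Ls(1)] R_closed(1)] by simp
      fix a b assume "a \<in> W z" "b \<in> W z"
      then obtain l y l' y' where *: "l \<in> L" "y \<in> R" "l' \<in> L" "y' \<in> R" "a = l + z * y" "b = l' + z * y'"
        unfolding W_def by blast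
      have "a - b = (l - l') + z * (y - y')" using * by (simp add: algebra_simps)
      then show "a - b \<in> W z"
        using mem[OF add_subgroupD(2)[OF Ls(1) *(1,3)] R_closed(2)[OF *(2,4)]] by simp
    qed
    moreover have LW: "L \<subseteq> W z" using mem[OF _ R_closed(1)] by auto
    moreover have WR: "W z \<subseteq> R"
    proof
      fix w assume "w \<in> W z"
      then obtain l y where "l \<in> L" "y \<in> R" "w = l + z * y" unfolding W_def by blast
      then show "w \<in> R" using Ls(3) R_closed(4) R_mult[OF zR(1)] by blast
    qed
    ultimately have midW: "mid (W z)" unfolding mid_def using IL by blast
    obtain c where c: "idx (W z) L = p ^ c" using idx_mid_power[OF midL midW LW] by blast
    \<comment> \<open>If L + zR were L, then z would lie in the conductor.\<close>
    have "c \<noteq> 0"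
    proof
      assume "c = 0"
      then have "W z = L" using idx_1_iff[OF Ls(1) midD(1)[OF midW] LW] c by simp
      then have "z * y \<in> L" if "y \<in> R" for y using mem[OF add_subgroupD(1)[OF Ls(1)] that] by simp
      then show False using zR L(3) unfolding conductor_def by blast
    qed
    then have "p dvd p ^ c" by simp
    then have "p \<le> idx (W z) L" unfolding c using prime_gt_0_nat[OF p] by (intro dvd_imp_le) auto
    moreover have "idx R (W z) * idx (W z) L = p ^ i"
      using idx_tower[OF Ls(1) midD(1)[OF midW] R_sub LW WR] L(2) by simp
    ultimately have "p * idx R (W z) \<le> p ^ i" by (metis mult.commute mult_le_mono1)
    moreover have "card (chars R (W z)) = idx R (W z)"
      using card_chars[OF midD(1)[OF midW] R_sub WR finite_mid_mid[OF midW mid_R WR]] by blast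
    ultimately show "p * card (chars R (W z)) \<le> p ^ i" by simp
  qed
  define B where "B = (\<Union>z\<in>Z. chars R (W z))"
  have BD: "B \<subseteq> D"
  proof
    fix \<xi> assume "\<xi> \<in> B"
    then obtain z where z: "z \<in> Z" "\<xi> \<in> chars R (W z)" unfolding B_def by blast
    have "L \<subseteq> W z" using W(2)[OF z(1) _ R_closed(1)] by auto
    then show "\<xi> \<in> D" using z(2) chars_mono unfolding D_def by blast
  qed
  have "p * card B \<le> (\<Sum>z\<in>Z. p * card (chars R (W z)))"
    unfolding B_def sum_distrib_left[symmetric] using card_UN_le[OF Z(1)] by (intro mult_le_mono) auto
  also have "\<dots> \<le> (\<Sum>z\<in>Z. p ^ i)" by (rule sum_mono) (rule W(1))
  also have "\<dots> \<le> n * p ^ i" using Z(2) by simp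
  \<comment> \<open>At most n sets of at most p^(i - 1) characters each, and 2 n \<le> p: less than
    or equal to half of all p^i characters is lost.\<close>
  finally have "2 * (p * card B) \<le> p * p ^ i" using pn mult_le_mono1[OF pn, of "p ^ i"] by linarith
  then have B2: "2 * card B \<le> p ^ i" using prime_gt_0_nat[OF p] by simp
  have "D - B \<subseteq> {\<xi>\<in>nondegenerate. \<forall>x\<in>L. \<xi> x = 1}"
  proof
    fix \<xi> assume \<xi>: "\<xi> \<in> D - B"
    then have cL: "\<xi> \<in> chars R L" unfolding D_def by blast
    then have ca: "\<xi> \<in> chars R adjoin_1" using chars_mono[OF a1L] by blast
    \<comment> \<open>A nonzero ideal in the radical contains a socle element z, so \<xi> is trivial
      on zR and therefore on W z.\<close>
    have "x \<in> I" if x: "x \<in> R" "\<forall>y\<in>R. \<xi> (x * y) = 1" for x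
    proof (rule ccontr)
      assume "x \<notin> I"
      then obtain z y where z: "z \<in> Z" "y \<in> R" "z - x * y \<in> I" using Z(4)[OF x(1)] by blast
      have zR: "z \<in> R" using z(1) Z(3) by blast
      have zw: "\<xi> (z * w) = 1" if w: "w \<in> R" for w
      proof -
        have i: "(z - x * y) * w \<in> I" using ideal_ofD(3)[OF I z(3) w] .
        have "\<xi> (z * w) = \<xi> ((z - x * y) * w + x * (y * w))" by (simp add: algebra_simps)
        also have "\<dots> = \<xi> ((z - x * y) * w) * \<xi> (x * (y * w))"
          using charsD(1)[OF cL] i ideal_ofD(2)[OF I] R_mult[OF x(1) R_mult[OF z(2) w]] by blast
        also have "\<dots> = 1" using charsD(2)[OF cL] i IL x(2) R_mult[OF z(2) w] by auto
        finally show ?thesis .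
      qed
      have "\<xi> v = 1" if vW: "v \<in> W z" for v
      proof -
        obtain l w where v: "l \<in> L" "w \<in> R" "v = l + z * w" using vW unfolding W_def by blast
        have "\<xi> v = \<xi> l * \<xi> (z * w)" unfolding v(3) using charsD(1)[OF cL] v Ls(3) R_mult[OF zR] by blast
        then show ?thesis using zw[OF v(2)] charsD(2)[OF cL v(1)] by simp
      qed
      then have "\<xi> \<in> chars R (W z)" using cL unfolding chars_def by blast
      then show False using \<xi> z(1) unfolding B_def by blast
    qed
    then show "\<xi> \<in> {\<xi>\<in>nondegenerate. \<forall>x\<in>L. \<xi> x = 1}"
      unfolding nondegenerate_def using ca charsD(2)[OF cL] by blast
  qed
  then have "card (D - B) \<le> card {\<xi>\<in>nondegenerate. \<forall>x\<in>L. \<xi> x = 1}"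
    using card_nondegenerate(1) by (intro card_mono) auto
  moreover have "card (D - B) = card D - card B" using BD D(1) by (meson card_Diff_subset finite_subset)
  ultimately show ?thesis using B2 D(2) by linarith
qed

definition perp :: "('a \<Rightarrow> complex) \<Rightarrow> nat \<Rightarrow> 'a set \<Rightarrow> 'a set" where
  "perp \<xi> \<nu> X = {y \<in> tor I (p ^ \<nu>) R. \<forall>x\<in>X. \<xi> (x * y) = 1}"

lemma mid_perp:
  assumes "\<xi> \<in> nondegenerate" "X \<subseteq> R"
  shows "mid (perp \<xi> \<nu> X)"
proof -
  have T: "mid (tor I (p ^ \<nu>) R)" using mid_tor[OF mid_R] .
  have "I \<subseteq> perp \<xi> \<nu> X"
    unfolding perp_def using midD(2)[OF T] nondegenerateD(3)[OF assms(1)] ideal_ofD(4)[OF I] assms(2) by blast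
  moreover have "y - y' \<in> perp \<xi> \<nu> X" if y: "y \<in> perp \<xi> \<nu> X" "y' \<in> perp \<xi> \<nu> X" for y y'
  proof -
    have yt: "y \<in> tor I (p ^ \<nu>) R" "y' \<in> tor I (p ^ \<nu>) R" using y unfolding perp_def by auto
    have "\<xi> (x * (y - y')) = 1" if x: "x \<in> X" for x
      using nondegenerate_diff[OF assms(1), of "x * y" "x * y'"] x y assms(2) R_mult yt midD(3)[OF T]
      unfolding perp_def by (auto simp: right_diff_distrib subset_iff)
    then show ?thesis unfolding perp_def using add_subgroupD(2)[OF midD(1)[OF T] yt] by blast
  qed
  ultimately show ?thesis
    unfolding mid_def add_subgroup_def using add_subgroupD(1)[OF I_sub] midD(3)[OF T] unfolding perp_def by blast
qed

text \<open>The p^\<nu>-torsion of R/I contains p^(k - \<nu>) R/I. An x that pairs trivially with it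
  is therefore killed by p^(k - \<nu>), so p^(k - \<nu>) X/I embeds into the characters of the
  torsion modulo the orthogonal complement.\<close>

lemma card_perp:
  assumes \<xi>: "\<xi> \<in> nondegenerate" and X: "mid X" and \<nu>: "\<nu> \<le> k"
  shows "idx (perp \<xi> \<nu> X) I * idx (lev I (p ^ (k - \<nu>)) X) I \<le> idx (tor I (p ^ \<nu>) R) I"
proof -
  let ?Y = "perp \<xi> \<nu> X" and ?T = "tor I (p ^ \<nu>) R"
  have T: "mid ?T" using mid_tor[OF mid_R] .
  have Y: "mid ?Y" using mid_perp[OF \<xi> midD(3)[OF X]] .
  have YT: "?Y \<subseteq> ?T" unfolding perp_def by blast
  have "idx X (tor I (p ^ (k - \<nu>)) X) \<le> idx ?T ?Y"
  proof (rule idx_pairing(1)[OF midD(1)[OF X] midD(1)[OF T] midD(1)[OF Y] YT finite_mid_mid[OF Y T YT]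
        midD(1)[OF mid_tor[OF X]], where \<beta> = "\<lambda>x y. \<xi> (x * y)"])
    fix x y y' assume "x \<in> X" "y \<in> ?T" "y' \<in> ?T"
    then show "\<xi> (x * (y + y')) = \<xi> (x * y) * \<xi> (x * y')"
      using nondegenerateD(4)[OF \<xi>] midD(3)[OF X] midD(3)[OF T] R_mult by (auto simp: distrib_left subset_iff)
  next
    fix x x' y assume "x \<in> X" "x' \<in> X" "y \<in> ?T"
    then show "\<xi> ((x - x') * y) * \<xi> (x' * y) = \<xi> (x * y)"
      using nondegenerate_diff[OF \<xi>, of "x * y" "x' * y"] midD(3)[OF X] midD(3)[OF T] R_mult
      by (auto simp: left_diff_distrib subset_iff)
  next
    fix x y assume "x \<in> X" "y \<in> ?Y"
    then show "\<xi> (x * y) = 1" unfolding perp_def by blast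
  next
    fix x assume x: "x \<in> X" "\<And>y. y \<in> ?T \<Longrightarrow> \<xi> (x * y) = 1"
    have xR: "x \<in> R" using x(1) midD(3)[OF X] by blast
    have "of_nat (p ^ (k - \<nu>)) * x \<in> I"
    proof (rule nondegenerateD(2)[OF \<xi> R_mult[OF R_of_nat xR]])
      fix y assume y: "y \<in> R"
      have "p ^ \<nu> * p ^ (k - \<nu>) = p ^ k" using \<nu> by (simp flip: power_add)
      then have "of_nat (p ^ \<nu>) * (of_nat (p ^ (k - \<nu>)) * y) = of_nat (p ^ k) * y"
        unfolding mult.assoc[symmetric] of_nat_mult[symmetric] by (rule arg_cong)
      then have "of_nat (p ^ (k - \<nu>)) * y \<in> ?T"
        unfolding tor_def using pk_mult[OF y] R_mult[OF R_of_nat y] by (metis (mono_tags, lifting) mem_Collect_eq)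
      from x(2)[OF this] show "\<xi> (of_nat (p ^ (k - \<nu>)) * x * y) = 1" by (simp add: mult.assoc mult.left_commute)
    qed
    then show "x \<in> tor I (p ^ (k - \<nu>)) X" unfolding tor_def using x(1) by blast
  qed
  then have "idx (lev I (p ^ (k - \<nu>)) X) I \<le> idx ?T ?Y" using idx_tor[OF X] by simp
  then have "idx ?Y I * idx (lev I (p ^ (k - \<nu>)) X) I \<le> idx ?Y I * idx ?T ?Y" by simp
  also have "\<dots> = idx ?T I" using tower_mid[OF Y T YT] by (simp add: mult.commute)
  finally show ?thesis .
qed

end

lemma cosetsE:
  assumes "c \<in> cosets T H"
  obtains x where "x \<in> T" "c = (+) x ` H"
  using assms unfolding cosets_def by blast

lemma downward_closed_nat:
  fixes S :: "nat set"
  assumes "finite S" "\<And>a b. b \<in> S \<Longrightarrow> a \<le> b \<Longrightarrow> a \<in> S"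
  shows "S = {..<card S}"
proof (cases "S = {}")
  case False
  have "S = {..Max S}" using assms Max_in[OF assms(1) False] Max_ge[OF assms(1)] by blast
  then show ?thesis by (metis card_atMost lessThan_Suc_atMost)
qed simp

context prime_reduced
begin

lemma finite_intermediate: "finite {L. add_subgroup L \<and> pw i \<subseteq> L \<and> L \<subseteq> R}"
proof -
  let ?S = "{L. add_subgroup L \<and> pw i \<subseteq> L \<and> L \<subseteq> R}"
  have sub: "L \<subseteq> L'" if h: "add_subgroup L'" "pw i \<subseteq> L'" "cosets L (pw i) \<subseteq> cosets L' (pw i)" for L L'
  proof
    fix x assume "x \<in> L"
    then obtain y where y: "y \<in> L'" "(+) x ` pw i = (+) y ` pw i" using h(3) unfolding cosets_def by blast
    then have "x - y \<in> L'" using coset_eq_iff[OF pw(1)] h(2) by blast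
    from add_subgroupD(4)[OF h(1) this y(1)] show "x \<in> L'" by simp
  qed
  have "inj_on (\<lambda>L. cosets L (pw i)) ?S"
  proof (rule inj_onI)
    fix L L' assume *: "L \<in> ?S" "L' \<in> ?S" "cosets L (pw i) = cosets L' (pw i)"
    show "L = L'" using sub[of L' L] sub[of L L'] * by simp
  qed
  moreover have "(\<lambda>L. cosets L (pw i)) ` ?S \<subseteq> Pow (cosets R (pw i))" unfolding cosets_def by blast
  ultimately show ?thesis using finite_pw[of i] by (meson finite_Pow_iff inj_on_finite)
qed

end

section \<open>Types of subrings and the choice of generators one at a time\<close>

context conductor_quotient
begin

declare of_nat_power [simp del]

text \<open>This says that \<open>L/I\<close> is a direct sum of \<open>n\<close> cyclic groups of the orders \<open>p\<^sup>\<nu>\<close> for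
  \<open>\<nu> 1, \<dots>, \<nu> n\<close>.\<close>

definition has_type :: "(nat \<Rightarrow> nat) \<Rightarrow> 'a set \<Rightarrow> bool" where
  "has_type \<nu> L \<longleftrightarrow> (\<forall>a. idx (tor I (p ^ Suc a) L) (tor I (p ^ a) L) = p ^ layer_size n \<nu> a)"

text \<open>Partitions padded by zeros to length n, with largest part k because 1 has order p^k and
  p^k kills R/I.\<close>

definition types :: "(nat \<Rightarrow> nat) set" where
  "types = {\<nu> \<in> {1..n} \<rightarrow>\<^sub>E {..k}. \<nu> 1 = k \<and> (\<forall>l\<in>{1..n}. \<forall>l'\<in>{1..n}. l \<le> l' \<longrightarrow> \<nu> l' \<le> \<nu> l)}"

lemma p_power_le_iff: "p ^ a \<le> p ^ b \<longleftrightarrow> a \<le> b"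
  using prime_gt_1_nat[OF p] by simp

lemma p_power_eq_iff: "p ^ a = p ^ b \<longleftrightarrow> a = b"
  using prime_gt_1_nat[OF p] by simp

lemma finite_types: "finite types" "card types \<le> (k + 1) ^ n"
proof -
  have sub: "types \<subseteq> {1..n} \<rightarrow>\<^sub>E {..k}" unfolding types_def by blast
  have fin: "finite ({1..n} \<rightarrow>\<^sub>E {..k})" by (intro finite_PiE) auto
  show "finite types" using finite_subset[OF sub fin] .
  show "card types \<le> (k + 1) ^ n" using card_mono[OF fin sub] by (simp add: card_PiE)
qed

lemma tor_mono_power: "a \<le> b \<Longrightarrow> tor I (p ^ a) H \<subseteq> tor I (p ^ b) H"
  by (rule tor_mono) (rule le_imp_power_dvd)

lemma tor_mono_Suc: "tor I (p ^ a) H \<subseteq> tor I (p ^ Suc a) H"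
  by (rule tor_mono_power) simp

text \<open>The ranks of the torsion layers of L/I decrease, are at most n and vanish from k on; the
  type is the conjugate partition of these ranks.\<close>

lemma type_exists:
  assumes L: "mid L" "1 \<in> L"
  shows "\<exists>\<nu>\<in>types. has_type \<nu> L"
proof -
  let ?D = "\<lambda>a. idx (tor I (p ^ Suc a) L) (tor I (p ^ a) L)"
  have "\<exists>c. ?D a = p ^ c" for a
    by (rule idx_mid_power[OF mid_tor[OF L(1)] mid_tor[OF L(1)] tor_mono_Suc])
  then obtain d where d: "\<And>a. ?D a = p ^ d a" by metis
  have dn: "d a \<le> n" for a using idx_tor_step_le[OF L(1), of a] unfolding d p_power_le_iff .
  have dS: "d (Suc a) \<le> d a" for a using idx_tor_step_decreasing[OF L(1), of a] unfolding d p_power_le_iff .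
  have dec: "d b \<le> d a" if "a \<le> b" for a b using lift_Suc_antimono_le[of d, OF dS that] .
  have d0: "d a = 0" if "a \<ge> k" for a
  proof -
    have t: "tor I (p ^ b) L = L" if "b \<ge> k" for b
      using tor_pk[OF L(1)] tor_mono_power[OF that] tor_sub by blast
    have "p ^ d a = 1"
      unfolding d[symmetric] t[OF that] t[OF le_SucI[OF that]] by (rule idx_self[OF midD(1)[OF L(1)]])
    then show ?thesis using prime_gt_1_nat[OF p] by simp
  qed
  \<comment> \<open>The element p^(k - 1 - a) of L has order exactly p^(a + 1) modulo I.\<close>
  have d1: "d a \<ge> 1" if "a < k" for a
  proof (rule ccontr)
    assume "\<not> d a \<ge> 1"
    then have "?D a = 1" using d[of a] by simp
    then have eq: "tor I (p ^ Suc a) L = tor I (p ^ a) L"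
      by (rule idx_1_iff[OF midD(1)[OF mid_tor[OF L(1)]] midD(1)[OF mid_tor[OF L(1)]] tor_mono_Suc])
    have e: "Suc a + (k - 1 - a) = k" "a + (k - 1 - a) = k - 1" using that by auto
    have m: "of_nat (p ^ b) * of_nat (p ^ (k - 1 - a)) = (of_nat (p ^ (b + (k - 1 - a))) :: 'a)" for b
      by (simp add: power_add)
    have "of_nat (p ^ (k - 1 - a)) \<in> L" using add_subgroup_of_nat[OF midD(1)[OF L(1)] L(2)] by simp
    then have "of_nat (p ^ (k - 1 - a)) \<in> tor I (p ^ Suc a) L" unfolding tor_def using m[of "Suc a"] k(1) e by simp
    then have "of_nat (p ^ a) * of_nat (p ^ (k - 1 - a)) \<in> I" unfolding eq unfolding tor_def by blast
    then show False using m[of a] k(2) e by simp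
  qed
  define \<nu> where "\<nu> = (\<lambda>l\<in>{1..n}. card {a\<in>{..<k}. l \<le> d a})"
  have \<nu>: "a < \<nu> l \<longleftrightarrow> a < k \<and> l \<le> d a" if "l \<in> {1..n}" for a l
  proof -
    have "{a\<in>{..<k}. l \<le> d a} = {..<\<nu> l}"
      using downward_closed_nat[of "{a\<in>{..<k}. l \<le> d a}"] dec that unfolding \<nu>_def by fastforce
    then show ?thesis by blast
  qed
  have "layer_size n \<nu> a = d a" for a
  proof (cases "a < k")
    case True
    have "{l\<in>{1..n}. a < \<nu> l} = {1..d a}" using \<nu> True dn[of a] by auto
    then show ?thesis unfolding layer_size_def by simp
  next
    case False
    have "{l\<in>{1..n}. a < \<nu> l} = {}" using \<nu> False by blast
    then show ?thesis unfolding layer_size_def using d0[of a] False by (metis card.empty linorder_not_less)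
  qed
  then have ht: "has_type \<nu> L" unfolding has_type_def using d by simp
  have le: "\<nu> l \<le> k" if "l \<in> {1..n}" for l
  proof (rule ccontr)
    assume "\<not> \<nu> l \<le> k"
    then show False using \<nu>[OF that, of k] by simp
  qed
  have "\<nu> 1 = k"
  proof (rule antisym[OF le])
    show "k \<le> \<nu> 1"
    proof (rule ccontr)
      assume "\<not> k \<le> \<nu> 1"
      then show False using \<nu>[of 1 "\<nu> 1"] d1[of "\<nu> 1"] n6 by simp
    qed
  qed (use n6 in simp)
  moreover have "\<nu> l' \<le> \<nu> l" if l: "l \<in> {1..n}" "l' \<in> {1..n}" "l \<le> l'" for l l'
  proof (rule ccontr)
    assume "\<not> \<nu> l' \<le> \<nu> l"
    then have "\<nu> l < \<nu> l'" by simp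
    then have "\<nu> l < k" "l' \<le> d (\<nu> l)" using \<nu>[OF l(2)] by blast+
    then show False using \<nu>[OF l(1), of "\<nu> l"] l(3) by simp
  qed
  moreover have "\<nu> \<in> {1..n} \<rightarrow>\<^sub>E {..k}" using le unfolding \<nu>_def by auto
  ultimately show ?thesis using ht unfolding types_def by blast
qed

lemma idx_tor_type:
  assumes L: "mid L" and t: "has_type \<nu> L"
  shows "idx (tor I (p ^ a) L) I = p ^ (\<Sum>l\<in>{1..n}. min (\<nu> l) a)"
proof -
  have "idx (tor I (p ^ a) L) I = p ^ (\<Sum>b<a. layer_size n \<nu> b)"
  proof (induction a)
    case 0
    then show ?case using tor_1[OF L] idx_self[OF I_sub] by simp
  next
    case (Suc a)
    have "idx (tor I (p ^ Suc a) L) (tor I (p ^ a) L) * idx (tor I (p ^ a) L) I = idx (tor I (p ^ Suc a) L) I"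
      using tower_mid[OF mid_tor[OF L] mid_tor[OF L] tor_mono_Suc] .
    then show ?case using t Suc unfolding has_type_def by (simp add: power_add mult.commute)
  qed
  then show ?thesis by (simp add: sum_layer_size)
qed

lemma idx_type:
  assumes L: "mid L" and t: "has_type \<nu> L" "\<nu> \<in> types"
  shows "idx L I = p ^ (\<Sum>l\<in>{1..n}. \<nu> l)"
proof -
  have "(\<Sum>l\<in>{1..n}. min (\<nu> l) k) = (\<Sum>l\<in>{1..n}. \<nu> l)"
    using t(2) unfolding types_def by (intro sum.cong) auto
  then show ?thesis using idx_tor_type[OF L t(1), of k] tor_pk[OF L] by simp
qed

definition gam :: "nat \<Rightarrow> nat" where
  "gam a = (SOME c. idx (tor I (p ^ Suc a) R) (tor I (p ^ a) R) = p ^ c)"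

lemma gam: "idx (tor I (p ^ Suc a) R) (tor I (p ^ a) R) = p ^ gam a"
  unfolding gam_def using someI_ex[OF idx_mid_power[OF mid_tor[OF mid_R] mid_tor[OF mid_R] tor_mono_Suc]] .

lemma idx_tor_R: "idx (tor I (p ^ a) R) I = p ^ (\<Sum>b<a. gam b)"
proof (induction a)
  case 0
  then show ?case using tor_1[OF mid_R] idx_self[OF I_sub] by simp
next
  case (Suc a)
  have "idx (tor I (p ^ Suc a) R) (tor I (p ^ a) R) * idx (tor I (p ^ a) R) I = idx (tor I (p ^ Suc a) R) I"
    using tower_mid[OF mid_tor[OF mid_R] mid_tor[OF mid_R] tor_mono_Suc] .
  then show ?case using gam Suc by (simp add: power_add mult.commute)
qed

lemma idx_R: "idx R I = p ^ (\<Sum>b<k. gam b)"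
  using idx_tor_R[of k] tor_pk[OF mid_R] by simp

lemma gam_le: "gam a \<le> n"
  using idx_tor_step_le[OF mid_R, of a] unfolding gam p_power_le_iff .

lemma layer_size_le_gam: "mid L \<Longrightarrow> has_type \<nu> L \<Longrightarrow> layer_size n \<nu> a \<le> gam a"
  using idx_tor_step_mono[OF _ mid_R midD(3), of L a] unfolding gam has_type_def by (simp add: p_power_le_iff)

text \<open>The layer p^(k - 1) R lies in all layers. Were it of rank 1, it would be p^(k - 1) Z
  modulo I, where \<xi> is trivial, and p^(k - 1) would be in the radical. In
  \<open>exponent_bound\<close> this excludes a layer with E = X = 0.\<close>

lemma gam_ge_2:
  assumes \<xi>: "\<xi> \<in> nondegenerate" and a: "a < k"
  shows "gam a \<ge> 2"
proof -
  let ?V = "lev I (p ^ (k - 1)) R" and ?U = "lev I (p ^ (k - 1)) adjoin_1"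
  have V: "mid ?V" and U: "mid ?U" using mid_lev mid_R mid_adjoin_1 by auto
  have UV: "?U \<subseteq> ?V" by (rule lev_mono[OF midD(3)[OF mid_adjoin_1]])
  have Up: "idx ?U I = p" using idx_lev_adjoin_1[of "k - 1"] k(3) by simp
  obtain c where c: "idx ?V ?U = p ^ c" using idx_mid_power[OF U V UV] by blast
  have "c \<noteq> 0"
  proof
    assume "c = 0"
    then have eq: "?V = ?U" using idx_1_iff[OF midD(1)[OF U] midD(1)[OF V] UV] c by simp
    have U1: "?U \<subseteq> adjoin_1" by (rule lev_sub[OF mid_adjoin_1])
    have "of_nat (p ^ (k - 1)) \<in> I"
    proof (rule nondegenerateD(2)[OF \<xi> R_of_nat])
      fix y assume "y \<in> R"
      then have "of_nat (p ^ (k - 1)) * y + 0 \<in> ?V" unfolding lev_def using add_subgroupD(1)[OF I_sub] by blast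
      then have "of_nat (p ^ (k - 1)) * y \<in> adjoin_1" using eq U1 by auto
      then show "\<xi> (of_nat (p ^ (k - 1)) * y) = 1" using charsD(2)[OF nondegenerateD(1)[OF \<xi>]] by blast
    qed
    then show False using k(2) by blast
  qed
  have "idx ?V I = p ^ c * p" using tower_mid[OF U V UV] Up c by simp
  then have "p ^ 2 \<le> idx ?V I" using \<open>c \<noteq> 0\<close> p_power_le_iff[of 2 "Suc c"] by (simp add: mult.commute)
  also have "?V \<subseteq> lev I (p ^ a) (tor I (p ^ Suc a) R)"
  proof
    fix z assume "z \<in> ?V"
    then obtain x y where xy: "x \<in> R" "y \<in> I" "z = of_nat (p ^ (k - 1)) * x + y" unfolding lev_def by blast
    have m: "of_nat (p ^ b) * (of_nat (p ^ (k - 1 - a)) * x) = of_nat (p ^ (b + (k - 1 - a))) * x" for b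
      by (simp add: power_add mult.assoc)
    have e: "Suc a + (k - 1 - a) = k" "a + (k - 1 - a) = k - 1" using a by auto
    have "of_nat (p ^ (k - 1 - a)) * x \<in> tor I (p ^ Suc a) R"
      unfolding tor_def using m[of "Suc a"] e pk_mult[OF xy(1)] R_mult[OF R_of_nat xy(1)] by (metis (mono_tags, lifting) mem_Collect_eq)
    moreover have "z = of_nat (p ^ a) * (of_nat (p ^ (k - 1 - a)) * x) + y" using m[of a] e xy(3) by metis
    ultimately show "z \<in> lev I (p ^ a) (tor I (p ^ Suc a) R)" unfolding lev_def using xy(2) by blast
  qed
  from idx_I_mono[OF mid_lev[OF mid_tor[OF mid_R]] this] have "idx ?V I \<le> p ^ gam a"
    using idx_tor_step[OF mid_R, of a] gam by simp
  finally show ?thesis by (simp only: p_power_le_iff)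
qed

definition family :: "(nat \<Rightarrow> nat) \<Rightarrow> ('a \<Rightarrow> complex) \<Rightarrow> 'a set \<Rightarrow> 'a set set" where
  "family \<nu> \<xi> X = {L. subring_of L \<and> idx R L = p ^ i \<and> conductor L = I \<and> has_type \<nu> L \<and>
     (\<forall>x\<in>L. \<xi> x = 1) \<and> X \<subseteq> L}"

text \<open>The condition on the indices says that \<open>X/I\<close> is a direct sum of \<open>j\<close> cyclic groups of the orders
  \<open>p\<^sup>\<nu>\<close> for \<open>\<nu> 1, \<dots>, \<nu> j\<close>.\<close>

definition adapted :: "(nat \<Rightarrow> nat) \<Rightarrow> nat \<Rightarrow> 'a set \<Rightarrow> bool" where
  "adapted \<nu> j X \<longleftrightarrow> mid X \<and> (\<forall>t. idx (lev I (p ^ t) X) I = p ^ (\<Sum>l\<in>{1..j}. \<nu> l - t))"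

lemma conductor_mid:
  assumes "subring_of L" "conductor L = I"
  shows "mid L" "adjoin_1 \<subseteq> L"
proof -
  have "I \<subseteq> L" using ideal_conductor(2)[OF assms(1)] assms(2) by simp
  then show "mid L" "adjoin_1 \<subseteq> L"
    unfolding mid_def adjoin_1_def using subring_ofD[OF assms(1)] adjoin_subset by blast+
qed

lemma familyD:
  assumes "L \<in> family \<nu> \<xi> X"
  shows "mid L" "has_type \<nu> L" "X \<subseteq> L" "\<And>x. x \<in> L \<Longrightarrow> \<xi> x = 1" "\<And>x y. x \<in> L \<Longrightarrow> y \<in> L \<Longrightarrow> x * y \<in> L"
  using assms conductor_mid(1)[of L] subring_ofD(4)[of L] unfolding family_def by auto

lemma finite_subrings: "finite {L. subring_of L \<and> idx R L = p ^ i \<and> conductor L = I}"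
  by (rule finite_subset[OF _ finite_intermediate[of i]])
    (use pw_subset_subring(1) subring_ofD in blast)

lemma finite_family: "finite (family \<nu> \<xi> X)"
  by (rule finite_subset[OF _ finite_subrings]) (auto simp: family_def)

lemma adapted_1: "\<nu> \<in> types \<Longrightarrow> adapted \<nu> 1 adjoin_1"
  unfolding adapted_def types_def using mid_adjoin_1 idx_lev_adjoin_1 by simp

lemma adapted_idx: "adapted \<nu> j X \<Longrightarrow> idx X I = p ^ (\<Sum>l\<in>{1..j}. \<nu> l)"
proof -
  assume X: "adapted \<nu> j X"
  then have "idx (lev I (p ^ 0) X) I = p ^ (\<Sum>l\<in>{1..j}. \<nu> l - 0)" unfolding adapted_def by blast
  then show ?thesis using lev_1[of X] X unfolding adapted_def by simp
qed

text \<open>The elements that cannot serve as next generator form a proper subgroup of the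
  p^v-torsion of L, of index at least p, so at least half of the torsion is usable.\<close>

lemma many_extensions:
  assumes \<nu>: "\<nu> \<in> types" and j: "1 \<le> j" "j < n" and X: "adapted \<nu> j X" and L: "L \<in> family \<nu> \<xi> X"
  defines "v \<equiv> \<nu> (Suc j)"
  shows "p ^ (\<Sum>l\<in>{1..n}. min (\<nu> l) v) \<le>
    2 * card (cosets {y \<in> tor I (p ^ v) L. v > 0 \<longrightarrow> of_nat (p ^ (v - 1)) * y \<notin> X} I)"
proof -
  let ?T = "tor I (p ^ v) L"
  let ?G = "{y \<in> ?T. v > 0 \<longrightarrow> of_nat (p ^ (v - 1)) * y \<notin> X}"
  have midX: "mid X" using X unfolding adapted_def by blast
  have midL: "mid L" using familyD(1)[OF L] .
  have T: "mid ?T" "idx ?T I = p ^ (\<Sum>l\<in>{1..n}. min (\<nu> l) v)"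
    using mid_tor[OF midL] idx_tor_type[OF midL familyD(2)[OF L]] by auto
  have finG: "finite (cosets ?G I)" by (rule finite_cosets_mono[OF finite_mid[OF T(1)]]) auto
  show ?thesis
  proof (cases "v = 0")
    case True
    then have "?G = ?T" by auto
    then show ?thesis unfolding T(2)[symmetric] idx_def by simp
  next
    case False
    let ?B = "{y \<in> ?T. of_nat (p ^ (v - 1)) * y \<in> X}"
    have B: "mid ?B"
    proof -
      have "of_nat (p ^ (v - 1)) * x \<in> X" if "x \<in> I" for x
        using of_nat_mult_I[OF that] midD(2)[OF midX] by blast
      then show ?thesis
        using T(1) midX unfolding mid_def add_subgroup_def
        by (auto simp: right_diff_distrib subset_iff simp del: of_nat_power)
    qed
    have BT: "?B \<subseteq> ?T" by blast
    obtain c where c: "idx ?T ?B = p ^ c" using idx_mid_power[OF B T(1) BT] by blast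
    \<comment> \<open>Otherwise p^(v - 1) maps the p^v-torsion of L into the p-torsion of X/I, which
      has rank at most j, while that layer of L has rank at least j + 1.\<close>
    have "c \<noteq> 0"
    proof
      assume "c = 0"
      then have eq: "?T = ?B" using idx_1_iff[OF midD(1)[OF B] midD(1)[OF T(1)] BT] c by simp
      have Sv: "Suc (v - 1) = v" using False by simp
      have "lev I (p ^ (v - 1)) ?T \<subseteq> tor I p X"
      proof
        fix z assume "z \<in> lev I (p ^ (v - 1)) ?T"
        then obtain x y where xy: "x \<in> ?T" "y \<in> I" "z = of_nat (p ^ (v - 1)) * x + y" unfolding lev_def by blast
        have "of_nat (p ^ (v - 1)) * x \<in> X" using xy(1) eq by blast
        then have 1: "z \<in> X" using xy(2,3) midD(1,2)[OF midX] add_subgroupD(4) by blast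
        have "p * p ^ (v - 1) = p ^ v" using Sv by (metis power_Suc)
        then have "of_nat p * (of_nat (p ^ (v - 1)) * x) = of_nat (p ^ v) * x"
          unfolding mult.assoc[symmetric] of_nat_mult[symmetric] by (rule arg_cong)
        then have "of_nat p * z = of_nat (p ^ v) * x + of_nat p * y" unfolding xy(3) by (simp add: distrib_left)
        moreover have "of_nat (p ^ v) * x \<in> I" using xy(1) unfolding tor_def by blast
        ultimately have "of_nat p * z \<in> I" using add_subgroupD(4)[OF I_sub] of_nat_mult_I[OF xy(2)] by metis
        then show "z \<in> tor I p X" unfolding tor_def using 1 by blast
      qed
      then have "idx (lev I (p ^ (v - 1)) ?T) I \<le> idx (tor I p X) I"
        by (rule idx_I_mono[OF mid_tor[OF midX]])
      moreover have "idx (lev I (p ^ (v - 1)) ?T) I = p ^ layer_size n \<nu> (v - 1)"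
        using idx_tor_step[OF midL, of "v - 1"] familyD(2)[OF L, unfolded has_type_def, rule_format, of "v - 1"]
        unfolding Sv by simp
      moreover have "idx (tor I p X) I \<le> p ^ j"
      proof -
        have l: "idx (lev I p X) I = p ^ (\<Sum>l\<in>{1..j}. \<nu> l - 1)" 
          using X[unfolded adapted_def, THEN conjunct2, rule_format, of 1] by simp
        have "(\<Sum>l\<in>{1..j}. \<nu> l) \<le> (\<Sum>l\<in>{1..j}. (\<nu> l - 1) + 1)" by (rule sum_mono) auto
        then have "p ^ (\<Sum>l\<in>{1..j}. \<nu> l) \<le> p ^ (\<Sum>l\<in>{1..j}. \<nu> l - 1) * p ^ j"
          unfolding power_add[symmetric] p_power_le_iff by (simp only: sum.distrib) simp
        then have "idx (lev I p X) I * idx (tor I p X) I \<le> idx (lev I p X) I * p ^ j"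
          using tor_lev[OF midX, of p] adapted_idx[OF X] l by simp
        then show ?thesis using l prime_gt_0_nat[OF p] by simp
      qed
      ultimately have "p ^ layer_size n \<nu> (v - 1) \<le> p ^ j" by linarith
      then have le: "layer_size n \<nu> (v - 1) \<le> j" unfolding p_power_le_iff .
      \<comment> \<open>The parts decrease, so the first j + 1 of them are at least v.\<close>
      have "{1..Suc j} \<subseteq> {l\<in>{1..n}. v - 1 < \<nu> l}"
      proof
        fix l assume l: "l \<in> {1..Suc j}"
        then have "v \<le> \<nu> l" using \<nu> j unfolding v_def types_def by auto
        then show "l \<in> {l\<in>{1..n}. v - 1 < \<nu> l}" using l j False by auto
      qed
      then have "card {1..Suc j} \<le> card {l\<in>{1..n}. v - 1 < \<nu> l}" by (intro card_mono) auto
      then show False using le unfolding layer_size_def by simp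
    qed
    then have "p ^ 1 \<le> idx ?T ?B" unfolding c p_power_le_iff by simp
    then have "2 \<le> idx ?T ?B" using prime_ge_2_nat[OF p] by simp
    from mult_le_mono1[OF this, of "idx ?B I"] have "2 * idx ?B I \<le> idx ?T I"
      unfolding tower_mid[OF B T(1) BT] .
    moreover have "?T \<subseteq> ?G \<union> ?B" by blast
    then have "cosets ?T I \<subseteq> cosets ?G I \<union> cosets ?B I"
      unfolding cosets_def image_Un[symmetric] by (rule image_mono)
    then have "idx ?T I \<le> card (cosets ?G I \<union> cosets ?B I)"
      unfolding idx_def using finG finite_mid[OF B] by (intro card_mono) auto
    then have "idx ?T I \<le> card (cosets ?G I) + idx ?B I"
      using card_Un_le[of "cosets ?G I" "cosets ?B I"] unfolding idx_def[of ?B] by (rule order_trans)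
    ultimately show ?thesis unfolding T(2)[symmetric] by linarith
  qed
qed

text \<open>Double counting of the pairs of a subring L and a coset of a usable next generator. The
  candidate set \<open>C\<close> is a parameter: it will be the whole orthogonal complement in
  general, and the zeros of a quadratic form for the second generator when k = 1.\<close>

lemma family_step:
  fixes M :: real
  assumes \<nu>: "\<nu> \<in> types" and j: "1 \<le> j" "j < n" and X: "adapted \<nu> j X"
    and C: "finite C" "\<And>L. L \<in> family \<nu> \<xi> X \<Longrightarrow> cosets (tor I (p ^ \<nu> (Suc j)) L) I \<subseteq> C"
    and M: "M \<ge> 0" "\<And>X'. adapted \<nu> (Suc j) X' \<Longrightarrow> real (card (family \<nu> \<xi> X')) \<le> M"
  shows "real (card (family \<nu> \<xi> X)) * real p ^ (\<Sum>l\<in>{1..n}. min (\<nu> l) (\<nu> (Suc j))) \<le> 2 * real (card C) * M"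
proof -
  let ?v = "\<nu> (Suc j)"
  let ?\<tau> = "\<Sum>l\<in>{1..n}. min (\<nu> l) ?v"
  let ?G = "\<lambda>L. {y \<in> tor I (p ^ ?v) L. ?v > 0 \<longrightarrow> of_nat (p ^ (?v - 1)) * y \<notin> X}"
  \<comment> \<open>Half of p^\<tau> rounded up, the number of usable cosets granted by
    \<open>many_extensions\<close>.\<close>
  define m where "m = (p ^ ?\<tau> + 1) div 2"
  have midX: "mid X" using X unfolding adapted_def by blast
  have "card (family \<nu> \<xi> X) * m \<le> card C * nat \<lfloor>M\<rfloor>"
  proof (rule double_counting[OF finite_family C(1), where r = "\<lambda>L c. c \<in> cosets (?G L) I"])
    fix L assume L: "L \<in> family \<nu> \<xi> X"
    have "cosets (?G L) I \<subseteq> cosets (tor I (p ^ ?v) L) I" unfolding cosets_def by blast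
    then have "{b \<in> C. b \<in> cosets (?G L) I} = cosets (?G L) I" using C(2)[OF L] by blast
    then show "m \<le> card {b \<in> C. b \<in> cosets (?G L) I}"
      using many_extensions[OF \<nu> j X L] unfolding m_def by simp
  next
    fix c assume "c \<in> C"
    show "card {L \<in> family \<nu> \<xi> X. c \<in> cosets (?G L) I} \<le> nat \<lfloor>M\<rfloor>"
    proof (cases "{L \<in> family \<nu> \<xi> X. c \<in> cosets (?G L) I} = {}")
      case False
      then obtain L0 where L0: "L0 \<in> family \<nu> \<xi> X" "c \<in> cosets (?G L0) I" by auto
      obtain y where y: "y \<in> ?G L0" "c = (+) y ` I" using L0(2) by (rule cosetsE)
      have yR: "y \<in> R" "of_nat (p ^ ?v) * y \<in> I" "?v > 0 \<Longrightarrow> of_nat (p ^ (?v - 1)) * y \<notin> X"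
        using y(1) midD(3)[OF familyD(1)[OF L0(1)]] unfolding tor_def by auto
      have "adapted \<nu> (Suc j) (adjoin X y)"
        unfolding adapted_def
      proof (intro conjI allI)
        show "mid (adjoin X y)" by (rule mid_adjoin[OF midX yR(1)])
        fix t
        have "(\<Sum>l\<in>{1..Suc j}. \<nu> l - t) = (\<Sum>l\<in>{1..j}. \<nu> l - t) + (?v - t)" by simp
        then show "idx (lev I (p ^ t) (adjoin X y)) I = p ^ (\<Sum>l\<in>{1..Suc j}. \<nu> l - t)"
          using idx_lev_adjoin[OF midX yR, of t] X unfolding adapted_def by (simp add: power_add)
      qed
      then have "real (card (family \<nu> \<xi> (adjoin X y))) \<le> M" by (rule M(2))
      then have "card (family \<nu> \<xi> (adjoin X y)) \<le> nat \<lfloor>M\<rfloor>" by (rule le_nat_floor)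
      moreover have "{L \<in> family \<nu> \<xi> X. c \<in> cosets (?G L) I} \<subseteq> family \<nu> \<xi> (adjoin X y)"
      proof
        fix L assume L: "L \<in> {L \<in> family \<nu> \<xi> X. c \<in> cosets (?G L) I}"
        then have LF: "L \<in> family \<nu> \<xi> X" and cL: "c \<in> cosets (?G L) I" by auto
        obtain y' where y': "y' \<in> ?G L" "c = (+) y' ` I" using cL by (rule cosetsE)
        note midL = familyD(1)[OF LF]
        have "y - y' \<in> I" using coset_eq_iff[OF I_sub, of y y'] y(2) y'(2) by simp
        moreover have "y' \<in> L" using y'(1) unfolding tor_def by blast
        ultimately have "y - y' + y' \<in> L" using midD(1,2)[OF midL] add_subgroupD(4) by blast
        then have "adjoin X y \<subseteq> L" using adjoin_subset[OF midD(1)[OF midL] familyD(3)[OF LF]] by simp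
        then show "L \<in> family \<nu> \<xi> (adjoin X y)" using LF unfolding family_def by blast
      qed
      then have "card {L \<in> family \<nu> \<xi> X. c \<in> cosets (?G L) I} \<le> card (family \<nu> \<xi> (adjoin X y))"
        by (rule card_mono[OF finite_family])
      ultimately show ?thesis by linarith
    next
      case True
      show ?thesis unfolding True by simp
    qed
  qed
  then have "real (card (family \<nu> \<xi> X)) * real m \<le> real (card C) * real (nat \<lfloor>M\<rfloor>)"
    by (metis of_nat_le_iff of_nat_mult)
  also have "\<dots> \<le> real (card C) * M" using M(1) by (intro mult_left_mono) (auto simp: of_nat_floor)
  finally have 1: "real (card (family \<nu> \<xi> X)) * (2 * real m) \<le> 2 * real (card C) * M" by simp
  have "p ^ ?\<tau> \<le> 2 * m" unfolding m_def by simp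
  then have "real p ^ ?\<tau> \<le> 2 * real m" by (metis of_nat_le_iff of_nat_mult of_nat_numeral of_nat_power)
  then have "real (card (family \<nu> \<xi> X)) * real p ^ ?\<tau> \<le> real (card (family \<nu> \<xi> X)) * (2 * real m)"
    by (intro mult_left_mono) auto
  then show ?thesis using 1 by linarith
qed

text \<open>The exponent of \<open>p\<close> in the number of candidates for the \<open>j\<close>-th generator, all orthogonal to the
  first \<open>j - 1\<close> ones, divided by the number of candidates that lie in a given subring.\<close>

definition weight :: "(nat \<Rightarrow> nat) \<Rightarrow> nat \<Rightarrow> real" where
  "weight \<nu> j = real (\<Sum>a<\<nu> j. gam a) - (\<Sum>l\<in>{1..<j}. real (\<nu> l + \<nu> j - k)) - (\<Sum>l\<in>{1..n}. real (min (\<nu> l) (\<nu> j)))"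

text \<open>For an adapted X the size of p^(k - v) X/I is known, so orthogonality to the l-th
  earlier generator saves the truncated difference \<nu> l + v - k in the exponent.\<close>

lemma idx_perp_adapted:
  assumes \<nu>: "\<nu> \<in> types" and \<xi>: "\<xi> \<in> nondegenerate" and X: "adapted \<nu> j X" and j: "j < n"
  shows "real (idx (perp \<xi> (\<nu> (Suc j)) X) I) \<le>
    real p powr (real (\<Sum>a<\<nu> (Suc j). gam a) - (\<Sum>l\<in>{1..<Suc j}. real (\<nu> l + \<nu> (Suc j) - k)))"
proof -
  let ?v = "\<nu> (Suc j)"
  have midX: "mid X" using X unfolding adapted_def by blast
  have v: "?v \<le> k" using \<nu> j unfolding types_def by auto
  have "(\<Sum>l\<in>{1..j}. \<nu> l - (k - ?v)) = (\<Sum>l\<in>{1..<Suc j}. \<nu> l + ?v - k)"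
    using v by (intro sum.cong) auto
  then have "idx (perp \<xi> ?v X) I * p ^ (\<Sum>l\<in>{1..<Suc j}. \<nu> l + ?v - k) \<le> p ^ (\<Sum>a<?v. gam a)"
    using card_perp[OF \<xi> midX v] X unfolding adapted_def idx_tor_R by simp
  then have "real (idx (perp \<xi> ?v X) I) * real p ^ (\<Sum>l\<in>{1..<Suc j}. \<nu> l + ?v - k) \<le> real p ^ (\<Sum>a<?v. gam a)"
    by (metis of_nat_le_iff of_nat_mult of_nat_power)
  then show ?thesis
    using prime_gt_0_nat[OF p] by (simp add: powr_diff powr_realpow field_simps flip: of_nat_sum)
qed

text \<open>Multiplicative closure enters here: products of X with L stay in L, where \<xi> is
  trivial.\<close>

lemma cosets_tor_subset_perp:
  assumes "L \<in> family \<nu> \<xi> X" 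
  shows "tor I (p ^ v) L \<subseteq> perp \<xi> v X"
  using familyD[OF assms] midD(3)[OF familyD(1)[OF assms]] unfolding tor_def perp_def by blast

text \<open>Downward induction on j. With all n generators chosen, X/I has the order of L/I, so L =
  X.\<close>

lemma family_bound:
  assumes \<nu>: "\<nu> \<in> types" and \<xi>: "\<xi> \<in> nondegenerate" and j: "1 \<le> j" "j \<le> n" and X: "adapted \<nu> j X"
  shows "real (card (family \<nu> \<xi> X)) \<le> (\<Prod>m\<in>{Suc j..n}. 2 * real p powr weight \<nu> m)"
  using j(2) j(1) X
proof (induction j arbitrary: X rule: inc_induct)
  case base
  have "family \<nu> \<xi> X \<subseteq> {X}"
  proof
    fix L assume L: "L \<in> family \<nu> \<xi> X"
    have midX: "mid X" using base unfolding adapted_def by blast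
    have "idx L X * idx X I = idx X I"
      using tower_mid[OF midX familyD(1)[OF L] familyD(3)[OF L]] idx_type[OF familyD(1,2)[OF L] \<nu>]
        adapted_idx[OF base(2)] by simp
    then have "idx L X = 1" using idx_mid_pos[OF mid_I midX midD(2)[OF midX]] by simp
    then show "L \<in> {X}"
      using idx_1_iff[OF midD(1)[OF midX] midD(1)[OF familyD(1)[OF L]] familyD(3)[OF L]] by simp
  qed
  then have "card (family \<nu> \<xi> X) \<le> card {X}" by (intro card_mono) auto
  then show ?case by simp
next
  case (step j)
  let ?v = "\<nu> (Suc j)"
  let ?M = "\<Prod>m\<in>{Suc (Suc j)..n}. 2 * real p powr weight \<nu> m"
  define \<tau> where "\<tau> = (\<Sum>l\<in>{1..n}. min (\<nu> l) ?v)"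
  define e where "e = real (\<Sum>a<\<nu> (Suc j). gam a) - (\<Sum>l\<in>{1..<Suc j}. real (\<nu> l + \<nu> (Suc j) - k))"
  have midX: "mid X" using step.prems unfolding adapted_def by blast
  have P: "mid (perp \<xi> ?v X)" by (rule mid_perp[OF \<xi> midD(3)[OF midX]])
  have p0: "real p > 0" using prime_gt_0_nat[OF p] by simp
  have M0: "?M \<ge> 0" by (intro prod_nonneg) auto
  have "real (card (family \<nu> \<xi> X)) * real p ^ \<tau> \<le> 2 * real (card (cosets (perp \<xi> ?v X) I)) * ?M"
    unfolding \<tau>_def
  proof (rule family_step[OF \<nu> step.prems(1) step.hyps(2) step.prems(2) finite_mid[OF P] _ M0])
    show "cosets (tor I (p ^ ?v) L) I \<subseteq> cosets (perp \<xi> ?v X) I" if "L \<in> family \<nu> \<xi> X" for L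
      using cosets_tor_subset_perp[OF that] unfolding cosets_def by blast
    show "real (card (family \<nu> \<xi> X')) \<le> ?M" if "adapted \<nu> (Suc j) X'" for X'
      using step.IH that by simp
  qed
  also have "\<dots> \<le> 2 * real p powr e * ?M"
    using idx_perp_adapted[OF \<nu> \<xi> step.prems(2) step.hyps(2)] M0 unfolding idx_def e_def
    by (intro mult_right_mono mult_left_mono) auto
  finally have "real (card (family \<nu> \<xi> X)) \<le> 2 * real p powr (e - real \<tau>) * ?M"
    using p0 by (simp add: powr_diff powr_realpow field_simps)
  moreover have "e - real \<tau> = weight \<nu> (Suc j)" unfolding weight_def e_def \<tau>_def by simp
  moreover have "{Suc j..n} = insert (Suc j) {Suc (Suc j)..n}" using step.hyps by auto
  ultimately show ?case by simp
qed

end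

section \<open>The quadric for k = 1, and the count for one type and one conductor\<close>

context conductor_quotient
begin

text \<open>The order of z modulo H divides both a and b.\<close>

lemma coprime_mem:
  assumes H: "add_subgroup H" and z: "of_int a * z \<in> H" "of_nat b * z \<in> H" "b > 0" "coprime a (int b)"
  shows "z \<in> H"
proof -
  obtain m where m: "\<And>j::int. of_int j * z \<in> H \<longleftrightarrow> int m dvd j"
    using order_mod_subgroup[OF H z(3,2)] by blast
  have "int m dvd a" "int m dvd int b" using m[of a] m[of "int b"] z(1,2) by auto
  then have "int m dvd 1" using z(4) by (meson coprime_common_divisor)
  then show ?thesis using m[of 1] by simp
qed

text \<open>When \<open>k = 1\<close> the second generator \<open>y\<close> is a zero of the quadratic form \<open>\<xi>(y y)\<close>, and a
  line \<open>y + t u\<close> with \<open>\<xi>(u u) \<noteq> 1\<close> contains at most two zeros.\<close>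

lemma quadric_zeros:
  assumes \<xi>: "\<xi> \<in> nondegenerate" and k1: "k = 1" and big: "p ^ 3 \<le> idx R I"
  defines "Q \<equiv> perp \<xi> 1 adjoin_1"
  shows "p * card (cosets {y\<in>Q. \<xi> (y * y) = 1} I) \<le> 2 * idx Q I"
proof -
  have Q: "mid Q" unfolding Q_def by (rule mid_perp[OF \<xi> midD(3)[OF mid_adjoin_1]])
  have p2: "p > 2" "odd p" using pn n6 prime_odd_nat[OF p] by auto
  have pI: "of_nat p * x \<in> I" if "x \<in> R" for x using pk_mult[OF that] k1 by simp
  define H where "H = {x\<in>R. \<xi> x = 1}"
  have H: "add_subgroup H"
    unfolding add_subgroup_def H_def
    using R_closed(1,2) nondegenerateD(3)[OF \<xi> add_subgroupD(1)[OF I_sub]] nondegenerate_diff[OF \<xi>] by fastforce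
  have IH: "I \<subseteq> H" unfolding H_def using nondegenerateD(3)[OF \<xi>] ideal_ofD(2)[OF I] by blast
  have QR: "Q \<subseteq> R" using midD(3)[OF Q] .
  have cop: "z \<in> H" if "of_int a * z \<in> H" "coprime a (int p)" "z \<in> R" for a z
    using coprime_mem[OF H that(1) _ _ that(2)] pI[OF that(3)] IH p2(1) by auto
  \<comment> \<open>If all squares were killed, polarisation (p is odd) would make Q orthogonal to
    itself, so that the square of |Q/I| is at most |R/I|. But Q has index at most p in R, which
    forces |R/I| \<le> p^2.\<close>
  have "\<exists>u\<in>Q. u * u \<notin> H"
  proof (rule ccontr)
    assume "\<not> (\<exists>u\<in>Q. u * u \<notin> H)"
    then have sq: "u * u \<in> H" if "u \<in> Q" for u using that by blast
    have "Q \<subseteq> perp \<xi> 1 Q"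
    proof
      fix u assume u: "u \<in> Q"
      have "v * u \<in> H" if v: "v \<in> Q" for v
      proof (rule cop)
        have "(v + u) * (v + u) - v * v - u * u \<in> H"
          using sq[OF u] sq[OF v] sq[OF add_subgroupD(4)[OF midD(1)[OF Q] v u]] add_subgroupD(2)[OF H] by blast
        then show "of_int 2 * (v * u) \<in> H" by (simp add: algebra_simps)
        show "coprime 2 (int p)" using p2(2) by simp
        show "v * u \<in> R" using u v QR R_mult by blast
      qed
      then show "u \<in> perp \<xi> 1 Q" using u unfolding perp_def[of _ _ Q] H_def Q_def perp_def by blast
    qed
    then have "idx Q I \<le> idx (perp \<xi> 1 Q) I" by (rule idx_I_mono[OF mid_perp[OF \<xi> QR]])
    moreover have "idx (perp \<xi> 1 Q) I * idx (lev I (p ^ (k - 1)) Q) I \<le> idx (tor I (p ^ 1) R) I"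
      using card_perp[OF \<xi> Q, of 1] k1 by simp
    moreover have "lev I (p ^ (k - 1)) Q = Q" using lev_1[OF Q] k1 by simp
    moreover have "idx (tor I (p ^ 1) R) I \<le> idx R I" by (rule idx_I_mono[OF mid_R tor_sub])
    ultimately have qq: "idx Q I * idx Q I \<le> idx R I" by (metis mult_le_mono1 order_trans)
    \<comment> \<open>Q is the orthogonal complement of I + Z, and (I + Z)/I has order p.\<close>
    have "idx R Q \<le> idx adjoin_1 I"
    proof (rule idx_pairing(1)[OF R_sub midD(1)[OF mid_adjoin_1] I_sub midD(2)[OF mid_adjoin_1]
          finite_mid[OF mid_adjoin_1] midD(1)[OF Q], where \<beta> = "\<lambda>x y. \<xi> (x * y)"])
      fix x y y' assume "x \<in> R" "y \<in> adjoin_1" "y' \<in> adjoin_1"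
      then show "\<xi> (x * (y + y')) = \<xi> (x * y) * \<xi> (x * y')"
        using nondegenerateD(4)[OF \<xi>] midD(3)[OF mid_adjoin_1] R_mult by (auto simp: distrib_left subset_iff)
    next
      fix x x' y assume "x \<in> R" "x' \<in> R" "y \<in> adjoin_1"
      then show "\<xi> ((x - x') * y) * \<xi> (x' * y) = \<xi> (x * y)"
        using nondegenerate_diff[OF \<xi>, of "x * y" "x' * y"] midD(3)[OF mid_adjoin_1] R_mult
        by (auto simp: left_diff_distrib subset_iff)
    next
      fix x y assume "x \<in> R" "y \<in> I"
      then show "\<xi> (x * y) = 1" using nondegenerateD(3)[OF \<xi>] ideal_ofD(4)[OF I] by blast
    next
      fix x assume "x \<in> R" "\<And>y. y \<in> adjoin_1 \<Longrightarrow> \<xi> (x * y) = 1"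
      then show "x \<in> Q" unfolding Q_def perp_def tor_def using pI by (simp add: mult.commute)
    qed
    then have "idx R Q \<le> p" using idx_adjoin_1 k1 by simp
    then have rq: "idx R I \<le> p * idx Q I" using tower_mid[OF Q mid_R QR] by (metis mult_le_mono1)
    have "idx Q I * idx Q I \<le> p * idx Q I" using qq rq by (rule order_trans)
    then have "idx Q I \<le> p" using idx_mid_pos[OF mid_I Q midD(2)[OF Q]] by simp
    then have "p ^ 3 \<le> p * p" using big rq by (meson mult_le_mono2 order_trans)
    then have "p ^ 3 \<le> p ^ 2" by (simp add: power2_eq_square)
    then show False unfolding p_power_le_iff by simp
  qed
  then obtain u where u: "u \<in> Q" "u * u \<notin> H" by blast
  have uR: "u \<in> R" "u * u \<in> R" using u QR R_mult by auto
  define Z where "Z = cosets {y\<in>Q. \<xi> (y * y) = 1} I"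
  have "{y\<in>Q. \<xi> (y * y) = 1} \<subseteq> Q" by blast
  then have ZQ: "Z \<subseteq> cosets Q I" unfolding Z_def cosets_def by (rule image_mono)
  have shift: "(+) (a + b) ` I = (+) a ` (+) b ` I" for a b by (simp add: image_image add.assoc)
  \<comment> \<open>Pairs of a translate by t u and a coset c that this translate moves to a zero:
    each t contributes all zeros, each c at most two values of t.\<close>
  have "card {..<p} * card Z \<le> card (cosets Q I) * 2"
  proof (rule double_counting[OF _ finite_mid[OF Q], where r = "\<lambda>t c. (+) (of_nat t * u) ` c \<in> Z"])
    fix t
    let ?f = "\<lambda>c. (+) (- (of_nat t * u)) ` c"
    have ff: "(+) (of_nat t * u) ` ?f c = c" for c by (simp add: image_image)
    show "card Z \<le> card {c \<in> cosets Q I. (+) (of_nat t * u) ` c \<in> Z}"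
    proof (rule card_inj_on_le)
      show "inj_on ?f Z" by (rule inj_on_inverseI[of _ "\<lambda>c. (+) (of_nat t * u) ` c"]) (rule ff)
      show "?f ` Z \<subseteq> {c \<in> cosets Q I. (+) (of_nat t * u) ` c \<in> Z}"
      proof
        fix c' assume "c' \<in> ?f ` Z"
        then obtain c where c: "c \<in> Z" "c' = ?f c" by blast
        obtain y where y: "y \<in> Q" "c = (+) y ` I" using ZQ c(1) by (meson cosetsE subset_iff)
        have "- (of_nat t * u) + y \<in> Q"
          using add_subgroupD(3,4)[OF midD(1)[OF Q]] add_subgroup_of_nat[OF midD(1)[OF Q] u(1)] y(1) by blast
        moreover have "c' = (+) (- (of_nat t * u) + y) ` I" unfolding c(2) y(2) shift ..
        ultimately have "c' \<in> cosets Q I" unfolding cosets_def by blast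
        then show "c' \<in> {c \<in> cosets Q I. (+) (of_nat t * u) ` c \<in> Z}" using ff[of c] c by simp
      qed
      show "finite {c \<in> cosets Q I. (+) (of_nat t * u) ` c \<in> Z}" using finite_mid[OF Q] by simp
    qed
  next
    fix c assume "c \<in> cosets Q I"
    then obtain y where y: "y \<in> Q" "c = (+) y ` I" by (rule cosetsE)
    have yR: "y \<in> R" "y * u \<in> R" using y QR uR R_mult by auto
    define S where "S = {t\<in>{..<p}. (y + of_nat t * u) * (y + of_nat t * u) \<in> H}"
    have "{t \<in> {..<p}. (+) (of_nat t * u) ` c \<in> Z} \<subseteq> S"
    proof
      fix t assume t: "t \<in> {t \<in> {..<p}. (+) (of_nat t * u) ` c \<in> Z}"
      then have "(+) (of_nat t * u) ` c \<in> Z" by blast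
      then obtain y' where y': "y' \<in> {y\<in>Q. \<xi> (y * y) = 1}" "(+) (of_nat t * u) ` c = (+) y' ` I"
        unfolding Z_def by (rule cosetsE)
      have y'R: "y' \<in> R" "y' * y' \<in> H" using y'(1) QR R_mult unfolding H_def by auto
      have "(+) (of_nat t * u + y) ` I = (+) y' ` I" unfolding shift using y'(2) y(2) by simp
      then have h: "of_nat t * u + y - y' \<in> I" using coset_eq_iff[OF I_sub] by blast
      let ?h = "of_nat t * u + y - y'"
      have "(y + of_nat t * u) * (y + of_nat t * u) = y' * y' + ?h * (y' + (y + of_nat t * u))"
        by (simp add: algebra_simps)
      moreover have "?h * (y' + (y + of_nat t * u)) \<in> I"
        using ideal_ofD(3)[OF I h] R_closed(4) y'R(1) yR(1) R_mult[OF R_of_nat uR(1)] by blast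
      ultimately have "(y + of_nat t * u) * (y + of_nat t * u) \<in> H"
        using add_subgroupD(4)[OF H y'R(2)] IH by (metis subset_iff)
      then show "t \<in> S" unfolding S_def using t by blast
    qed
    moreover have "card S \<le> 2"
    proof (rule ccontr)
      assume "\<not> card S \<le> 2"
      then obtain T where "T \<subseteq> S" "card T = 3" using obtain_subset_with_card_n[of 3 S] by auto
      then obtain a b c where abc: "a \<in> S" "b \<in> S" "c \<in> S" "a \<noteq> b" "a \<noteq> c" "b \<noteq> c"
        by (auto simp: card_3_iff)
      have cp: "coprime (int s - int t) (int p)" if st: "s \<in> S" "t \<in> S" "s \<noteq> t" for s t
      proof -
        have "s < p" "t < p" using st unfolding S_def by auto
        then have "\<bar>int s - int t\<bar> < int p" "\<bar>int s - int t\<bar> > 0" using st(3) by auto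
        then have "\<not> int p dvd int s - int t" using zdvd_not_zless[of "\<bar>int s - int t\<bar>" "int p"] by simp
        then have "coprime (int p) (int s - int t)" using p by (intro prime_imp_coprime) auto
        then show ?thesis by (simp add: coprime_commute)
      qed
      \<comment> \<open>The difference of the form at two zeros s and t, divided by s - t.
        Subtracting two such relations below isolates a multiple of u u.\<close>
      have pair: "of_nat 2 * (y * u) + of_nat (s + t) * (u * u) \<in> H" if st: "s \<in> S" "t \<in> S" "s \<noteq> t" for s t
      proof (rule cop[OF _ cp[OF st]])
        have "(y + of_nat s * u) * (y + of_nat s * u) - (y + of_nat t * u) * (y + of_nat t * u) \<in> H"
          using st add_subgroupD(2)[OF H] unfolding S_def by blast
        then show "of_int (int s - int t) * (of_nat 2 * (y * u) + of_nat (s + t) * (u * u)) \<in> H"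
          by (simp add: algebra_simps)
        show "of_nat 2 * (y * u) + of_nat (s + t) * (u * u) \<in> R"
          using R_closed(4) R_mult[OF R_of_nat yR(2)] R_mult[OF R_of_nat uR(2)] by blast
      qed
      have "(of_nat 2 * (y * u) + of_nat (a + b) * (u * u)) - (of_nat 2 * (y * u) + of_nat (a + c) * (u * u)) \<in> H"
        using add_subgroupD(2)[OF H pair[OF abc(1,2,4)] pair[OF abc(1,3,5)]] .
      then have "of_int (int b - int c) * (u * u) \<in> H" by (simp add: algebra_simps)
      then have "u * u \<in> H" by (rule cop[OF _ cp[OF abc(2,3,6)] uR(2)])
      then show False using u(2) by blast
    qed
    moreover have "finite S" unfolding S_def by simp
    ultimately show "card {t \<in> {..<p}. (+) (of_nat t * u) ` c \<in> Z} \<le> 2"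
      using card_mono[of S "{t \<in> {..<p}. (+) (of_nat t * u) ` c \<in> Z}"] by linarith
  qed simp
  then show ?thesis unfolding Z_def idx_def by (simp add: mult.commute)
qed

text \<open>Double counting of the pairs of a subring L and a nondegenerate character trivial on L:
  each L has at least p^i / 2 of them, and each character serves at most M subrings.\<close>

lemma type_count:
  fixes M :: real
  assumes \<nu>: "\<nu> \<in> types" and M: "M \<ge> 0" "\<And>\<xi>. \<xi> \<in> nondegenerate \<Longrightarrow> real (card (family \<nu> \<xi> adjoin_1)) \<le> M"
  shows "real (card {L. subring_of L \<and> idx R L = p ^ i \<and> conductor L = I \<and> has_type \<nu> L}) \<le>
    2 * real p powr (real (\<Sum>a<k. gam a) - real k - real i) * M"
proof -
  let ?A = "{L. subring_of L \<and> idx R L = p ^ i \<and> conductor L = I \<and> has_type \<nu> L}"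
  define m where "m = (p ^ i + 1) div 2"
  have p0: "real p > 0" using prime_gt_0_nat[OF p] by simp
  have fin: "finite ?A" by (rule finite_subset[OF _ finite_subrings]) blast
  have "card ?A * m \<le> card nondegenerate * nat \<lfloor>M\<rfloor>"
  proof (rule double_counting[OF fin card_nondegenerate(1), where r = "\<lambda>L \<xi>. \<forall>x\<in>L. \<xi> x = 1"])
    fix L assume "L \<in> ?A"
    then show "m \<le> card {\<xi> \<in> nondegenerate. \<forall>x\<in>L. \<xi> x = 1}"
      using many_nondegenerate[of L] unfolding m_def by simp
  next
    fix \<xi> assume \<xi>: "\<xi> \<in> nondegenerate"
    have "{L \<in> ?A. \<forall>x\<in>L. \<xi> x = 1} \<subseteq> family \<nu> \<xi> adjoin_1"
      unfolding family_def using conductor_mid(2) by blast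
    then have "card {L \<in> ?A. \<forall>x\<in>L. \<xi> x = 1} \<le> card (family \<nu> \<xi> adjoin_1)" by (rule card_mono[OF finite_family])
    also have "\<dots> \<le> nat \<lfloor>M\<rfloor>" by (rule le_nat_floor[OF M(2)[OF \<xi>]])
    finally show "card {L \<in> ?A. \<forall>x\<in>L. \<xi> x = 1} \<le> nat \<lfloor>M\<rfloor>" .
  qed
  then have "real (card ?A) * real m \<le> real (card nondegenerate) * real (nat \<lfloor>M\<rfloor>)"
    unfolding of_nat_mult[symmetric] of_nat_le_iff .
  also have "\<dots> \<le> real (card nondegenerate) * M" using M(1) by (intro mult_left_mono) (auto simp: of_nat_floor)
  finally have 1: "real (card ?A) * (2 * real m) \<le> 2 * (real (card nondegenerate) * M)" by simp
  have "p ^ i \<le> 2 * m" unfolding m_def by simp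
  then have "real p ^ i \<le> 2 * real m" by (metis of_nat_le_iff of_nat_mult of_nat_numeral of_nat_power)
  then have "real (card ?A) * real p ^ i \<le> real (card ?A) * (2 * real m)" by (intro mult_left_mono) auto
  then have "real (card ?A) * real p ^ i * real p ^ k \<le> 2 * (real (card nondegenerate) * M) * real p ^ k"
    using 1 by (intro mult_right_mono) auto
  also have "\<dots> = 2 * M * (real (card nondegenerate) * real p ^ k)" by simp
  also have "\<dots> \<le> 2 * M * real p ^ (\<Sum>a<k. gam a)"
  proof (rule mult_left_mono)
    show "real (card nondegenerate) * real p ^ k \<le> real p ^ (\<Sum>a<k. gam a)"
      using card_nondegenerate(2) unfolding idx_R by (metis of_nat_le_iff of_nat_mult of_nat_power)
  qed (use M(1) in simp)
  finally have 2: "real (card ?A) * real p ^ i * real p ^ k \<le> 2 * M * real p ^ (\<Sum>a<k. gam a)" .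
  have 3: "real p powr (real (\<Sum>a<k. gam a) - real k - real i) = real p ^ (\<Sum>a<k. gam a) / real p ^ k / real p ^ i"
    using p0 by (simp only: powr_diff powr_realpow)
  show ?thesis unfolding 3 using 2 p0 by (simp add: field_simps)
qed

text \<open>The factors 2 come from the halves lost in \<open>many_nondegenerate\<close>, in
  \<open>many_extensions\<close> for the generators 2, ..., n, and in the quadric. The power of p is
  \<open>exponent_bound\<close>.\<close>

lemma typed_subring_count:
  assumes \<nu>: "\<nu> \<in> types"
  shows "real (card {L. subring_of L \<and> idx R L = p ^ i \<and> conductor L = I \<and> has_type \<nu> L}) \<le>
    2 ^ Suc n * real p powr ((real n / 2 - 7/6) * real i - 1)"
proof (cases "{L. subring_of L \<and> idx R L = p ^ i \<and> conductor L = I \<and> has_type \<nu> L} = {}")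
  case True
  show ?thesis unfolding True by simp
next
  case False
  let ?A = "{L. subring_of L \<and> idx R L = p ^ i \<and> conductor L = I \<and> has_type \<nu> L}"
  obtain L where L: "subring_of L" "idx R L = p ^ i" "conductor L = I" "has_type \<nu> L" using False by blast
  have midL: "mid L" using conductor_mid(1)[OF L(1,3)] .
  define s where "s = (\<Sum>l\<in>{1..n}. \<nu> l)"
  define \<kappa> where "\<kappa> = (\<Sum>a<k. gam a)"
  define W where "W = (\<Sum>j\<in>{2..n}. weight \<nu> j)"
  have p0: "real p > 0" and p1: "real p \<ge> 1"
    using prime_gt_0_nat[OF p] by auto
  have "p ^ i * p ^ s = p ^ \<kappa>"
    using tower_mid[OF midL mid_R midD(3)[OF midL]] L(2) idx_type[OF midL L(4) \<nu>] idx_R unfolding s_def \<kappa>_def by simp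
  then have \<kappa>: "\<kappa> = i + s" unfolding power_add[symmetric] p_power_eq_iff by simp
  \<comment> \<open>One such character makes L isotropic, so L/I has at most the square root of the
    order of R/I; this is the constraint 2 s \<le> \<kappa>.\<close>
  have "{\<xi> \<in> nondegenerate. \<forall>x\<in>L. \<xi> x = 1} \<noteq> {}"
  proof
    assume e: "{\<xi> \<in> nondegenerate. \<forall>x\<in>L. \<xi> x = 1} = {}"
    have "p ^ i \<le> 2 * card {\<xi> \<in> nondegenerate. \<forall>x\<in>L. \<xi> x = 1}" by (rule many_nondegenerate[OF L(1,2,3)])
    then show False unfolding e using prime_gt_0_nat[OF p] by simp
  qed
  then obtain \<xi> where \<xi>: "\<xi> \<in> nondegenerate" "\<forall>x\<in>L. \<xi> x = 1" by auto
  have "L \<in> family \<nu> \<xi> L" unfolding family_def using L \<xi> by blast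
  then have "L \<subseteq> perp \<xi> k L" using cosets_tor_subset_perp[of L \<nu> \<xi> L k] tor_pk[OF midL] by simp
  then have "idx L I * idx (lev I (p ^ (k - k)) L) I \<le> idx (perp \<xi> k L) I * idx (lev I (p ^ (k - k)) L) I"
    by (intro mult_le_mono1 idx_I_mono mid_perp[OF \<xi>(1) midD(3)[OF midL]])
  also have "\<dots> \<le> idx R I" using card_perp[OF \<xi>(1) midL, of k] tor_pk[OF mid_R] by simp
  finally have "p ^ (s + s) \<le> p ^ \<kappa>"
    using lev_1[OF midL] idx_type[OF midL L(4) \<nu>] idx_R unfolding s_def \<kappa>_def by (simp add: power_add)
  then have s2: "2 * s \<le> \<kappa>" unfolding p_power_le_iff by simp
  have W: "real s - real k + W \<le> (real n / 2 - 7/6) * real i - real k / 2"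
  proof -
    have "real s - real k + W \<le> (real n / 2 - 7/6) * (real \<kappa> - real s) - real k / 2"
      unfolding s_def \<kappa>_def W_def weight_def
    proof (rule exponent_bound[OF n6])
      show "\<nu> 1 = k" "\<And>l. l \<in> {1..n} \<Longrightarrow> \<nu> l \<le> k" using \<nu> unfolding types_def by auto
      show "\<And>a. a < k \<Longrightarrow> 2 \<le> gam a" by (rule gam_ge_2[OF \<xi>(1)])
      show "\<And>a. gam a \<le> n" by (rule gam_le)
      show "\<And>a. layer_size n \<nu> a \<le> gam a" by (rule layer_size_le_gam[OF midL L(4)])
      show "2 * (\<Sum>l\<in>{1..n}. \<nu> l) \<le> (\<Sum>a<k. gam a)" using s2 unfolding s_def \<kappa>_def .
    qed
    then show ?thesis using \<kappa> by simp
  qed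
  have prod: "(\<Prod>m\<in>{2..n}. 2 * real p powr weight \<nu> m) = 2 ^ (n - 1) * real p powr W"
    unfolding W_def using p0 by (simp add: prod.distrib powr_sum)
  have F: "real (card (family \<nu> \<psi> adjoin_1)) \<le> 2 ^ (n - 1) * real p powr W" if "\<psi> \<in> nondegenerate" for \<psi>
    using family_bound[OF \<nu> that _ _ adapted_1[OF \<nu>]] n6 prod by (simp add: numeral_2_eq_2)
  have two: "(2::real) ^ n = 2 * 2 ^ (n - 1)" using n6 by (cases n) auto
  have e\<kappa>: "real \<kappa> - real k - real i = real s - real k" using \<kappa> by simp
  have G: "real (card ?A) \<le> 2 ^ n * real p powr (real s - real k + W)"
    using type_count[OF \<nu> _ F] unfolding \<kappa>_def[symmetric] e\<kappa> two powr_add by (simp add: algebra_simps)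
  have pos: "2 ^ n * (x :: real) \<le> 2 ^ Suc n * y" if "0 \<le> x" "x \<le> y" for x y
  proof -
    have "2 ^ n * x \<le> 2 ^ n * (2 * y)" using that by (intro mult_left_mono) auto
    then show ?thesis by simp
  qed
  \<comment> \<open>The gain k/2 reaches 1 for k \<ge> 2. The remaining cases have k = 1 and differ
    in whether there is a second generator.\<close>
  consider "k \<ge> 2" | "k = 1" "\<nu> 2 = 0" | "k = 1" "\<nu> 2 \<ge> 1" using k(3) by linarith
  then show ?thesis
  proof cases
    case 1
    have "real p powr (real s - real k + W) \<le> real p powr ((real n / 2 - 7/6) * real i - 1)"
      using W 1 p1 by (intro powr_mono) auto
    then show ?thesis using G pos by (meson order_trans powr_ge_zero)
  next
    case 2
    have "\<nu> l = 0" if "l \<in> {2..n}" for l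
      using \<nu> that 2(2) n6 unfolding types_def by fastforce
    then have "(\<Sum>l\<in>{2..n}. \<nu> l) = 0" by simp
    moreover have "{1..n} = insert 1 {2..n}" using n6 by auto
    ultimately have "s = 1" using \<nu> 2(1) unfolding s_def types_def by simp
    \<comment> \<open>Here L/I is cyclic and generated by 1.\<close>
    have "?A \<subseteq> {adjoin_1}"
    proof
      fix L' assume "L' \<in> ?A"
      then have L': "mid L'" "adjoin_1 \<subseteq> L'" "has_type \<nu> L'" using conductor_mid by auto
      have "idx L' I = idx adjoin_1 I"
        using idx_type[OF L'(1,3) \<nu>] \<open>s = 1\<close> idx_adjoin_1 2(1) unfolding s_def by simp
      then have "idx L' adjoin_1 = 1"
        using tower_mid[OF mid_adjoin_1 L'(1,2)] idx_mid_pos[OF mid_I mid_adjoin_1 midD(2)[OF mid_adjoin_1]] by simp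
      then show "L' \<in> {adjoin_1}"
        using idx_1_iff[OF midD(1)[OF mid_adjoin_1] midD(1)[OF L'(1)] L'(2)] by simp
    qed
    then have "card ?A \<le> card {adjoin_1}" by (intro card_mono) auto
    then have "real (card ?A) \<le> 1" by simp
    also have "1 \<le> 2 ^ Suc n * real p powr ((real n / 2 - 7/6) * real i - 1)"
    proof -
      have "1 * 1 \<le> (real n / 2 - 7/6) * real i" using n6 i1 by (intro mult_mono) auto
      then have "real p powr 0 \<le> real p powr ((real n / 2 - 7/6) * real i - 1)"
        using p1 by (intro powr_mono) auto
      then have "1 \<le> real p powr ((real n / 2 - 7/6) * real i - 1)" using p0 by simp
      moreover have "(1::real) \<le> 2 ^ Suc n" by (rule one_le_power) simp
      ultimately have "1 * 1 \<le> 2 ^ Suc n * real p powr ((real n / 2 - 7/6) * real i - 1)"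
        by (intro mult_mono) auto
      then show ?thesis by simp
    qed
    finally show ?thesis .
  next
    case 3
    have "\<nu> 2 \<le> k" using \<nu> n6 unfolding types_def by auto
    then have "\<nu> 2 = 1" using 3 by simp
    then have v2: "\<nu> (Suc 1) = 1" by (simp add: numeral_2_eq_2)
    have "{1,2} \<subseteq> {1..n}" using n6 by auto
    then have "(\<Sum>l\<in>{1,2}. \<nu> l) \<le> s" unfolding s_def by (intro sum_mono2) auto
    moreover have "\<nu> 1 = k" using \<nu> unfolding types_def by blast
    ultimately have "s \<ge> 2" using 3 by simp
    \<comment> \<open>With s \<ge> 2 the isotropy constraint even gives \<kappa> \<ge> 4.\<close>
    then have big: "p ^ 3 \<le> idx R I" using s2 unfolding idx_R \<kappa>_def[symmetric] p_power_le_iff by linarith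
    define M where "M = (\<Prod>m\<in>{Suc 2..n}. 2 * real p powr weight \<nu> m)"
    have M0: "M \<ge> 0" unfolding M_def by (intro prod_nonneg) auto
    have MM: "2 * real p powr weight \<nu> 2 * M = 2 ^ (n - 1) * real p powr W"
    proof -
      have "{2..n} = insert 2 {Suc 2..n}" using n6 by auto
      then show ?thesis unfolding prod[symmetric] M_def by simp
    qed
    \<comment> \<open>The bound \<open>F\<close> with an extra factor 2/p, obtained by replacing the
      orthogonal complement with the zeros of the quadratic form at the choice of the second
      generator.\<close>
    have F': "real (card (family \<nu> \<psi> adjoin_1)) \<le> 2 / real p * (2 ^ (n - 1) * real p powr W)"
      if \<psi>: "\<psi> \<in> nondegenerate" for \<psi>
    proof -
      let ?Q = "perp \<psi> 1 adjoin_1"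
      define C where "C = cosets {y\<in>?Q. \<psi> (y * y) = 1} I"
      define \<tau> where "\<tau> = (\<Sum>l\<in>{1..n}. min (\<nu> l) (\<nu> (Suc 1)))"
      define e where "e = real (\<Sum>a<\<nu> (Suc 1). gam a) - (\<Sum>l\<in>{1..<Suc 1}. real (\<nu> l + \<nu> (Suc 1) - k))"
      have Q: "mid ?Q" by (rule mid_perp[OF \<psi> midD(3)[OF mid_adjoin_1]])
      have "real (card (family \<nu> \<psi> adjoin_1)) * real p ^ \<tau> \<le> 2 * real (card C) * M"
        unfolding \<tau>_def
      proof (rule family_step[OF \<nu> _ _ adapted_1[OF \<nu>] _ _ M0])
        show "finite C" unfolding C_def by (rule finite_cosets_mono[OF finite_mid[OF Q]]) auto
        show "cosets (tor I (p ^ \<nu> (Suc 1)) L') I \<subseteq> C" if L': "L' \<in> family \<nu> \<psi> adjoin_1" for L'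
        proof -
          \<comment> \<open>L' contains the squares of its elements, and \<psi> is trivial on
            L'.\<close>
          have "tor I (p ^ 1) L' \<subseteq> {y\<in>?Q. \<psi> (y * y) = 1}"
            using cosets_tor_subset_perp[OF L', of 1] familyD(4,5)[OF L'] tor_sub by blast
          then show ?thesis unfolding C_def cosets_def v2 by (rule image_mono)
        qed
        show "real (card (family \<nu> \<psi> X')) \<le> M" if "adapted \<nu> (Suc 1) X'" for X'
          using family_bound[OF \<nu> \<psi> _ _ that] n6 unfolding M_def by (simp add: numeral_2_eq_2)
      qed (use n6 in auto)
      moreover have "real p * real (card C) \<le> 2 * real p powr e"
      proof -
        have "real (p * card C) \<le> real (2 * idx ?Q I)"
          unfolding of_nat_le_iff C_def by (rule quadric_zeros[OF \<psi> 3(1) big])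
        then have "real p * real (card C) \<le> 2 * real (idx ?Q I)" by simp
        also have "real (idx ?Q I) \<le> real p powr e"
          using idx_perp_adapted[OF \<nu> \<psi> adapted_1[OF \<nu>]] n6 unfolding v2 e_def by simp
        finally show ?thesis by simp
      qed
      then have 1: "real p * real (card C) * (2 * M) \<le> 2 * real p powr e * (2 * M)"
        using M0 by (intro mult_right_mono) auto
      ultimately have "real p * (real (card (family \<nu> \<psi> adjoin_1)) * real p ^ \<tau>) \<le> real p * (2 * real (card C) * M)"
        using p0 by (intro mult_left_mono) auto
      also have "\<dots> = real p * real (card C) * (2 * M)" by simp
      also note 1
      finally have "real p * (real (card (family \<nu> \<psi> adjoin_1)) * real p ^ \<tau>) \<le> 2 * (2 * real p powr e * M)" by simp
      moreover have "e - real \<tau> = weight \<nu> 2" unfolding weight_def e_def \<tau>_def by (simp add: numeral_2_eq_2)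
      then have "real p powr weight \<nu> 2 * real p ^ \<tau> = real p powr e"
        using p0 by (simp add: powr_realpow[symmetric] powr_add[symmetric] flip: \<open>e - real \<tau> = weight \<nu> 2\<close>)
      ultimately have "real p * real (card (family \<nu> \<psi> adjoin_1)) * real p ^ \<tau> \<le>
          2 * (2 * real p powr weight \<nu> 2 * M) * real p ^ \<tau>" by (simp add: algebra_simps)
      then have "real p * real (card (family \<nu> \<psi> adjoin_1)) \<le> 2 * (2 * real p powr weight \<nu> 2 * M)"
        using p0 by simp
      then show ?thesis unfolding MM using p0 by (simp add: field_simps)
    qed
    have "real (card ?A) \<le> 2 * real p powr (real s - real k) * (2 / real p * (2 ^ (n - 1) * real p powr W))"
      using type_count[OF \<nu> _ F'] p0 unfolding \<kappa>_def[symmetric] e\<kappa> by simp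
    also have "\<dots> = 2 / real p * (2 ^ n * real p powr (real s - real k + W))"
      unfolding two powr_add by simp
    also have "\<dots> = 2 ^ Suc n * real p powr (real s - real k + W - 1)"
      using p0 by (simp add: powr_diff)
    also have "\<dots> \<le> 2 ^ Suc n * real p powr ((real n / 2 - 7/6) * real i - 1)"
      using W p1 by (intro mult_left_mono powr_mono) auto
    finally show ?thesis .
  qed
qed

lemma conductor_count:
  "real (card {L. subring_of L \<and> idx R L = p ^ i \<and> conductor L = I}) \<le>
    real (k + 1) ^ n * (2 ^ Suc n * real p powr ((real n / 2 - 7/6) * real i - 1))"
proof -
  let ?A = "\<lambda>\<nu>. {L. subring_of L \<and> idx R L = p ^ i \<and> conductor L = I \<and> has_type \<nu> L}"
  let ?B = "2 ^ Suc n * real p powr ((real n / 2 - 7/6) * real i - 1)"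
  have "{L. subring_of L \<and> idx R L = p ^ i \<and> conductor L = I} \<subseteq> (\<Union>\<nu>\<in>types. ?A \<nu>)"
    using type_exists conductor_mid(1) subring_ofD(2) by blast
  moreover have "finite (\<Union>\<nu>\<in>types. ?A \<nu>)"
    by (rule finite_subset[OF _ finite_subrings]) blast
  ultimately have "card {L. subring_of L \<and> idx R L = p ^ i \<and> conductor L = I} \<le> card (\<Union>\<nu>\<in>types. ?A \<nu>)"
    by (intro card_mono)
  also have "\<dots> \<le> (\<Sum>\<nu>\<in>types. card (?A \<nu>))" by (rule card_UN_le[OF finite_types(1)])
  finally have "real (card {L. subring_of L \<and> idx R L = p ^ i \<and> conductor L = I}) \<le> (\<Sum>\<nu>\<in>types. real (card (?A \<nu>)))"
    unfolding of_nat_sum[symmetric] of_nat_le_iff .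
  also have "\<dots> \<le> (\<Sum>\<nu>\<in>types. ?B)" by (rule sum_mono) (rule typed_subring_count)
  also have "\<dots> = real (card types) * ?B" by simp
  also have "\<dots> \<le> real ((k + 1) ^ n) * ?B"
    using finite_types(2) by (intro mult_right_mono) auto
  finally show ?thesis unfolding of_nat_power .
qed

end

section \<open>Summation over all conductors\<close>

context prime_reduced
begin

lemma finite_subrings_of_index: "finite {L. subring_of L \<and> idx R L = p ^ i}"
  by (rule finite_subset[OF _ finite_intermediate[of i]])
    (use pw_subset_subring(1) subring_ofD in blast)

text \<open>One factor (i + 1)^n counts the conductors, the other bounds the number of types, since
  k \<le> i.\<close>

theorem subring_bound:
  assumes n: "n \<ge> 6" "2 * n \<le> p" and i: "i \<ge> 1"
  shows "real (card {L. subring_of L \<and> idx R L = p ^ i}) \<le>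
    real (i + 1) ^ (2 * n) * (2 ^ Suc n * real p powr ((real n / 2 - 7/6) * real i - 1))"
proof -
  let ?A = "\<lambda>I. {L. subring_of L \<and> idx R L = p ^ i \<and> conductor L = I}"
  let ?I = "{I. ideal_of R I \<and> pw i \<subseteq> I}"
  let ?B = "2 ^ Suc n * real p powr ((real n / 2 - 7/6) * real i - 1)"
  note fin = finite_subrings_of_index[of i]
  have bound: "real (card (?A I)) \<le> real (i + 1) ^ n * ?B" if I: "I \<in> ?I" for I
  proof (cases "?A I = {}")
    case True
    show ?thesis unfolding True by simp
  next
    case False
    then obtain L where L: "subring_of L" "idx R L = p ^ i" "conductor L = I" by blast
    \<comment> \<open>The conductor is proper because the index p^i exceeds 1; this makes k \<ge>
      1.\<close>
    have "1 \<notin> I"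
    proof
      assume "1 \<in> I"
      then have "R \<subseteq> L" using L(3) unfolding conductor_def by force
      then have "L = R" using subring_ofD(3)[OF L(1)] by blast
      then have "p ^ i = 1" using L(2) idx_self[OF R_sub] by simp
      then show False using prime_gt_1_nat[OF p] i by simp
    qed
    define k where "k = (LEAST k. of_nat (p ^ k) \<in> I)"
    have pi: "of_nat (p ^ i) \<in> I" using pwI[OF R_1, of i] I by auto
    have k: "of_nat (p ^ k) \<in> I" unfolding k_def by (rule LeastI[of "\<lambda>k. of_nat (p ^ k) \<in> I", OF pi])
    have ki: "k \<le> i" unfolding k_def by (rule Least_le[of "\<lambda>k. of_nat (p ^ k) \<in> I", OF pi])
    have k1: "k \<ge> 1"
    proof (rule ccontr)
      assume "\<not> k \<ge> 1"
      then have "k = 0" by simp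
      then show False using k \<open>1 \<notin> I\<close> by simp
    qed
    then have k': "of_nat (p ^ (k - 1)) \<notin> I"
      using not_less_Least[of "k - 1" "\<lambda>k. of_nat (p ^ k) \<in> I"] unfolding k_def[symmetric] by simp
    interpret conductor_quotient R p n I i k
      by unfold_locales (use n i I k k1 k' in auto)
    have "real (card (?A I)) \<le> real (k + 1) ^ n * ?B" by (rule conductor_count)
    also have "\<dots> \<le> real (i + 1) ^ n * ?B" using ki by (intro mult_right_mono power_mono) auto
    finally show ?thesis .
  qed
  have "{L. subring_of L \<and> idx R L = p ^ i} \<subseteq> (\<Union>I\<in>?I. ?A I)"
    using ideal_conductor(1) pw_subset_conductor by blast
  moreover have "finite (\<Union>I\<in>?I. ?A I)" by (rule finite_subset[OF _ fin]) blast
  ultimately have "card {L. subring_of L \<and> idx R L = p ^ i} \<le> card (\<Union>I\<in>?I. ?A I)" by (intro card_mono)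
  also have "\<dots> \<le> (\<Sum>I\<in>?I. card (?A I))" by (rule card_UN_le[OF card_ideals(1)[OF i]])
  finally have "real (card {L. subring_of L \<and> idx R L = p ^ i}) \<le> (\<Sum>I\<in>?I. real (card (?A I)))"
    unfolding of_nat_sum[symmetric] of_nat_le_iff .
  also have "\<dots> \<le> (\<Sum>I\<in>?I. real (i + 1) ^ n * ?B)" by (rule sum_mono) (rule bound)
  also have "\<dots> = real (card ?I) * (real (i + 1) ^ n * ?B)" by simp
  also have "\<dots> \<le> real ((i + 1) ^ n) * (real (i + 1) ^ n * ?B)"
  proof (rule mult_right_mono)
    show "real (card ?I) \<le> real ((i + 1) ^ n)" unfolding of_nat_le_iff by (rule card_ideals(2)[OF i])
  qed simp
  also have "\<dots> = real (i + 1) ^ (2 * n) * ?B" unfolding of_nat_power mult_2 power_add by (rule mult.assoc[symmetric])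
  finally show ?thesis .
qed

end

section \<open>Rings of integers of number fields\<close>

definition int_span :: "'a::comm_ring_1 set \<Rightarrow> 'a set" where
  "int_span G = {\<Sum>g\<in>G. of_int (c g) * g | c. True}"

lemma add_subgroup_int_span: "add_subgroup (int_span G)"
  unfolding add_subgroup_def int_span_def
proof safe
  show "\<exists>c. 0 = (\<Sum>g\<in>G. of_int (c g) * g) \<and> True" by (rule exI[of _ "\<lambda>_. 0"]) simp
  fix c d :: "'a \<Rightarrow> int"
  show "\<exists>e. (\<Sum>g\<in>G. of_int (c g) * g) - (\<Sum>g\<in>G. of_int (d g) * g) = (\<Sum>g\<in>G. of_int (e g) * g) \<and> True"
    by (rule exI[of _ "\<lambda>g. c g - d g"]) (simp add: sum_subtractf left_diff_distrib)
qed

lemma int_span_base: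
  assumes "finite G" "g \<in> G"
  shows "g \<in> int_span G"
proof -
  have "(\<Sum>h\<in>G. of_int (if h = g then 1 else 0) * h) = (\<Sum>h\<in>G. if h = g then h else 0)"
    by (rule sum.cong) auto
  also have "\<dots> = g" using assms by simp
  finally show ?thesis unfolding int_span_def by (intro CollectI exI[of _ "\<lambda>h. if h = g then 1 else 0"]) simp
qed

lemma int_span_minimal: "add_subgroup S \<Longrightarrow> G \<subseteq> S \<Longrightarrow> int_span G \<subseteq> S"
proof
  fix x assume S: "add_subgroup S" "G \<subseteq> S" and "x \<in> int_span G"
  then obtain c where x: "x = (\<Sum>g\<in>G. of_int (c g) * g)" unfolding int_span_def by blast
  show "x \<in> S" unfolding x
    by (rule add_subgroup_sum[OF S(1)], rule add_subgroup_of_int[OF S(1)]) (use S(2) in blast)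
qed

text \<open>The determinant trick: z is an eigenvalue of the integer matrix of multiplication by z
  on the generators, so it is a root of a monic characteristic polynomial.\<close>

lemma algebraic_int_of_int_span:
  fixes z :: "'a::field_char_0"
  assumes G: "finite G" "g0 \<in> G" "g0 \<noteq> 0" and z: "\<And>g. g \<in> G \<Longrightarrow> z * g \<in> int_span G"
  shows "algebraic_int z"
proof -
  obtain e where e: "bij_betw e {0..<card G} G" using G(1) ex_bij_betw_nat_finite by blast
  have "\<exists>c. \<forall>g\<in>G. z * g = (\<Sum>h\<in>G. of_int (c g h) * h)"
    using z unfolding int_span_def by (intro bchoice) auto
  then obtain c where c: "\<And>g. g \<in> G \<Longrightarrow> z * g = (\<Sum>h\<in>G. of_int (c g h) * h)" by blast
  define n where "n = card G"
  define A where "A = mat n n (\<lambda>(i, j). c (e i) (e j))"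
  define v where "v = vec n e"
  let ?h = "of_int :: int \<Rightarrow> 'a"
  have A: "A \<in> carrier_mat n n" and mA: "map_mat ?h A \<in> carrier_mat n n" unfolding A_def by auto
  have eG: "e i \<in> G" if "i < n" for i using e that unfolding n_def bij_betw_def by auto
  have "map_mat ?h A *\<^sub>v v = z \<cdot>\<^sub>v v"
  proof (rule eq_vecI)
    fix i assume "i < dim_vec (z \<cdot>\<^sub>v v)"
    then have i: "i < n" unfolding v_def by simp
    have "(map_mat ?h A *\<^sub>v v) $ i = (\<Sum>j\<in>{0..<n}. ?h (c (e i) (e j)) * e j)"
      using i unfolding A_def v_def by (auto simp: scalar_prod_def)
    also have "\<dots> = (\<Sum>h\<in>G. ?h (c (e i) h) * h)"
      using e unfolding n_def by (rule sum.reindex_bij_betw)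
    also have "\<dots> = (z \<cdot>\<^sub>v v) $ i" using c[OF eG[OF i]] i unfolding v_def by simp
    finally show "(map_mat ?h A *\<^sub>v v) $ i = (z \<cdot>\<^sub>v v) $ i" .
  qed (simp add: A_def v_def)
  moreover have "v \<noteq> 0\<^sub>v n"
  proof
    assume v0: "v = 0\<^sub>v n"
    have "g0 \<in> e ` {0..<n}" using e G(2) unfolding n_def bij_betw_def by simp
    then obtain i where "i < n" "e i = g0" by auto
    then show False using v0 G(3) unfolding v_def by (metis index_vec index_zero_vec(1))
  qed
  ultimately have "eigenvalue (map_mat ?h A) z"
    unfolding eigenvalue_def eigenvector_def using mA by (intro exI[of _ v]) (auto simp: v_def)
  then have "poly (char_poly (map_mat ?h A)) z = 0" using eigenvalue_root_char_poly[OF mA] by blast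
  then have "poly (map_poly ?h (char_poly A)) z = 0" using of_int_hom.char_poly_hom[OF A] by metis
  moreover have "lead_coeff (char_poly A) = 1" using degree_monic_char_poly[OF A] by metis
  ultimately show ?thesis unfolding algebraic_int_altdef_ipoly by blast
qed

lemma monic_relation:
  fixes x :: "'a::field_char_0"
  assumes "algebraic_int x"
  obtains d b where "d > 0" "x ^ d = (\<Sum>i<d. of_int (b i) * x ^ i)"
proof -
  obtain q where q: "poly (map_poly of_int q) x = 0" "lead_coeff q = 1"
    using assms unfolding algebraic_int_altdef_ipoly by blast
  let ?d = "degree q"
  have "poly (map_poly of_int q) x = (\<Sum>i\<le>?d. of_int (coeff q i) * x ^ i)"
    by (simp add: poly_altdef degree_map_poly coeff_map_poly)
  also have "\<dots> = (\<Sum>i<?d. of_int (coeff q i) * x ^ i) + x ^ ?d"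
    using q(2) by (simp add: lessThan_Suc_atMost[symmetric])
  finally have e: "x ^ ?d = - (\<Sum>i<?d. of_int (coeff q i) * x ^ i)"
    using q(1) by (simp add: eq_neg_iff_add_eq_0 add.commute)
  then have "x ^ ?d = (\<Sum>i<?d. of_int (- coeff q i) * x ^ i)" by (simp add: sum_negf)
  moreover have "?d > 0" using e by (cases "?d") auto
  ultimately show ?thesis using that[of ?d "\<lambda>i. - coeff q i"] by blast
qed

lemma monic_relation_algebraic_int:
  fixes x :: "'a::field_char_0"
  assumes "d > 0" "x ^ d = (\<Sum>i<d. of_int (b i) * x ^ i)"
  shows "algebraic_int x"
proof (rule algebraic_int_of_int_span[of "(\<lambda>i. x ^ i) ` {..<d}" 1])
  let ?G = "(\<lambda>i. x ^ i) ` {..<d}"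
  show "1 \<in> ?G" using assms(1) by (auto intro!: image_eqI[of _ _ 0])
  fix g assume "g \<in> ?G"
  then obtain i where i: "i < d" "g = x ^ i" by blast
  have pow: "x ^ j \<in> int_span ?G" if "j < d" for j using that by (intro int_span_base) auto
  show "x * g \<in> int_span ?G"
  proof (cases "Suc i < d")
    case True
    then show ?thesis using pow[OF True] i by simp
  next
    case False
    then have "d = Suc i" using i(1) by simp
    then have "x * g = x ^ d" using i(2) by simp
    also have "\<dots> \<in> int_span ?G"
      unfolding assms(2) using pow by (intro add_subgroup_sum add_subgroup_of_int add_subgroup_int_span) auto
    finally show ?thesis .
  qed
qed auto

text \<open>The finitely many monomials x^i y^j span a group stable under multiplication by x and y,
  hence by x - y and x y.\<close>

lemma algebraic_int_closed:
  fixes x y :: "'a::field_char_0"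
  assumes "algebraic_int x" "algebraic_int y"
  shows "algebraic_int (x - y)" "algebraic_int (x * y)"
proof -
  obtain d b where d: "d > 0" "x ^ d = (\<Sum>i<d. of_int (b i) * x ^ i)" using monic_relation[OF assms(1)] .
  obtain e c where e: "e > 0" "y ^ e = (\<Sum>i<e. of_int (c i) * y ^ i)" using monic_relation[OF assms(2)] .
  define G where "G = (\<lambda>(i, j). x ^ i * y ^ j) ` ({..<d} \<times> {..<e})"
  have fin: "finite G" unfolding G_def by simp
  have one: "1 \<in> G" unfolding G_def using d(1) e(1) by (auto intro!: image_eqI[of _ _ "(0, 0)"])
  note S = add_subgroup_int_span[of G]
  have base: "x ^ i * y ^ j \<in> int_span G" if "i < d" "j < e" for i j
    using that by (intro int_span_base[OF fin]) (auto simp: G_def)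
  have xg: "x * g \<in> int_span G" if g: "g \<in> G" for g
  proof -
    obtain i j where ij: "i < d" "j < e" "g = x ^ i * y ^ j" using g unfolding G_def by auto
    show ?thesis
    proof (cases "Suc i < d")
      case True
      then show ?thesis using base[OF True ij(2)] ij(3) by (simp add: mult.assoc)
    next
      case False
      then have "d = Suc i" using ij(1) by simp
      then have "x * g = x ^ d * y ^ j" using ij(3) by (simp add: mult.assoc)
      also have "\<dots> = (\<Sum>i<d. of_int (b i) * (x ^ i * y ^ j))" unfolding d(2) sum_distrib_right by (simp add: mult.assoc)
      also have "\<dots> \<in> int_span G" using base ij(2) by (intro add_subgroup_sum[OF S] add_subgroup_of_int[OF S]) auto
      finally show ?thesis .
    qed
  qed
  have yg: "y * g \<in> int_span G" if g: "g \<in> G" for g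
  proof -
    obtain i j where ij: "i < d" "j < e" "g = x ^ i * y ^ j" using g unfolding G_def by auto
    show ?thesis
    proof (cases "Suc j < e")
      case True
      then show ?thesis using base[OF ij(1) True] ij(3) by (simp add: mult.left_commute)
    next
      case False
      then have "e = Suc j" using ij(2) by simp
      then have "y * g = y ^ e * x ^ i" using ij(3) by (simp add: algebra_simps)
      also have "\<dots> = (\<Sum>j<e. of_int (c j) * (x ^ i * y ^ j))" unfolding e(2) sum_distrib_right by (simp add: algebra_simps)
      also have "\<dots> \<in> int_span G" using base ij(1) by (intro add_subgroup_sum[OF S] add_subgroup_of_int[OF S]) auto
      finally show ?thesis .
    qed
  qed
  have stable: "w * v \<in> int_span G" if "\<And>g. g \<in> G \<Longrightarrow> w * g \<in> int_span G" "v \<in> int_span G" for w v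
  proof -
    have "add_subgroup {v. w * v \<in> int_span G}"
      unfolding add_subgroup_def using S by (auto simp: add_subgroup_def right_diff_distrib)
    then have "int_span G \<subseteq> {v. w * v \<in> int_span G}" using that(1) by (intro int_span_minimal) auto
    then show ?thesis using that(2) by blast
  qed
  show "algebraic_int (x - y)"
    by (rule algebraic_int_of_int_span[OF fin one])
      (use xg yg add_subgroupD(2)[OF S] in \<open>auto simp: left_diff_distrib\<close>)
  show "algebraic_int (x * y)"
    by (rule algebraic_int_of_int_span[OF fin one])
      (use yg stable[OF xg] in \<open>auto simp: mult.assoc\<close>)
qed

text \<open>Multiplying the equation of degree d by the power d - 1 of the leading coefficient a
  makes it monic in a x.\<close>

lemma algebraic_int_lead_coeff:
  fixes x :: "'a::field_char_0"
  assumes f: "f \<noteq> 0" "poly (map_poly of_int f) x = 0"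
  shows "algebraic_int (of_int (lead_coeff f) * x)"
proof -
  let ?d = "degree f" and ?a = "of_int (lead_coeff f) :: 'a"
  have "poly (map_poly of_int f) x = (\<Sum>i\<le>?d. of_int (coeff f i) * x ^ i)"
    by (simp add: poly_altdef degree_map_poly coeff_map_poly)
  also have "\<dots> = (\<Sum>i<?d. of_int (coeff f i) * x ^ i) + ?a * x ^ ?d"
    by (simp add: lessThan_Suc_atMost[symmetric])
  finally have r: "?a * x ^ ?d = - (\<Sum>i<?d. of_int (coeff f i) * x ^ i)"
    using f(2) by (simp add: eq_neg_iff_add_eq_0 add.commute)
  have a0: "?a \<noteq> 0" using f(1) by simp
  have d: "?d > 0"
  proof (rule ccontr)
    assume "\<not> ?d > 0"
    then show False using r a0 by simp
  qed
  have "(?a * x) ^ ?d = ?a ^ (?d - 1) * (?a * x ^ ?d)" using d by (cases ?d) (auto simp: power_mult_distrib)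
  also have "\<dots> = (\<Sum>i<?d. - (?a ^ (?d - 1) * (of_int (coeff f i) * x ^ i)))"
    unfolding r by (simp add: sum_negf sum_distrib_left)
  also have "\<dots> = (\<Sum>i<?d. of_int (- coeff f i * lead_coeff f ^ (?d - 1 - i)) * (?a * x) ^ i)"
  proof (rule sum.cong[OF refl])
    fix i assume "i \<in> {..<?d}"
    then have "?a ^ (?d - 1) = ?a ^ (?d - 1 - i) * ?a ^ i" by (simp flip: power_add)
    then show "- (?a ^ (?d - 1) * (of_int (coeff f i) * x ^ i)) =
        of_int (- coeff f i * lead_coeff f ^ (?d - 1 - i)) * (?a * x) ^ i"
      by (simp add: power_mult_distrib)
  qed
  finally show ?thesis by (rule monic_relation_algebraic_int[OF d])
qed

interpretation rat_space: vector_space "\<lambda>(q::rat) (x::'a::field_char_0). of_rat q * x"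
  by unfold_locales (auto simp: algebra_simps of_rat_add of_rat_mult)

locale number_field_ring =
  fixes K :: "'a::field_char_0 set" and n :: nat
  assumes K: "number_field K" and n: "field_degree K = n"
begin

lemma K_closed:
  "1 \<in> K" "add_subgroup K" "\<And>x y. x \<in> K \<Longrightarrow> y \<in> K \<Longrightarrow> x * y \<in> K" "\<And>x. x \<in> K \<Longrightarrow> inverse x \<in> K"
proof -
  show 1: "1 \<in> K" and m: "\<And>x y. x \<in> K \<Longrightarrow> y \<in> K \<Longrightarrow> x * y \<in> K" "\<And>x. x \<in> K \<Longrightarrow> inverse x \<in> K"
    using K unfolding number_field_def by auto
  have "1 - 1 \<in> K" using K 1 unfolding number_field_def by blast
  then show "add_subgroup K" using K unfolding number_field_def add_subgroup_def by auto
qed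

lemma K_power: "x \<in> K \<Longrightarrow> x ^ i \<in> K"
  by (induction i) (auto intro: K_closed)

lemma basis:
  obtains B where "finite B" "card B = n" "B \<subseteq> K" "K \<subseteq> rat_space.span B"
proof -
  obtain B0 where B0: "finite B0" "K = rat_space.span B0" using K unfolding number_field_def by blast
  obtain B where B: "B \<subseteq> K" "rat_space.independent B" "K \<subseteq> rat_space.span B" "card B = rat_space.dim K"
    using rat_space.basis_exists by blast
  have "finite B" using rat_space.independent_span_bound[OF B0(1) B(2)] B(1) B0(2) by blast
  then show ?thesis using that B n unfolding field_degree_def by blast
qed

lemma integer_relation:
  assumes x: "\<And>i. i \<le> n \<Longrightarrow> x i \<in> K"
  obtains c :: "nat \<Rightarrow> int" where "\<exists>i\<le>n. c i \<noteq> 0" "(\<Sum>i\<le>n. of_int (c i) * x i) = 0"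
proof (cases "inj_on x {..n}")
  \<comment> \<open>Linear independence is a property of the set of values, so a repeated value is
    treated separately.\<close>
  case False
  then obtain i j where ij: "i \<le> n" "j \<le> n" "i \<noteq> j" "x i = x j" unfolding inj_on_def by auto
  let ?c = "\<lambda>l. (if l = i then 1 else 0) - (if l = j then 1 else 0) :: int"
  have "(\<Sum>l\<le>n. of_int (?c l) * x l) = (\<Sum>l\<le>n. (if l = i then x l else 0) - (if l = j then x l else 0))"
    by (rule sum.cong) auto
  also have "\<dots> = 0" using ij by (simp add: sum_subtractf)
  finally show ?thesis using that[of ?c] ij by force
next
  case True
  obtain B where B: "finite B" "card B = n" "B \<subseteq> K" "K \<subseteq> rat_space.span B" using basis .
  have "\<not> rat_space.independent (x ` {..n})"
  proof
    assume "rat_space.independent (x ` {..n})"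
    moreover have "x ` {..n} \<subseteq> rat_space.span B" using x B(4) by auto
    ultimately have "card (x ` {..n}) \<le> n" using rat_space.independent_span_bound[OF B(1)] B(2) by blast
    then show False using card_image[OF True] by simp
  qed
  then obtain t u v where t: "finite t" "t \<subseteq> x ` {..n}" "(\<Sum>v\<in>t. of_rat (u v) * v) = 0" "v \<in> t" "u v \<noteq> 0"
    unfolding rat_space.dependent_explicit by blast
  define q where "q i = (if x i \<in> t then u (x i) else 0)" for i
  have rel: "(\<Sum>i\<le>n. of_rat (q i) * x i) = 0"
  proof -
    have "(\<Sum>i\<le>n. of_rat (q i) * x i) = (\<Sum>y\<in>x ` {..n}. of_rat (if y \<in> t then u y else 0) * y)"
      unfolding q_def using True by (simp add: sum.reindex)
    also have "\<dots> = (\<Sum>v\<in>t. of_rat (u v) * v)"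
      using t(1,2) by (intro sum.mono_neutral_cong_right) auto
    finally show ?thesis using t(3) by simp
  qed
  define D where "D = (\<Prod>i\<le>n. snd (quotient_of (q i)))"
  have D: "D > 0" unfolding D_def by (intro prod_pos) (simp add: quotient_of_denom_pos')
  have "\<exists>c. of_int D * q i = of_int c" if "i \<le> n" for i
  proof -
    have "snd (quotient_of (q i)) dvd D" unfolding D_def using that by (intro dvd_prodI) auto
    then obtain r where r: "D = r * snd (quotient_of (q i))" by (metis dvd_def mult.commute)
    have "q i = of_int (fst (quotient_of (q i))) / of_int (snd (quotient_of (q i)))"
      by (rule quotient_of_div) simp
    moreover have "snd (quotient_of (q i)) \<noteq> 0" using quotient_of_denom_pos'[of "q i"] by simp
    ultimately have "q i * of_int (snd (quotient_of (q i))) = of_int (fst (quotient_of (q i)))"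
      by (metis nonzero_eq_divide_eq of_int_eq_0_iff)
    then have "of_int D * q i = of_int (r * fst (quotient_of (q i)))"
      unfolding r by (simp add: mult.assoc mult.commute)
    then show ?thesis by blast
  qed
  then obtain c where c: "\<And>i. i \<le> n \<Longrightarrow> of_int D * q i = of_int (c i)" by metis
  have "of_int (c i) = (of_int D * of_rat (q i) :: 'a)" if "i \<le> n" for i
    using c[OF that] by (metis of_rat_mult of_rat_of_int_eq)
  then have "(\<Sum>i\<le>n. of_int (c i) * x i) = of_int D * (\<Sum>i\<le>n. of_rat (q i) * x i)"
    unfolding sum_distrib_left by (intro sum.cong) (auto simp: mult.assoc)
  then have "(\<Sum>i\<le>n. of_int (c i) * x i) = 0" using rel by simp
  moreover have "\<exists>i\<le>n. c i \<noteq> 0"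
  proof -
    obtain i where i: "i \<le> n" "x i = v" using t(2,4) by auto
    then have "q i \<noteq> 0" unfolding q_def using t(4,5) by simp
    then have "c i \<noteq> 0" using c[OF i(1)] D by auto
    then show ?thesis using i(1) by blast
  qed
  ultimately show ?thesis using that by blast
qed

text \<open>While p divides all coefficients it can be cancelled, which decreases the sum of their
  absolute values.\<close>

lemma primitive_relation:
  assumes x: "\<And>i. i \<le> n \<Longrightarrow> x i \<in> K" and p: "prime p"
  obtains c :: "nat \<Rightarrow> int" where "\<exists>i\<le>n. \<not> int p dvd c i" "(\<Sum>i\<le>n. of_int (c i) * x i) = 0"
proof -
  have *: "\<exists>c. (\<exists>i\<le>n. \<not> int p dvd c i) \<and> (\<Sum>i\<le>n. of_int (c i) * x i) = 0"
    if "\<exists>i\<le>n. c i \<noteq> 0" "(\<Sum>i\<le>n. of_int (c i) * x i) = 0" for c :: "nat \<Rightarrow> int"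
    using that
  proof (induction "\<Sum>i\<le>n. nat \<bar>c i\<bar>" arbitrary: c rule: less_induct)
    case less
    show ?case
    proof (cases "\<exists>i\<le>n. \<not> int p dvd c i")
      case False
      define d where "d i = c i div int p" for i
      have c: "c i = int p * d i" if "i \<le> n" for i using False that unfolding d_def by simp
      have "(\<Sum>i\<le>n. of_int (c i) * x i) = of_nat p * (\<Sum>i\<le>n. of_int (d i) * x i)"
        unfolding sum_distrib_left using c by (intro sum.cong) (auto simp: mult.assoc)
      then have d0: "(\<Sum>i\<le>n. of_int (d i) * x i) = 0" using less.prems(2) prime_gt_0_nat[OF p] by simp
      obtain i where i: "i \<le> n" "c i \<noteq> 0" using less.prems(1) by blast
      then have di: "d i \<noteq> 0" using c[OF i(1)] by auto
      have abs: "nat \<bar>c j\<bar> = p * nat \<bar>d j\<bar>" if "j \<le> n" for j using c[OF that] by (simp add: abs_mult nat_mult_distrib)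
      have "(\<Sum>j\<le>n. nat \<bar>d j\<bar>) < (\<Sum>j\<le>n. nat \<bar>c j\<bar>)"
      proof (rule sum_strict_mono_ex1)
        show "\<forall>j\<in>{..n}. nat \<bar>d j\<bar> \<le> nat \<bar>c j\<bar>" using abs prime_gt_0_nat[OF p] by auto
        show "\<exists>j\<in>{..n}. nat \<bar>d j\<bar> < nat \<bar>c j\<bar>"
          using abs[OF i(1)] di i(1) prime_gt_1_nat[OF p] by (intro bexI[of _ i]) auto
      qed simp
      then show ?thesis using less.hyps[of d] d0 di i(1) by blast
    qed (use less.prems in blast)
  qed
  obtain c where "\<exists>i\<le>n. c i \<noteq> 0" "(\<Sum>i\<le>n. of_int (c i) * x i) = 0" using integer_relation[OF x] .
  then show ?thesis using * that by blast
qed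

lemma clear_lead:
  assumes x: "x \<in> K"
  obtains m :: int where "m \<noteq> 0" "algebraic_int (of_int m * x)"
proof -
  obtain c where c: "\<exists>i\<le>n. c i \<noteq> 0" "(\<Sum>i\<le>n. of_int (c i) * x ^ i) = 0"
    using integer_relation[of "\<lambda>i. x ^ i"] K_power[OF x] by blast
  define f where "f = (\<Sum>i\<le>n. monom (c i) i)"
  have cf: "coeff f j = (if j \<le> n then c j else 0)" for j
    unfolding f_def by (auto simp: coeff_sum)
  have "f \<noteq> 0" using c(1) cf by (metis coeff_0)
  moreover have "poly (map_poly of_int f) x = (\<Sum>i\<le>n. of_int (c i) * x ^ i)"
  proof -
    have "map_poly of_int f = (\<Sum>i\<le>n. monom (of_int (c i) :: 'a) i)"
      by (rule poly_eqI) (simp add: coeff_map_poly cf coeff_sum)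
    then show ?thesis by (simp add: poly_sum poly_monom)
  qed
  ultimately show ?thesis using algebraic_int_lead_coeff[of f x] that[of "lead_coeff f"] c(2) by auto
qed

text \<open>Every lattice in \<open>K\<close> has at most \<open>n\<close> generators modulo \<open>p\<close>, as \<open>n + 1\<close> elements satisfy a
  primitive integral relation.\<close>

lemma idx_mod_p:
  assumes T: "add_subgroup T" "T \<subseteq> K" and p: "prime p"
  shows "finite (cosets T ((*) (of_nat p) ` T))" "idx T ((*) (of_nat p) ` T) \<le> p ^ n"
proof -
  let ?pT = "(*) (of_nat p) ` T"
  have pT: "add_subgroup ?pT"
    unfolding add_subgroup_def
  proof (intro conjI ballI)
    show "0 \<in> ?pT" using add_subgroupD(1)[OF T(1)] by force
    fix a b assume "a \<in> ?pT" "b \<in> ?pT"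
    then obtain u v where "u \<in> T" "v \<in> T" "a = of_nat p * u" "b = of_nat p * v" by blast
    then show "a - b \<in> ?pT" using add_subgroupD(2)[OF T(1), of u v] by (auto simp flip: right_diff_distrib)
  qed
  \<comment> \<open>Linear independence of z 0, ..., z (m - 1) in T/pT over the field with p
    elements, stated with integer coefficients.\<close>
  define indep where "indep m z \<longleftrightarrow> (\<forall>j<m. z j \<in> T) \<and>
    (\<forall>c :: nat \<Rightarrow> int. (\<Sum>j<m. of_int (c j) * z j) \<in> ?pT \<longrightarrow> (\<forall>j<m. int p dvd c j))" for m and z :: "nat \<Rightarrow> 'a"
  have bound: "m \<le> n" if m: "indep m z" for m z
  proof (rule ccontr)
    assume "\<not> m \<le> n"
    then have nm: "n < m" by simp
    have "z i \<in> K" if "i \<le> n" for i using m nm T(2) that unfolding indep_def by auto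
    then obtain c where c: "\<exists>i\<le>n. \<not> int p dvd c i" "(\<Sum>i\<le>n. of_int (c i) * z i) = 0"
      using primitive_relation[OF _ p] by metis
    define d where "d i = (if i \<le> n then c i else 0)" for i
    have "(\<Sum>j<m. of_int (d j) * z j) = (\<Sum>i\<le>n. of_int (c i) * z i)"
      using nm unfolding d_def by (intro sum.mono_neutral_cong_right) auto
    then have "(\<Sum>j<m. of_int (d j) * z j) \<in> ?pT" using c(2) add_subgroupD(1)[OF pT] by simp
    then have dv: "int p dvd d j" if "j < m" for j using m that unfolding indep_def by blast
    obtain i where "i \<le> n" "\<not> int p dvd c i" using c(1) by blast
    then show False using dv[of i] nm unfolding d_def by simp
  qed
  define M where "M = (GREATEST m. \<exists>z. indep m z)"
  have ex: "\<exists>z. indep 0 z" unfolding indep_def by simp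
  have "\<exists>z. indep M z" unfolding M_def by (rule GreatestI_nat[of "\<lambda>m. \<exists>z. indep m z" 0 n]) (use ex bound in auto)
  then obtain z where z: "indep M z" by blast
  have max: "\<not> indep (Suc M) z'" for z'
  proof
    assume "indep (Suc M) z'"
    then have "Suc M \<le> M" unfolding M_def using bound by (intro Greatest_le_nat[of _ _ n]) blast+
    then show False by simp
  qed
  have zT: "z j \<in> T" if "j < M" for j using z that unfolding indep_def by blast
  let ?S = "\<lambda>b. (+) (\<Sum>j<M. of_int (b j) * z j) ` ?pT"
  have "cosets T ?pT \<subseteq> ?S ` ({..<M} \<rightarrow>\<^sub>E {0..<int p})"
  proof
    fix k assume "k \<in> cosets T ?pT"
    then obtain x where x: "x \<in> T" "k = (+) x ` ?pT" by (rule cosetsE)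
    define z' where "z' = z(M := x)"
    have "\<forall>j<Suc M. z' j \<in> T" using zT x(1) unfolding z'_def by (simp add: less_Suc_eq)
    then obtain c :: "nat \<Rightarrow> int" where c: "(\<Sum>j<Suc M. of_int (c j) * z' j) \<in> ?pT" "\<not> (\<forall>j<Suc M. int p dvd c j)"
      using max[of z'] unfolding indep_def by blast
    have c1: "(\<Sum>j<M. of_int (c j) * z j) + of_int (c M) * x \<in> ?pT" using c(1) unfolding z'_def by simp
    \<comment> \<open>Otherwise the new element drops out modulo p and the family z itself would be
      dependent.\<close>
    have "\<not> int p dvd c M"
    proof
      assume dv: "int p dvd c M"
      then obtain r where "c M = int p * r" by blast
      then have "of_int (c M) * x = of_nat p * (of_int r * x)" by (simp add: mult.assoc)
      then have "of_int (c M) * x \<in> ?pT" using add_subgroup_of_int[OF T(1) x(1)] by blast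
      from add_subgroupD(2)[OF pT c1 this] have "(\<Sum>j<M. of_int (c j) * z j) \<in> ?pT" by simp
      then have "\<forall>j<M. int p dvd c j" using z unfolding indep_def by blast
      then show False using c(2) dv by (metis less_Suc_eq)
    qed
    then have "coprime (int p) (c M)" using p by (intro prime_imp_coprime) auto
    then obtain u v where uv: "u * c M + v * int p = 1" using bezout_int[of "c M" "int p"] by (auto simp: coprime_iff_gcd_eq_1 gcd.commute)
    \<comment> \<open>Here u inverts c M modulo p, so these are the coordinates of x with respect to
      z.\<close>
    define b where "b = (\<lambda>j\<in>{..<M}. (- u * c j) mod int p)"
    have bP: "b \<in> {..<M} \<rightarrow>\<^sub>E {0..<int p}" unfolding b_def using prime_gt_0_nat[OF p] by auto
    have "x - (\<Sum>j<M. of_int (b j) * z j) \<in> ?pT"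
    proof -
      have "of_int u * ((\<Sum>j<M. of_int (c j) * z j) + of_int (c M) * x) \<in> ?pT" by (rule add_subgroup_of_int[OF pT c1])
      moreover have "of_nat p * (of_int v * x) \<in> ?pT" using add_subgroup_of_int[OF T(1) x(1)] by blast
      moreover have "(\<Sum>j<M. of_int (- u * c j - b j) * z j) \<in> ?pT"
      proof (rule add_subgroup_sum[OF pT])
        fix j assume j: "j \<in> {..<M}"
        then have "int p dvd - u * c j - b j" unfolding b_def by (simp add: minus_mod_eq_mult_div)
        then obtain r where "- u * c j - b j = int p * r" by blast
        then have "of_int (- u * c j - b j) * z j = of_nat p * (of_int r * z j)" by (simp add: mult.assoc)
        then show "of_int (- u * c j - b j) * z j \<in> ?pT" using add_subgroup_of_int[OF T(1) zT] j by blast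
      qed
      ultimately have "of_int u * ((\<Sum>j<M. of_int (c j) * z j) + of_int (c M) * x) + of_nat p * (of_int v * x)
          + (\<Sum>j<M. of_int (- u * c j - b j) * z j) \<in> ?pT" using add_subgroupD(4)[OF pT] by blast
      moreover have "of_int u * ((\<Sum>j<M. of_int (c j) * z j) + of_int (c M) * x) + of_nat p * (of_int v * x)
          + (\<Sum>j<M. of_int (- u * c j - b j) * z j) = x - (\<Sum>j<M. of_int (b j) * z j)"
      proof -
        have "of_int u * (of_int (c M) * x) + of_nat p * (of_int v * x) = of_int (u * c M + v * int p) * x"
          by (simp add: algebra_simps)
        then have 1: "of_int u * (of_int (c M) * x) + of_nat p * (of_int v * x) = x" using uv by simp
        have 2: "(\<Sum>j<M. of_int (- u * c j - b j) * z j) =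
            - (of_int u * (\<Sum>j<M. of_int (c j) * z j)) - (\<Sum>j<M. of_int (b j) * z j)"
          by (simp add: sum_subtractf sum_negf sum_distrib_left algebra_simps)
        show ?thesis unfolding 2 distrib_left using 1 by (simp add: algebra_simps)
      qed
      ultimately show ?thesis by simp
    qed
    then have "k = ?S b" unfolding x(2) using coset_eq_iff[OF pT] by blast
    then show "k \<in> ?S ` ({..<M} \<rightarrow>\<^sub>E {0..<int p})" using bP by blast
  qed
  moreover have finP: "finite ({..<M} \<rightarrow>\<^sub>E {0..<int p})" by (intro finite_PiE) auto
  ultimately show "finite (cosets T ?pT)" by (meson finite_imageI finite_subset)
  have "idx T ?pT \<le> card ({..<M} \<rightarrow>\<^sub>E {0..<int p})"
    unfolding idx_def using \<open>cosets T ?pT \<subseteq> _\<close> finP by (meson card_image_le card_mono finite_imageI order_trans)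
  also have "\<dots> = p ^ M" by (simp add: card_PiE)
  also have "\<dots> \<le> p ^ n" using bound[OF z] prime_gt_0_nat[OF p] by (intro power_increasing) auto
  finally show "idx T ?pT \<le> p ^ n" .
qed

end

subsection \<open>The ring of integers is reduced modulo almost all primes\<close>

text \<open>Congruences modulo p in a ring S, which will be an order with explicit generators; for
  these the Frobenius map can be computed.\<close>

locale ring_mod_prime =
  fixes S :: "'a::comm_ring_1 set" and p :: nat
  assumes S_sub: "add_subgroup S" and S_1: "1 \<in> S" and S_mult: "\<And>x y. x \<in> S \<Longrightarrow> y \<in> S \<Longrightarrow> x * y \<in> S"
    and p: "prime p"
begin

abbreviation pS :: "'a set" where "pS \<equiv> (*) (of_nat p) ` S"

definition cg :: "'a \<Rightarrow> 'a \<Rightarrow> bool" where "cg x y \<longleftrightarrow> x - y \<in> pS"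

lemmas S_add = add_subgroupD(4)[OF S_sub]
lemmas S_diff = add_subgroupD(2)[OF S_sub]
lemmas S_0 = add_subgroupD(1)[OF S_sub]
lemmas S_minus = add_subgroupD(3)[OF S_sub]

lemma S_power: "x \<in> S \<Longrightarrow> x ^ i \<in> S"
  by (induction i) (auto intro: S_1 S_mult)

lemma S_of_int: "of_int m \<in> S"
  using add_subgroup_of_int[OF S_sub S_1, of m] by simp

lemma S_of_nat: "of_nat m \<in> S"
  using add_subgroup_of_nat[OF S_sub S_1, of m] by simp

lemma pS_I: "x \<in> S \<Longrightarrow> of_nat p * x \<in> pS"
  by blast

lemma pS_sub: "add_subgroup pS"
  unfolding add_subgroup_def
proof (intro conjI ballI)
  show "0 \<in> pS" using pS_I[OF S_0] by simp
  fix a b assume "a \<in> pS" "b \<in> pS"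
  then obtain u v where uv: "u \<in> S" "v \<in> S" "a = of_nat p * u" "b = of_nat p * v" by blast
  then show "a - b \<in> pS" using pS_I[OF S_diff[OF uv(1,2)]] by (simp add: right_diff_distrib)
qed

lemma pS_mult: "x \<in> pS \<Longrightarrow> y \<in> S \<Longrightarrow> x * y \<in> pS"
proof -
  assume "x \<in> pS" and y: "y \<in> S"
  then obtain u where u: "u \<in> S" "x = of_nat p * u" by blast
  show ?thesis using pS_I[OF S_mult[OF u(1) y]] u(2) by (simp add: mult.assoc)
qed

lemma cg_refl: "cg x x"
  unfolding cg_def using add_subgroupD(1)[OF pS_sub] by simp

lemma cg_sym: "cg x y \<Longrightarrow> cg y x"
  unfolding cg_def using add_subgroupD(3)[OF pS_sub, of "x - y"] by simp

lemma cg_trans: "cg x y \<Longrightarrow> cg y z \<Longrightarrow> cg x z"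
  unfolding cg_def using add_subgroupD(4)[OF pS_sub, of "x - y" "y - z"] by simp

lemma cg_0: "cg x 0 \<longleftrightarrow> x \<in> pS"
  unfolding cg_def by simp

lemma cg_add: "cg x y \<Longrightarrow> cg u v \<Longrightarrow> cg (x + u) (y + v)"
  unfolding cg_def using add_subgroupD(4)[OF pS_sub, of "x - y" "u - v"] by (simp add: algebra_simps)

lemma cg_diff: "cg x y \<Longrightarrow> cg u v \<Longrightarrow> cg (x - u) (y - v)"
  unfolding cg_def using add_subgroupD(2)[OF pS_sub, of "x - y" "u - v"] by (simp add: algebra_simps)

lemma cg_mult:
  assumes "cg x y" "cg u v" "u \<in> S" "y \<in> S"
  shows "cg (x * u) (y * v)"
proof -
  have "(x - y) * u + (u - v) * y \<in> pS"
    using assms unfolding cg_def by (intro add_subgroupD(4)[OF pS_sub] pS_mult)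
  then show ?thesis unfolding cg_def by (simp add: algebra_simps)
qed

lemma cg_power: "cg x y \<Longrightarrow> x \<in> S \<Longrightarrow> y \<in> S \<Longrightarrow> cg (x ^ m) (y ^ m)"
proof (induction m)
  case (Suc m)
  then show ?case using cg_mult[of x y "x ^ m" "y ^ m"] S_power by simp
qed (simp add: cg_refl)

lemma frobenius:
  assumes x: "x \<in> S" and y: "y \<in> S"
  shows "cg ((x + y) ^ p) (x ^ p + y ^ p)"
proof -
  let ?t = "\<lambda>i. of_nat (p choose i) * x ^ i * y ^ (p - i)"
  have p1: "p \<ge> 1" using prime_gt_0_nat[OF p] by simp
  have "(x + y) ^ p = (\<Sum>i\<le>p. ?t i)" by (rule binomial_ring)
  also have "{..p} = insert 0 (insert p {0<..<p})" using p1 by auto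
  also have "(\<Sum>i\<in>\<dots>. ?t i) = ?t 0 + (?t p + (\<Sum>i\<in>{0<..<p}. ?t i))"
    using p1 by (subst sum.insert, simp, simp, subst sum.insert) auto
  finally have e: "(x + y) ^ p - (x ^ p + y ^ p) = (\<Sum>i\<in>{0<..<p}. ?t i)" by simp
  have "(\<Sum>i\<in>{0<..<p}. ?t i) \<in> pS"
  proof (rule add_subgroup_sum[OF pS_sub])
    fix i assume i: "i \<in> {0<..<p}"
    then have "p dvd i * (p choose i)" using times_binomial_minus1_eq[of i p] by simp
    then have "p dvd p choose i" using i p by (auto simp: prime_dvd_mult_iff dest: dvd_imp_le)
    then obtain r where "p choose i = p * r" by blast
    then have "?t i = of_nat p * (of_nat r * x ^ i * y ^ (p - i))" by (simp add: mult.assoc)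
    then show "?t i \<in> pS" using pS_I[OF S_mult[OF S_mult[OF S_of_nat S_power[OF x]] S_power[OF y]]] by simp
  qed
  then show ?thesis unfolding cg_def e .
qed

lemma frobenius_power:
  assumes x: "x \<in> S" and y: "y \<in> S"
  shows "cg ((x + y) ^ (p ^ N)) (x ^ (p ^ N) + y ^ (p ^ N))"
proof (induction N)
  case (Suc N)
  have e: "z ^ (p ^ Suc N) = (z ^ (p ^ N)) ^ p" for z :: 'a by (simp add: power_mult[symmetric] mult.commute)
  have "cg (((x + y) ^ (p ^ N)) ^ p) ((x ^ (p ^ N) + y ^ (p ^ N)) ^ p)"
    using cg_power[OF Suc S_power[OF S_add[OF x y]] S_add[OF S_power[OF x] S_power[OF y]]] .
  from cg_trans[OF this frobenius[OF S_power[OF x] S_power[OF y]]] show ?case unfolding e .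
qed (simp add: cg_refl)

lemma frobenius_diff:
  assumes x: "x \<in> S" and y: "y \<in> S"
  shows "cg ((x - y) ^ (p ^ N)) (x ^ (p ^ N) - y ^ (p ^ N))"
proof -
  have "cg (x ^ (p ^ N)) ((x - y) ^ (p ^ N) + y ^ (p ^ N))"
    using frobenius_power[OF S_diff[OF x y] y, of N] by simp
  from cg_diff[OF cg_sym[OF this] cg_refl[of "y ^ (p ^ N)"]] show ?thesis by simp
qed

lemma fermat: "cg (of_int a ^ (p ^ N)) (of_int a)"
proof -
  have p0: "p ^ N > 0" using prime_gt_0_nat[OF p] by simp
  have nat: "cg (of_nat m ^ (p ^ N)) (of_nat m)" for m
  proof (induction m)
    case 0
    show ?case unfolding of_nat_0 zero_power[OF p0] by (rule cg_refl)
  next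
    case (Suc m)
    have "cg ((1 + of_nat m) ^ (p ^ N)) (1 ^ (p ^ N) + of_nat m ^ (p ^ N))"
      by (rule frobenius_power[OF S_1 S_of_nat])
    moreover have "cg (1 ^ (p ^ N) + of_nat m ^ (p ^ N)) (1 + of_nat m)"
      using cg_add[OF cg_refl[of 1] Suc] by simp
    ultimately show ?case using cg_trans by simp
  qed
  obtain m l where a: "a = int m - int l" by (metis int_diff_cases)
  have "cg ((of_nat m - of_nat l) ^ (p ^ N)) (of_nat m ^ (p ^ N) - of_nat l ^ (p ^ N))"
    by (rule frobenius_diff[OF S_of_nat S_of_nat])
  from cg_trans[OF this cg_diff[OF nat nat]] show ?thesis unfolding a by simp
qed

definition ev :: "int poly \<Rightarrow> 'a \<Rightarrow> 'a" where "ev f x = poly (map_poly of_int f) x"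

lemma ev_pCons: "ev (pCons a f) x = of_int a + x * ev f x"
  unfolding ev_def by (cases "a = 0 \<and> f = 0") (auto simp: map_poly_pCons)

lemma ev_0: "ev 0 x = 0"
  unfolding ev_def by simp

lemma ev_add: "ev (f + g) x = ev f x + ev g x"
proof -
  have "map_poly of_int (f + g) = (map_poly of_int f + map_poly of_int g :: 'a poly)"
    by (rule poly_eqI) (simp add: coeff_map_poly)
  then show ?thesis unfolding ev_def by simp
qed

lemma ev_S: "x \<in> S \<Longrightarrow> ev f x \<in> S"
  by (induction f) (auto simp: ev_0 ev_pCons intro: S_0 S_add S_of_int S_mult)

text \<open>The coefficients of f are integers, which Frobenius fixes modulo p.\<close>

lemma ev_frobenius:
  assumes x: "x \<in> S"
  shows "cg (ev f (x ^ (p ^ N))) (ev f x ^ (p ^ N))"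
proof (induction f)
  case 0
  then show ?case using cg_refl prime_gt_0_nat[OF p] by (simp add: ev_0 power_0_left)
next
  case (pCons a f)
  let ?q = "p ^ N"
  have "cg (of_int a + x ^ ?q * ev f (x ^ ?q)) (of_int a ^ ?q + x ^ ?q * ev f x ^ ?q)"
    by (intro cg_add cg_sym[OF fermat] cg_mult cg_refl pCons.IH ev_S S_power x)
  moreover have "cg (of_int a ^ ?q + (x * ev f x) ^ ?q) ((of_int a + x * ev f x) ^ ?q)"
    by (intro cg_sym[OF frobenius_power] S_of_int S_mult x ev_S)
  ultimately show ?case unfolding ev_pCons power_mult_distrib by (rule cg_trans)
qed

text \<open>Built coefficient by coefficient, the remainder needs no division by 2 and stays in
  S.\<close>

lemma ev_taylor:
  assumes x: "x \<in> S" "d \<in> S"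
  shows "\<exists>h\<in>S. ev f (x + d) = ev f x + d * ev (pderiv f) x + d * d * h"
proof (induction f)
  case 0
  then show ?case using S_0 by (intro bexI[of _ 0]) (simp_all add: ev_0)
next
  case (pCons a f)
  then obtain h where h: "h \<in> S" "ev f (x + d) = ev f x + d * ev (pderiv f) x + d * d * h" by blast
  have "ev (pderiv (pCons a f)) x = ev f x + x * ev (pderiv f) x"
    by (simp add: pderiv_pCons ev_add ev_pCons)
  then have "ev (pCons a f) (x + d) = ev (pCons a f) x + d * ev (pderiv (pCons a f)) x
      + d * d * (ev (pderiv f) x + (x + d) * h)"
    unfolding ev_pCons h(2) by (simp add: algebra_simps)
  moreover have "ev (pderiv f) x + (x + d) * h \<in> S" by (intro S_add S_mult ev_S x h(1))
  ultimately show ?case by blast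
qed

text \<open>Substituting d = d d h into itself makes d a multiple of every power of d modulo
  p.\<close>

lemma nilpotent_multiple:
  assumes d: "d \<in> S" "d ^ m \<in> pS" and h: "h \<in> S" "cg d (d * d * h)"
  shows "d \<in> pS"
proof -
  have "\<exists>w\<in>S. cg d (d ^ Suc j * w)" for j
  proof (induction j)
    case 0
    then show ?case using S_1 cg_refl by (intro bexI[of _ 1]) auto
  next
    case (Suc j)
    then obtain w where w: "w \<in> S" "cg d (d ^ Suc j * w)" by blast
    have "cg (d * (d ^ j * w)) (d * d * h * (d ^ j * w))"
      by (intro cg_mult h cg_refl S_mult S_power d w)
    then have "cg (d ^ Suc j * w) (d ^ Suc (Suc j) * (h * w))" by (simp add: mult_ac)
    from cg_trans[OF w(2) this] have "cg d (d ^ Suc (Suc j) * (h * w))" .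
    then show ?case using S_mult[OF h(1) w(1)] by blast
  qed
  then obtain w where w: "w \<in> S" "cg d (d ^ Suc m * w)" by blast
  have "d ^ m * (d * w) \<in> pS" by (rule pS_mult[OF d(2) S_mult[OF d(1) w(1)]])
  then have "cg (d ^ Suc m * w) 0" unfolding cg_0 by (simp add: mult.assoc mult.left_commute)
  from cg_trans[OF w(2) this] show ?thesis unfolding cg_0 .
qed

text \<open>The difference of \<open>\<omega>\<close> and a Frobenius power of \<open>\<omega>\<close> is nilpotent modulo \<open>p\<close>, and both are roots
  of \<open>f\<close>; as \<open>f'(\<omega>)\<close> is a unit, they agree modulo \<open>p\<close>.\<close>

lemma frobenius_fixes:
  assumes fin: "finite (cosets S pS)" and \<omega>: "\<omega> \<in> S" "ev f \<omega> = 0"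
    and m: "\<mu> \<in> S" "ev (pderiv f) \<omega> * \<mu> = of_int m" "\<not> int p dvd m"
  shows "\<exists>N\<ge>1. cg (\<omega> ^ (p ^ N)) \<omega>"
proof -
  let ?f = "\<lambda>t. (+) (\<omega> ^ (p ^ t)) ` pS"
  have "range ?f \<subseteq> cosets S pS" unfolding cosets_def using S_power[OF \<omega>(1)] by blast
  then have "\<not> inj ?f" using finite_subset[OF _ fin] finite_imageD[of ?f UNIV] by auto
  then obtain s t where st: "s < t" "?f s = ?f t" unfolding inj_def by (metis linorder_neqE_nat)
  then have c: "cg (\<omega> ^ (p ^ t)) (\<omega> ^ (p ^ s))" unfolding cg_def using coset_eq_iff[OF pS_sub] by metis
  define N where "N = t - s"
  \<comment> \<open>The p^s-th power of d is congruent to the difference of the p^t-th and the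
    p^s-th power of \<omega>, hence to 0.\<close>
  define d where "d = \<omega> ^ (p ^ N) - \<omega>"
  have d: "d \<in> S" unfolding d_def by (intro S_diff S_power \<omega>)
  have "cg (d ^ (p ^ s)) ((\<omega> ^ (p ^ N)) ^ (p ^ s) - \<omega> ^ (p ^ s))"
    unfolding d_def by (rule frobenius_diff[OF S_power[OF \<omega>(1)] \<omega>(1)])
  also have "(\<omega> ^ (p ^ N)) ^ (p ^ s) = \<omega> ^ (p ^ t)"
    unfolding N_def using st(1) by (simp flip: power_mult power_add)
  finally have "cg (d ^ (p ^ s)) (\<omega> ^ (p ^ t) - \<omega> ^ (p ^ s))" .
  moreover have "cg (\<omega> ^ (p ^ t) - \<omega> ^ (p ^ s)) 0" using c unfolding cg_0 unfolding cg_def .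
  ultimately have dn: "d ^ (p ^ s) \<in> pS" unfolding cg_0[symmetric] by (rule cg_trans)
  obtain h where h: "h \<in> S" "ev f (\<omega> + d) = ev f \<omega> + d * ev (pderiv f) \<omega> + d * d * h"
    using ev_taylor[OF \<omega>(1) d] by blast
  have "cg (ev f (\<omega> ^ (p ^ N))) (ev f \<omega> ^ (p ^ N))" by (rule ev_frobenius[OF \<omega>(1)])
  \<comment> \<open>\<omega> + d is a Frobenius power of the root \<omega>, hence a root modulo
    p.\<close>
  then have "ev f (\<omega> + d) \<in> pS"
    unfolding \<omega>(2) d_def using prime_gt_0_nat[OF p] by (simp add: zero_power cg_0)
  then have "(d * ev (pderiv f) \<omega> + d * d * h) * \<mu> \<in> pS" using pS_mult[OF _ m(1)] h(2) \<omega>(2) by simp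
  moreover have "(d * ev (pderiv f) \<omega> + d * d * h) * \<mu> = d * of_int m + d * d * (h * \<mu>)"
    unfolding m(2)[symmetric] by (simp add: algebra_simps)
  ultimately have A: "d * of_int m + d * d * (h * \<mu>) \<in> pS" by simp
  have "coprime (int p) m" using p m(3) by (intro prime_imp_coprime) auto
  \<comment> \<open>Inverting m modulo p turns A into a congruence between d and a multiple of d
    d.\<close>
  then obtain u v where uv: "u * m + v * int p = 1"
    using bezout_int[of m "int p"] by (auto simp: coprime_iff_gcd_eq_1 gcd.commute)
  have "(d * of_int m + d * d * (h * \<mu>)) * of_int u + of_nat p * (of_int v * d) \<in> pS"
    using add_subgroupD(4)[OF pS_sub pS_mult[OF A S_of_int] pS_I[OF S_mult[OF S_of_int d]]] .
  moreover have "(d * of_int m + d * d * (h * \<mu>)) * of_int u + of_nat p * (of_int v * d) =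
      of_int (u * m + v * int p) * d + d * d * (h * \<mu> * of_int u)" by (simp add: algebra_simps)
  ultimately have "d + d * d * (h * \<mu> * of_int u) \<in> pS" using uv by simp
  then have "cg d (d * d * (- (h * \<mu> * of_int u)))" unfolding cg_def by simp
  then have "d \<in> pS" by (rule nilpotent_multiple[OF d dn S_minus[OF S_mult[OF S_mult[OF h(1) m(1)] S_of_int]]])
  moreover have "N \<ge> 1" unfolding N_def using st(1) by simp
  ultimately show ?thesis unfolding cg_def d_def by blast
qed

lemma cg_frobenius_iterate:
  assumes x: "x \<in> S" and c: "cg (x ^ (p ^ N)) x"
  shows "cg (x ^ (p ^ (N * k))) x"
proof (induction k)
  case 0
  then show ?case using cg_refl by simp
next
  case (Suc k)
  have "x ^ (p ^ (N * Suc k)) = (x ^ (p ^ (N * k))) ^ (p ^ N)"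
    by (simp add: power_add mult.commute flip: power_mult)
  then have "cg (x ^ (p ^ (N * Suc k))) (x ^ (p ^ N))" using cg_power[OF Suc S_power[OF x] x] by simp
  from cg_trans[OF this c] show ?case .
qed

text \<open>Iterating Frobenius, x is congruent to a power of itself with exponent at least
  m.\<close>

lemma power_in_pS:
  assumes N: "N \<ge> 1" and x: "x \<in> S" "cg (x ^ (p ^ N)) x" "x ^ m \<in> pS"
  shows "x \<in> pS"
proof -
  have "m < p ^ m" using prime_gt_1_nat[OF p] power_gt_expt by simp 
  also have "\<dots> \<le> p ^ (N * m)" using N prime_gt_0_nat[OF p] by (intro power_increasing) auto
  finally have "x ^ (p ^ (N * m)) = x ^ m * x ^ (p ^ (N * m) - m)" by (simp flip: power_add)
  then have "cg 0 (x ^ (p ^ (N * m)))"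
    using cg_sym pS_mult[OF x(3) S_power[OF x(1)]] unfolding cg_0[symmetric] by simp
  from cg_trans[OF this cg_frobenius_iterate[OF x(1,2)]] show ?thesis using cg_sym cg_0 by blast
qed

end

context number_field_ring
begin

definition ints :: "'a set" where "ints = {x \<in> K. algebraic_int x}"

lemma ints_subring: "add_subgroup ints" "1 \<in> ints" "\<And>x y. x \<in> ints \<Longrightarrow> y \<in> ints \<Longrightarrow> x * y \<in> ints"
  unfolding ints_def add_subgroup_def
  using K_closed add_subgroupD[OF K_closed(2)] algebraic_int_closed int_imp_algebraic_int[of 1] by auto

text \<open>The order \<open>\<Lambda>\<close> generated by an integral basis of \<open>K\<close> as a vector space is reduced modulo all
  primes not dividing \<open>m\<close>; at these primes it agrees with the ring of integers.\<close>

lemma reduced_at_almost_all_primes: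
  "\<exists>m::int. m \<noteq> 0 \<and> (\<forall>p. prime p \<and> \<not> int p dvd m \<longrightarrow>
     (\<forall>x\<in>ints. x * x \<in> (*) (of_nat p) ` ints \<longrightarrow> x \<in> (*) (of_nat p) ` ints))"
proof -
  obtain B where B: "finite B" "card B = n" "B \<subseteq> K" "K \<subseteq> rat_space.span B" using basis .
  have "\<exists>m. \<forall>b\<in>B. m b \<noteq> 0 \<and> algebraic_int (of_int (m b :: int) * b)"
    using clear_lead B(3) by (intro bchoice) (metis subset_iff)
  then obtain mb where mb: "\<And>b. b \<in> B \<Longrightarrow> mb b \<noteq> 0 \<and> algebraic_int (of_int (mb b) * b)" by blast
  define \<Omega> where "\<Omega> = (\<lambda>b. of_int (mb b) * b) ` B"
  have \<Omega>: "finite \<Omega>" "\<Omega> \<subseteq> ints"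
    unfolding \<Omega>_def ints_def using B(1,3) mb add_subgroup_of_int[OF K_closed(2)] by auto
  define sr where "sr S \<longleftrightarrow> add_subgroup S \<and> 1 \<in> S \<and> (\<forall>x\<in>S. \<forall>y\<in>S. x * y \<in> S) \<and> \<Omega> \<subseteq> S" for S
  \<comment> \<open>The smallest subring containing \<Omega>; minimality later shows that a property
    stable under the ring operations holds on all of \<Lambda>.\<close>
  define \<Lambda> where "\<Lambda> = \<Inter>{S. sr S}"
  have \<Lambda>sr: "sr \<Lambda>" unfolding \<Lambda>_def sr_def add_subgroup_def by blast
  have \<Lambda>min: "\<Lambda> \<subseteq> S" if "sr S" for S using that unfolding \<Lambda>_def by blast
  have \<Lambda>: "add_subgroup \<Lambda>" "1 \<in> \<Lambda>" "\<And>x y. x \<in> \<Lambda> \<Longrightarrow> y \<in> \<Lambda> \<Longrightarrow> x * y \<in> \<Lambda>" "\<Omega> \<subseteq> \<Lambda>"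
    using \<Lambda>sr unfolding sr_def by auto
  have \<Lambda>O: "\<Lambda> \<subseteq> ints" by (rule \<Lambda>min) (use ints_subring \<Omega> in \<open>auto simp: sr_def\<close>)
  have \<Lambda>K: "\<Lambda> \<subseteq> K" using \<Lambda>O unfolding ints_def by blast
  \<comment> \<open>The elements with a nonzero integer multiple in \<Lambda> form a rational
    subspace containing the basis.\<close>
  have clear: "\<exists>m::int. m \<noteq> 0 \<and> of_int m * x \<in> \<Lambda>" if "x \<in> K" for x
  proof -
    define V where "V = {x. \<exists>m::int. m \<noteq> 0 \<and> of_int m * x \<in> \<Lambda>}"
    have "rat_space.subspace V"
      unfolding rat_space.subspace_def
    proof (intro conjI ballI allI)
      show "0 \<in> V" unfolding V_def using add_subgroupD(1)[OF \<Lambda>(1)] by (auto intro: exI[of _ 1])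
    next
      fix x y assume "x \<in> V" "y \<in> V"
      then obtain k l :: int where kl: "k \<noteq> 0" "of_int k * x \<in> \<Lambda>" "l \<noteq> 0" "of_int l * y \<in> \<Lambda>" unfolding V_def by blast
      have "of_int (k * l) * (x + y) = of_int l * (of_int k * x) + of_int k * (of_int l * y)" by (simp add: algebra_simps)
      also have "\<dots> \<in> \<Lambda>" by (intro add_subgroupD(4)[OF \<Lambda>(1)] add_subgroup_of_int[OF \<Lambda>(1)] kl)
      finally show "x + y \<in> V" unfolding V_def using kl(1,3) by (intro CollectI exI[of _ "k * l"]) simp
    next
      fix q :: rat and x assume "x \<in> V"
      then obtain k :: int where k: "k \<noteq> 0" "of_int k * x \<in> \<Lambda>" unfolding V_def by blast
      obtain a b where ab: "q = of_int a / of_int b" "b \<noteq> 0"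
        by (metis quotient_of_denom_pos' quotient_of_div prod.collapse less_numeral_extra(3))
      have "of_rat q = (of_int a / of_int b :: 'a)" unfolding ab(1) by (simp add: of_rat_divide)
      then have "of_int (k * b) * (of_rat q * x) = of_int a * (of_int k * x)" using ab(2) by simp
      also have "\<dots> \<in> \<Lambda>" by (rule add_subgroup_of_int[OF \<Lambda>(1) k(2)])
      finally show "of_rat q * x \<in> V" unfolding V_def using k(1) ab(2) by (intro CollectI exI[of _ "k * b"]) simp
    qed
    moreover have "B \<subseteq> V" unfolding V_def using mb \<Lambda>(4) unfolding \<Omega>_def by blast
    ultimately have "rat_space.span B \<subseteq> V" by (rule rat_space.span_minimal[rotated])
    then show ?thesis using that B(4) unfolding V_def by blast
  qed
  have "\<exists>m::int. m \<noteq> 0 \<and> (\<exists>f. \<exists>\<mu>\<in>\<Lambda>. poly (map_poly of_int f) \<omega> = 0 \<and>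
      poly (map_poly of_int (pderiv f)) \<omega> * \<mu> = of_int m)" if w: "\<omega> \<in> \<Omega>" for \<omega>
  proof -
    have wK: "\<omega> \<in> K" "algebraic_int \<omega>" using w \<Omega>(2) unfolding ints_def by auto
    let ?P = "\<lambda>d. \<exists>f::int poly. f \<noteq> 0 \<and> degree f = d \<and> poly (map_poly of_int f) \<omega> = 0"
    obtain q :: "int poly" where q: "poly (map_poly of_int q) \<omega> = 0" "lead_coeff q = 1"
      using wK(2) unfolding algebraic_int_altdef_ipoly by blast
    then have "?P (degree q)" by (metis leading_coeff_0_iff zero_neq_one)
    then have "?P (LEAST d. ?P d)" by (rule LeastI[of ?P])
    then obtain f :: "int poly" where f: "f \<noteq> 0" "degree f = (LEAST d. ?P d)" "poly (map_poly of_int f) \<omega> = 0" by blast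
    have deg: "degree f \<noteq> 0"
    proof
      assume "degree f = 0"
      then obtain a where "f = [:a:]" by (metis degree_eq_zeroE)
      then show False using f(1,3) by (simp add: map_poly_pCons)
    qed
    let ?\<eta> = "poly (map_poly of_int (pderiv f)) \<omega>"
    \<comment> \<open>Separability in characteristic 0: f has least degree among the polynomials
      that vanish at \<omega>.\<close>
    have "?\<eta> \<noteq> 0"
    proof
      assume 0: "?\<eta> = 0"
      have "pderiv f \<noteq> 0" using deg by (simp add: pderiv_eq_0_iff)
      then have "?P (degree (pderiv f))" using 0 by blast
      then have "(LEAST d. ?P d) \<le> degree (pderiv f)" by (rule Least_le)
      then show False using f(2) deg degree_pderiv[of f] by simp
    qed
    \<comment> \<open>Interpreted at an arbitrary prime to obtain \<open>ev_S\<close> for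
      \<Lambda>.\<close>
    interpret L0: ring_mod_prime \<Lambda> 2 by unfold_locales (use \<Lambda> in auto)
    have "?\<eta> \<in> \<Lambda>" using L0.ev_S[of \<omega> "pderiv f"] w \<Lambda>(4) unfolding L0.ev_def by blast
    then have "inverse ?\<eta> \<in> K" using K_closed(4) \<Lambda>K by blast
    then obtain m :: int where m: "m \<noteq> 0" "of_int m * inverse ?\<eta> \<in> \<Lambda>" using clear by blast
    have "?\<eta> * (of_int m * inverse ?\<eta>) = of_int m" using \<open>?\<eta> \<noteq> 0\<close> by simp
    then show ?thesis using m f(3) by blast
  qed
  then obtain m\<omega> where m\<omega>: "\<And>\<omega>. \<omega> \<in> \<Omega> \<Longrightarrow> m\<omega> \<omega> \<noteq> (0::int) \<and> (\<exists>f. \<exists>\<mu>\<in>\<Lambda>. poly (map_poly of_int f) \<omega> = 0 \<and>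
      poly (map_poly of_int (pderiv f)) \<omega> * \<mu> = of_int (m\<omega> \<omega>))" by metis
  define m where "m = (\<Prod>\<omega>\<in>\<Omega>. m\<omega> \<omega>)"
  have "m \<noteq> 0" unfolding m_def using \<Omega>(1) m\<omega> by simp
  moreover have "x \<in> (*) (of_nat p) ` ints"
    if p: "prime p" "\<not> int p dvd m" and x: "x \<in> ints" "x * x \<in> (*) (of_nat p) ` ints" for p x
  proof -
    interpret L: ring_mod_prime \<Lambda> p by unfold_locales (use \<Lambda> p(1) in auto)
    have fin: "finite (cosets \<Lambda> L.pS)" by (rule idx_mod_p(1)[OF \<Lambda>(1) \<Lambda>K p(1)])
    have "\<exists>N\<ge>1. L.cg (\<omega> ^ (p ^ N)) \<omega>" if w: "\<omega> \<in> \<Omega>" for \<omega>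
    proof -
      obtain f \<mu> where f: "\<mu> \<in> \<Lambda>" "poly (map_poly of_int f) \<omega> = 0"
        "poly (map_poly of_int (pderiv f)) \<omega> * \<mu> = of_int (m\<omega> \<omega>)" using m\<omega>[OF w] by blast
      have "m\<omega> \<omega> dvd m" unfolding m_def using \<Omega>(1) w by (rule dvd_prodI)
      then have "\<not> int p dvd m\<omega> \<omega>" using p(2) dvd_trans by blast
      then show ?thesis using L.frobenius_fixes[OF fin _ _ f(1)] f(2,3) w \<Lambda>(4) unfolding L.ev_def by blast
    qed
    then obtain N\<omega> where N\<omega>: "\<And>\<omega>. \<omega> \<in> \<Omega> \<Longrightarrow> N\<omega> \<omega> \<ge> 1 \<and> L.cg (\<omega> ^ (p ^ N\<omega> \<omega>)) \<omega>" by metis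
    \<comment> \<open>A common multiple, so that one iterate of Frobenius fixes all generators
      modulo p.\<close>
    define N where "N = (\<Prod>\<omega>\<in>\<Omega>. N\<omega> \<omega>)"
    have N1: "N \<ge> 1" unfolding N_def using N\<omega> by (metis One_nat_def Suc_leI prod_pos Suc_le_lessD)
    have N\<Omega>: "L.cg (\<omega> ^ (p ^ N)) \<omega>" if w: "\<omega> \<in> \<Omega>" for \<omega>
    proof -
      have "N\<omega> \<omega> dvd N" unfolding N_def using \<Omega>(1) w by (rule dvd_prodI)
      then obtain k where "N = N\<omega> \<omega> * k" by blast
      then show ?thesis using L.cg_frobenius_iterate[of \<omega> "N\<omega> \<omega>" k] N\<omega>[OF w] w \<Lambda>(4) by auto
    qed
    \<comment> \<open>The elements fixed by this iterate form a subring containing \<Omega>, hence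
      all of \<Lambda>; so \<Lambda>/p is reduced.\<close>
    define F where "F = {x\<in>\<Lambda>. L.cg (x ^ (p ^ N)) x}"
    have "sr F"
      unfolding sr_def
    proof (intro conjI ballI)
      show "add_subgroup F"
        unfolding add_subgroup_def
      proof (intro conjI ballI)
        show "0 \<in> F" unfolding F_def using L.S_0 L.cg_refl[of 0] prime_gt_0_nat[OF p(1)] by (simp add: power_0_left)
        fix a b assume ab: "a \<in> F" "b \<in> F"
        then have "L.cg ((a - b) ^ (p ^ N)) (a - b)"
          using L.cg_trans[OF L.frobenius_diff L.cg_diff] unfolding F_def by blast
        then show "a - b \<in> F" using ab L.S_diff unfolding F_def by blast
      qed
      show "1 \<in> F" unfolding F_def using L.cg_refl \<Lambda>(2) by simp
      show "a * b \<in> F" if ab: "a \<in> F" "b \<in> F" for a b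
        using L.cg_mult[of "a ^ (p ^ N)" a "b ^ (p ^ N)" b] ab \<Lambda>(3) L.S_power unfolding F_def by (simp add: power_mult_distrib)
      show "\<Omega> \<subseteq> F" unfolding F_def using N\<Omega> \<Lambda>(4) by blast
    qed
    then have all: "L.cg (y ^ (p ^ N)) y" if "y \<in> \<Lambda>" for y using \<Lambda>min that unfolding F_def by blast
    have red: "y \<in> L.pS" if "y \<in> \<Lambda>" "y ^ j \<in> L.pS" for y j
      using L.power_in_pS[OF N1 that(1) all[OF that(1)] that(2)] .
    have p0: "(of_nat p :: 'a) \<noteq> 0" using prime_gt_0_nat[OF p(1)] by simp
    \<comment> \<open>The monic equation of z of degree d, multiplied by p^d, puts (p z)^d into
      p\<Lambda>; by reducedness p z is in p\<Lambda>.\<close>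
    have div: "z \<in> \<Lambda>" if z: "z \<in> ints" "of_nat p * z \<in> \<Lambda>" for z
    proof -
      obtain d b where d: "d > 0" "z ^ d = (\<Sum>i<d. of_int (b i) * z ^ i)"
        using monic_relation z(1) unfolding ints_def by blast
      have "(of_nat p * z) ^ d = (\<Sum>i<d. of_nat p * (of_int (b i) * of_nat p ^ (d - 1 - i) * (of_nat p * z) ^ i))"
        unfolding power_mult_distrib d(2) sum_distrib_left
      proof (rule sum.cong[OF refl])
        fix i assume "i \<in> {..<d}"
        then have "d = Suc ((d - 1 - i) + i)" by simp
        then have "(of_nat p :: 'a) ^ d = of_nat p * (of_nat p ^ (d - 1 - i) * of_nat p ^ i)" by (metis power_Suc power_add)
        then show "of_nat p ^ d * (of_int (b i) * z ^ i) =
            of_nat p * (of_int (b i) * of_nat p ^ (d - 1 - i) * (of_nat p ^ i * z ^ i))" by (simp add: mult_ac)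
      qed
      also have "\<dots> \<in> L.pS"
        by (intro add_subgroup_sum[OF L.pS_sub] L.pS_I L.S_mult L.S_of_int L.S_power L.S_of_nat z(2))
      finally have "of_nat p * z \<in> L.pS" by (rule red[OF z(2)])
      then show ?thesis using p0 by auto
    qed
    obtain k :: int where k: "k \<noteq> 0" "of_int k * x \<in> \<Lambda>" using clear x(1) unfolding ints_def by blast
    \<comment> \<open>By \<open>div\<close>, factors p of k can be cancelled one after
      another.\<close>
    have "\<exists>k::int. \<not> int p dvd k \<and> of_int k * x \<in> \<Lambda>"
      using k
    proof (induction "nat \<bar>k\<bar>" arbitrary: k rule: less_induct)
      case less
      show ?case
      proof (cases "int p dvd k")
        case True
        then obtain l where l: "k = int p * l" by blast
        have "of_int l * x \<in> ints" using add_subgroup_of_int[OF ints_subring(1) x(1)] .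
        moreover have "of_nat p * (of_int l * x) \<in> \<Lambda>" using less.prems(2) unfolding l by (simp add: mult.assoc)
        ultimately have "of_int l * x \<in> \<Lambda>" by (rule div)
        moreover have "l \<noteq> 0" using less.prems(1) l by simp
        moreover have "nat \<bar>l\<bar> < nat \<bar>k\<bar>"
          using \<open>l \<noteq> 0\<close> prime_gt_1_nat[OF p(1)] unfolding l by (simp add: abs_mult nat_mult_distrib)
        ultimately show ?thesis using less.hyps[of l] by blast
      qed (use less.prems in blast)
    qed
    then obtain l :: int where l: "\<not> int p dvd l" "of_int l * x \<in> \<Lambda>" by blast
    obtain y where y: "y \<in> ints" "x * x = of_nat p * y" using x(2) by blast
    have "of_int l * of_int l * y \<in> ints"
      using add_subgroup_of_int[OF ints_subring(1) y(1), of "l * l"] by simp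
    moreover have sq: "of_nat p * (of_int l * of_int l * y) = (of_int l * x) * (of_int l * x)"
      using y(2) by (simp add: mult_ac)
    ultimately have "of_int l * of_int l * y \<in> \<Lambda>" using div \<Lambda>(3)[OF l(2,2)] by metis
    then have "(of_int l * x) ^ 2 \<in> L.pS" using L.pS_I sq by (metis power2_eq_square)
    then have "of_int l * x \<in> L.pS" by (rule red[OF l(2)])
    then obtain z where z: "z \<in> \<Lambda>" "of_int l * x = of_nat p * z" by blast
    have "coprime (int p) l" using p(1) l(1) by (intro prime_imp_coprime) auto
    then obtain u v where uv: "u * l + v * int p = 1"
      using bezout_int[of l "int p"] by (auto simp: coprime_iff_gcd_eq_1 gcd.commute)
    have "x = of_int (u * l + v * int p) * x" using uv by simp
    also have "\<dots> = of_int u * (of_int l * x) + of_nat p * (of_int v * x)" by (simp add: algebra_simps)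
    also have "\<dots> = of_nat p * (of_int u * z + of_int v * x)" unfolding z(2) by (simp add: algebra_simps)
    finally have "x = of_nat p * (of_int u * z + of_int v * x)" .
    moreover have "of_int u * z + of_int v * x \<in> ints"
      using z(1) \<Lambda>O x(1) by (intro add_subgroupD(4)[OF ints_subring(1)] add_subgroup_of_int[OF ints_subring(1)]) auto
    ultimately show ?thesis by blast
  qed
  ultimately show ?thesis by blast
qed

lemma prime_reduced_ints:
  obtains m :: int where "m \<noteq> 0" "\<And>p. prime p \<Longrightarrow> \<not> int p dvd m \<Longrightarrow> prime_reduced ints p n"
proof -
  obtain m :: int where m: "m \<noteq> 0" "\<forall>p. prime p \<and> \<not> int p dvd m \<longrightarrow>
     (\<forall>x\<in>ints. x * x \<in> (*) (of_nat p) ` ints \<longrightarrow> x \<in> (*) (of_nat p) ` ints)"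
    using reduced_at_almost_all_primes by blast
  have K: "ints \<subseteq> K" unfolding ints_def by blast
  have "prime_reduced ints p n" if "prime p" "\<not> int p dvd m" for p
  proof
    show "x \<in> (*) (of_nat p) ` ints" if "x \<in> ints" "x * x \<in> (*) (of_nat p) ` ints" for x
      using m(2) \<open>prime p\<close> \<open>\<not> int p dvd m\<close> that by blast
  qed (use ints_subring idx_mod_p[OF ints_subring(1) K that(1)] that(1) in blast)+
  then show ?thesis using that m(1) by blast
qed

end

section \<open>Subrings of \<open>\<O>\<^sub>K \<otimes> \<int>\<^sub>p\<close> and of \<open>\<O>\<^sub>K\<close>\<close>

text \<open>Lagrange: translation by \<open>x\<close> permutes the cosets, so the sum of a system of representatives
  changes by an element of \<open>H\<close>.\<close>

lemma frag_cmul_idx_mem: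
  fixes H T :: "('b \<Rightarrow>\<^sub>0 int) set"
  assumes H: "add_subgroup H" and T: "add_subgroup T" and x: "x \<in> T"
  shows "frag_cmul (int (idx T H)) x \<in> H"
proof (cases "finite (cosets T H)")
  case False
  then show ?thesis unfolding idx_def using add_subgroupD(1)[OF H] by simp
next
  case fin: True
  define r where "r c = (SOME y. y \<in> c)" for c :: "('b \<Rightarrow>\<^sub>0 int) set"
  let ?f = "\<lambda>c. (+) x ` c"
  have f: "?f ((+) y ` H) = (+) (x + y) ` H" for y by (simp add: image_image add.assoc)
  have r: "r ((+) y ` H) - y \<in> H" for y
  proof -
    have "y \<in> (+) y ` H" using add_subgroupD(1)[OF H] by force
    then have "r ((+) y ` H) \<in> (+) y ` H" unfolding r_def by (rule someI)
    then show ?thesis by auto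
  qed
  have inj: "inj_on ?f (cosets T H)" by (rule inj_onI) (simp add: inj_image_eq_iff)
  have sub: "?f ` cosets T H \<subseteq> cosets T H"
    unfolding cosets_def using f add_subgroupD(4)[OF T x] by (auto simp del: image_image)
  have "?f ` cosets T H = cosets T H" using endo_inj_surj[OF fin sub inj] .
  then have "sum r (cosets T H) = (\<Sum>c\<in>cosets T H. r (?f c))" using sum.reindex[OF inj, of r] by simp
  then have "(\<Sum>c\<in>cosets T H. r (?f c) - r c) = 0" by (simp add: sum_subtractf)
  moreover have "r (?f c) - r c - x \<in> H" if c: "c \<in> cosets T H" for c
  proof -
    obtain y where y: "c = (+) y ` H" using c unfolding cosets_def by blast
    have "r (?f c) - (x + y) - (r c - y) \<in> H" unfolding y f by (rule add_subgroupD(2)[OF H r r])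
    then show ?thesis by (simp add: algebra_simps)
  qed
  then have "(\<Sum>c\<in>cosets T H. r (?f c) - r c - x) \<in> H" by (rule add_subgroup_sum[OF H])
  ultimately have "- (\<Sum>c\<in>cosets T H. x) \<in> H" by (simp add: sum_subtractf)
  moreover have "(\<Sum>c\<in>C. x) = frag_cmul (int (card C)) x" if "finite C" for C :: "('b \<Rightarrow>\<^sub>0 int) set set"
    using that by (induction C) (auto simp: frag_cmul_distrib)
  ultimately show ?thesis using fin add_subgroupD(3)[OF H] unfolding idx_def by (metis add.inverse_inverse)
qed

text \<open>The tensor product is handled as a set of cosets of the kernel G in the free group F.
  That products are again cosets is taken from the hypothesis that L is a subring.\<close>

locale tensor_pair =
  fixes A :: "('a, 'm) ring_scheme" and B :: "('b, 'n) ring_scheme"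
  assumes addA: "\<And>x y. x \<in> carrier A \<Longrightarrow> y \<in> carrier A \<Longrightarrow> x \<oplus>\<^bsub>A\<^esub> y \<in> carrier A"
    and addB: "\<And>x y. x \<in> carrier B \<Longrightarrow> y \<in> carrier B \<Longrightarrow> x \<oplus>\<^bsub>B\<^esub> y \<in> carrier B"
    and oneA: "\<one>\<^bsub>A\<^esub> \<in> carrier A" and oneB: "\<one>\<^bsub>B\<^esub> \<in> carrier B"
begin

abbreviation F :: "('a \<times> 'b \<Rightarrow>\<^sub>0 int) set" where "F \<equiv> {c. Poly_Mapping.keys c \<subseteq> carrier A \<times> carrier B}"
abbreviation G :: "('a \<times> 'b \<Rightarrow>\<^sub>0 int) set" where "G \<equiv> tensor_kernel A B"
abbreviation M where "M \<equiv> tensor_algebra A B"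
definition q :: "('a \<times> 'b \<Rightarrow>\<^sub>0 int) \<Rightarrow> ('a \<times> 'b \<Rightarrow>\<^sub>0 int) set" where "q x = (+) x ` G"

lemma F_sub: "add_subgroup F"
  unfolding add_subgroup_def using keys_diff by fastforce

lemma frag_of_F: "a \<in> carrier A \<Longrightarrow> b \<in> carrier B \<Longrightarrow> frag_of (a, b) \<in> F"
  by simp

lemma relations_F: "biadditivity_relations A B \<subseteq> F"
  unfolding biadditivity_relations_def
proof safe
  fix a a' b x y
  assume ab: "a \<in> carrier A" "a' \<in> carrier A" "b \<in> carrier B"
    and xy: "(x, y) \<in> Poly_Mapping.keys (frag_of (a \<oplus>\<^bsub>A\<^esub> a', b) - frag_of (a, b) - frag_of (a', b))"
  have "frag_of (a \<oplus>\<^bsub>A\<^esub> a', b) - frag_of (a, b) - frag_of (a', b) \<in> F"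
    by (intro add_subgroupD(2)[OF F_sub] frag_of_F addA ab)
  then show "x \<in> carrier A" "y \<in> carrier B" using xy by auto
next
  fix a b b' x y
  assume ab: "a \<in> carrier A" "b \<in> carrier B" "b' \<in> carrier B"
    and xy: "(x, y) \<in> Poly_Mapping.keys (frag_of (a, b \<oplus>\<^bsub>B\<^esub> b') - frag_of (a, b) - frag_of (a, b'))"
  have "frag_of (a, b \<oplus>\<^bsub>B\<^esub> b') - frag_of (a, b) - frag_of (a, b') \<in> F"
    by (intro add_subgroupD(2)[OF F_sub] frag_of_F addB ab)
  then show "x \<in> carrier A" "y \<in> carrier B" using xy by auto
qed

lemma G_sub: "add_subgroup G" and G_F: "G \<subseteq> F"
proof -
  let ?G = "free_Abelian_group (carrier A \<times> carrier B)"
  have c: "carrier ?G = F" by (simp add: free_Abelian_group_def)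
  have s: "subgroup G ?G"
    unfolding tensor_kernel_def using relations_F c
    by (intro group.generate_is_subgroup group_free_Abelian_group) simp
  show GF: "G \<subseteq> F" using subgroup.subset[OF s] c by simp
  have m: "x + y \<in> G" if "x \<in> G" "y \<in> G" for x y
    using subgroup.m_closed[OF s that] by (simp add: free_Abelian_group_def)
  have i: "- x \<in> G" if "x \<in> G" for x
    using subgroup.m_inv_closed[OF s that] that GF by (auto simp: subset_iff)
  have "0 \<in> G" using subgroup.one_closed[OF s] by (simp add: free_Abelian_group_def)
  moreover have "x - y \<in> G" if "x \<in> G" "y \<in> G" for x y using m[OF that(1) i[OF that(2)]] by simp
  ultimately show "add_subgroup G" unfolding add_subgroup_def by blast
qed

lemma rel_left:
  "a \<in> carrier A \<Longrightarrow> a' \<in> carrier A \<Longrightarrow> b \<in> carrier B \<Longrightarrow>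
   frag_of (a \<oplus>\<^bsub>A\<^esub> a', b) - frag_of (a, b) - frag_of (a', b) \<in> G"
  unfolding tensor_kernel_def biadditivity_relations_def by (rule generate.incl) blast

lemma rel_right:
  "a \<in> carrier A \<Longrightarrow> b \<in> carrier B \<Longrightarrow> b' \<in> carrier B \<Longrightarrow>
   frag_of (a, b \<oplus>\<^bsub>B\<^esub> b') - frag_of (a, b) - frag_of (a, b') \<in> G"
  unfolding tensor_kernel_def biadditivity_relations_def by (rule generate.incl) blast

lemma q_eq: "q x = q y \<longleftrightarrow> x - y \<in> G"
  unfolding q_def by (rule coset_eq_iff[OF G_sub])

lemma q_self: "x \<in> q x"
  unfolding q_def using add_subgroupD(1)[OF G_sub] by force

lemma pair_coset: "G +>\<^bsub>pair_ring A B\<^esub> x = q x"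
  unfolding a_r_coset_def r_coset_def q_def by (auto simp: pair_ring_def add.commute)

lemma carrier_M: "carrier M = q ` F"
proof -
  have "carrier M = {G +>\<^bsub>pair_ring A B\<^esub> x | x. x \<in> carrier (pair_ring A B)}"
    by (simp add: tensor_algebra_def tensor_ring_def ring.defs FactRing_def A_RCOSETS_def RCOSETS_def a_r_coset_def) blast
  then show ?thesis unfolding pair_coset by (auto simp: pair_ring_def free_Abelian_group_def)
qed

lemma zero_M: "zero M = q 0"
  by (simp add: q_def tensor_algebra_def tensor_ring_def ring.defs FactRing_def)

lemma one_M: "one M = q (frag_of (\<one>\<^bsub>A\<^esub>, \<one>\<^bsub>B\<^esub>))"
proof -
  have "one M = G +>\<^bsub>pair_ring A B\<^esub> one (pair_ring A B)"
    by (simp add: tensor_algebra_def tensor_ring_def ring.defs FactRing_def)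
  then show ?thesis unfolding pair_coset by (simp add: pair_ring_def)
qed

lemma add_M: "q x \<oplus>\<^bsub>M\<^esub> q y = q (x + y)"
proof -
  have "q x \<oplus>\<^bsub>M\<^esub> q y = (\<Union>a\<in>q x. \<Union>b\<in>q y. {a + b})"
    by (simp add: tensor_algebra_def tensor_ring_def ring.defs FactRing_def set_add_def set_mult_def pair_ring_def)
  also have "\<dots> = q (x + y)"
  proof (intro equalityI subsetI)
    fix z assume "z \<in> (\<Union>a\<in>q x. \<Union>b\<in>q y. {a + b})"
    then obtain g h where gh: "g \<in> G" "h \<in> G" "z = x + g + (y + h)" unfolding q_def by auto
    have "z = x + y + (g + h)" unfolding gh(3) by (simp add: algebra_simps)
    then show "z \<in> q (x + y)" unfolding q_def using add_subgroupD(4)[OF G_sub gh(1,2)] by blast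
  next
    fix z assume "z \<in> q (x + y)"
    then obtain g where g: "g \<in> G" "z = x + y + g" unfolding q_def by auto
    then have "z = (x + 0) + (y + g)" by (simp add: algebra_simps)
    then show "z \<in> (\<Union>a\<in>q x. \<Union>b\<in>q y. {a + b})" using g(1) add_subgroupD(1)[OF G_sub] unfolding q_def by blast
  qed
  finally show ?thesis .
qed

text \<open>The product of two cosets is defined as a union over all representatives; an inclusion
  from the chosen representatives is what \<open>lift_mult\<close> builds on.\<close>

lemma mult_M: "q (frag_of (a \<otimes>\<^bsub>A\<^esub> a', b \<otimes>\<^bsub>B\<^esub> b')) \<subseteq> q (frag_of (a, b)) \<otimes>\<^bsub>M\<^esub> q (frag_of (a', b'))"
proof -
  have "q (frag_of (a, b)) \<otimes>\<^bsub>M\<^esub> q (frag_of (a', b')) =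
      (\<Union>x\<in>q (frag_of (a, b)). \<Union>y\<in>q (frag_of (a', b')). q (x \<otimes>\<^bsub>pair_ring A B\<^esub> y))"
    by (simp add: tensor_algebra_def tensor_ring_def ring.defs FactRing_def rcoset_mult_def pair_coset)
  also have "q (frag_of (a, b) \<otimes>\<^bsub>pair_ring A B\<^esub> frag_of (a', b')) \<subseteq> \<dots>"
    by (rule subset_trans[OF UN_upper[OF q_self] UN_upper[OF q_self]])
  also have "frag_of (a, b) \<otimes>\<^bsub>pair_ring A B\<^esub> frag_of (a', b') = frag_of (a \<otimes>\<^bsub>A\<^esub> a', b \<otimes>\<^bsub>B\<^esub> b')"
    by (simp add: pair_ring_def)
  finally show ?thesis .
qed

text \<open>The inverse is a definite description, so uniqueness is checked as well.\<close>

lemma inv_M: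
  assumes "x \<in> F"
  shows "inv\<^bsub>add_monoid M\<^esub> (q x) = q (- x)"
  unfolding m_inv_def
proof (rule the_equality)
  have "q (- x) \<in> carrier M" unfolding carrier_M using add_subgroupD(3)[OF F_sub assms] by blast
  then show "q (- x) \<in> carrier (add_monoid M) \<and> q x \<otimes>\<^bsub>add_monoid M\<^esub> q (- x) = \<one>\<^bsub>add_monoid M\<^esub> \<and>
      q (- x) \<otimes>\<^bsub>add_monoid M\<^esub> q x = \<one>\<^bsub>add_monoid M\<^esub>"
    by (simp add: add_M zero_M)
next
  fix y assume y: "y \<in> carrier (add_monoid M) \<and> q x \<otimes>\<^bsub>add_monoid M\<^esub> y = \<one>\<^bsub>add_monoid M\<^esub> \<and>
      y \<otimes>\<^bsub>add_monoid M\<^esub> q x = \<one>\<^bsub>add_monoid M\<^esub>"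
  then have "y \<in> carrier M" by simp
  then obtain u where u: "y = q u" unfolding carrier_M by blast
  have "q x \<oplus>\<^bsub>M\<^esub> y = zero M" using y by simp
  then have "u - (- x) \<in> G" unfolding u add_M zero_M q_eq by (simp add: algebra_simps)
  then show "y = q (- x)" unfolding u q_eq .
qed

definition lift :: "('a \<times> 'b \<Rightarrow>\<^sub>0 int) set set \<Rightarrow> ('a \<times> 'b \<Rightarrow>\<^sub>0 int) set" where
  "lift L = {x \<in> F. q x \<in> L}"

context
  fixes L
  assumes L: "subring L M"
begin

lemma L_carrier: "L \<subseteq> carrier M"
  using subgroup.subset[OF subring.axioms(1)[OF L]] by simp

lemma q_lift: "q ` lift L = L"
  using L_carrier unfolding carrier_M lift_def by blast

lemma lift_sub: "add_subgroup (lift L)"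
  unfolding add_subgroup_def
proof (intro conjI ballI)
  note S = subring.axioms(1)[OF L]
  show "0 \<in> lift L" using subgroup.one_closed[OF S] add_subgroupD(1)[OF F_sub] unfolding lift_def by (simp add: zero_M)
  fix x y assume xy: "x \<in> lift L" "y \<in> lift L"
  then have F: "x \<in> F" "y \<in> F" and q: "q x \<in> L" "q y \<in> L" unfolding lift_def by auto
  have "q (- y) \<in> L" using subgroup.m_inv_closed[OF S q(2)] unfolding inv_M[OF F(2)] .
  from subgroup.m_closed[OF S q(1) this] have "q (x + - y) \<in> L" by (simp add: add_M)
  then show "x - y \<in> lift L" using add_subgroupD(2)[OF F_sub F] unfolding lift_def by simp
qed

lemma G_lift: "G \<subseteq> lift L"
proof
  fix x assume x: "x \<in> G"
  then have "q x = q 0" unfolding q_eq by simp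
  moreover have "q 0 \<in> L" using add_subgroupD(1)[OF lift_sub] unfolding lift_def by blast
  ultimately show "x \<in> lift L" using x G_F unfolding lift_def by auto
qed

lemma lift_F: "lift L \<subseteq> F"
  unfolding lift_def by blast

lemma lift_one: "frag_of (\<one>\<^bsub>A\<^esub>, \<one>\<^bsub>B\<^esub>) \<in> lift L"
  using submonoid.one_closed[OF subring.axioms(2)[OF L]] frag_of_F[OF oneA oneB] unfolding lift_def one_M by blast

text \<open>The product of two members of \<open>L\<close> is a single coset by assumption, and it contains the coset of the product of the representatives.\<close>

lemma lift_mult:
  assumes "frag_of (a, b) \<in> lift L" "frag_of (a', b') \<in> lift L"
    and "a \<otimes>\<^bsub>A\<^esub> a' \<in> carrier A" "b \<otimes>\<^bsub>B\<^esub> b' \<in> carrier B"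
  shows "frag_of (a \<otimes>\<^bsub>A\<^esub> a', b \<otimes>\<^bsub>B\<^esub> b') \<in> lift L"
proof -
  let ?m = "frag_of (a \<otimes>\<^bsub>A\<^esub> a', b \<otimes>\<^bsub>B\<^esub> b')"
  have m: "q (frag_of (a, b)) \<otimes>\<^bsub>M\<^esub> q (frag_of (a', b')) \<in> L"
    using submonoid.m_closed[OF subring.axioms(2)[OF L]] assms(1,2) unfolding lift_def by blast
  then obtain u where u: "q (frag_of (a, b)) \<otimes>\<^bsub>M\<^esub> q (frag_of (a', b')) = q u" using L_carrier unfolding carrier_M by blast
  have "?m \<in> q ?m" by (rule q_self)
  then have "?m \<in> q u" using mult_M unfolding u[symmetric] by blast
  then have "q ?m = q u" unfolding q_eq unfolding q_def by auto
  then show ?thesis using m u frag_of_F[OF assms(3,4)] unfolding lift_def by auto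
qed

text \<open>The lift contains G, so q maps its cosets bijectively to those of L, also when there are
  infinitely many.\<close>

lemma additive_index_lift: "additive_index M L = idx F (lift L)"
proof -
  have r: "L #>\<^bsub>add_monoid M\<^esub> q x = q ` (+) x ` lift L" for x
  proof -
    have "L #>\<^bsub>add_monoid M\<^esub> q x = (\<lambda>y. y \<oplus>\<^bsub>M\<^esub> q x) ` q ` lift L" unfolding r_coset_def q_lift by auto
    also have "\<dots> = (\<lambda>y. q y \<oplus>\<^bsub>M\<^esub> q x) ` lift L" by (rule image_image)
    also have "\<dots> = (\<lambda>y. q (x + y)) ` lift L" unfolding add_M by (simp add: add.commute)
    also have "\<dots> = q ` (+) x ` lift L" by (rule image_image[symmetric])
    finally show ?thesis .
  qed
  have "rcosets\<^bsub>add_monoid M\<^esub> L = (\<lambda>X. L #>\<^bsub>add_monoid M\<^esub> X) ` q ` F"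
    unfolding RCOSETS_def by (auto simp: carrier_M)
  also have "\<dots> = (\<lambda>x. L #>\<^bsub>add_monoid M\<^esub> q x) ` F" by (rule image_image)
  also have "\<dots> = (\<lambda>x. q ` (+) x ` lift L) ` F" unfolding r ..
  also have "\<dots> = (`) q ` cosets F (lift L)" unfolding cosets_def by (rule image_image[symmetric])
  finally have e: "rcosets\<^bsub>add_monoid M\<^esub> L = (`) q ` cosets F (lift L)" .
  have "inj_on ((`) q) (cosets F (lift L))"
  proof (rule inj_onI)
    fix c d assume c: "c \<in> cosets F (lift L)" and d: "d \<in> cosets F (lift L)" and cd: "q ` c = q ` d"
    obtain x where x: "c = (+) x ` lift L" using c unfolding cosets_def by blast
    obtain y where y: "d = (+) y ` lift L" using d unfolding cosets_def by blast
    have "x \<in> c" unfolding x using add_subgroupD(1)[OF lift_sub] by force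
    then have "q x \<in> q ` d" unfolding cd[symmetric] by (rule imageI)
    then obtain l where l: "l \<in> lift L" "q x = q (y + l)" unfolding y by auto
    have "x - (y + l) \<in> lift L" using l(2) G_lift unfolding q_eq by blast
    from add_subgroupD(4)[OF lift_sub this l(1)] have "x - y \<in> lift L" by simp
    then show "c = d" unfolding x y coset_eq_iff[OF lift_sub] .
  qed
  then show ?thesis unfolding additive_index_def idx_def e by (rule card_image)
qed

end

end

section \<open>Integers approximate p-adic integers\<close>

lemma padic_memD:
  assumes "z \<in> carrier (padic_integers p)"
  shows "z k \<ge> 0" "z k < int p ^ k" "z (Suc k) mod int p ^ k = z k"
  using assms unfolding padic_integers_def by auto

lemma padic_memI:
  "(\<And>k. 0 \<le> z k \<and> z k < int p ^ k \<and> z (Suc k) mod int p ^ k = z k) \<Longrightarrow> z \<in> carrier (padic_integers p)"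
  unfolding padic_integers_def by auto

lemma padic_mod:
  assumes z: "z \<in> carrier (padic_integers p)"
  shows "z (k + l) mod int p ^ k = z k"
proof (induction l)
  case 0
  then show ?case using padic_memD[OF z, of k] by simp
next
  case (Suc l)
  have "int p ^ k dvd int p ^ (k + l)" by (simp add: le_imp_power_dvd)
  then have "z (k + Suc l) mod int p ^ k = z (Suc (k + l)) mod int p ^ (k + l) mod int p ^ k"
    by (simp add: mod_mod_cancel)
  then show ?case using Suc padic_memD(3)[OF z, of "k + l"] by simp
qed

definition padic_scale :: "nat \<Rightarrow> nat \<Rightarrow> (nat \<Rightarrow> int) \<Rightarrow> nat \<Rightarrow> int" where
  "padic_scale p t z = (\<lambda>k. (int t * z k) mod int p ^ k)"

lemma padic_closed:
  assumes p: "p > 0"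
  shows "\<And>x y. x \<in> carrier (padic_integers p) \<Longrightarrow> y \<in> carrier (padic_integers p) \<Longrightarrow>
      x \<oplus>\<^bsub>padic_integers p\<^esub> y \<in> carrier (padic_integers p)"
    and "\<one>\<^bsub>padic_integers p\<^esub> \<in> carrier (padic_integers p)"
    and "\<And>x. x \<in> carrier (padic_integers p) \<Longrightarrow> padic_scale p t x \<in> carrier (padic_integers p)"
proof -
  have red: "w mod int p ^ Suc k mod int p ^ k = w mod int p ^ k" for w k
    by (rule mod_mod_cancel) simp
  have pos: "0 \<le> w mod int p ^ k" "w mod int p ^ k < int p ^ k" for w k using p by simp_all
  show "x \<oplus>\<^bsub>padic_integers p\<^esub> y \<in> carrier (padic_integers p)"
    if x: "x \<in> carrier (padic_integers p)" and y: "y \<in> carrier (padic_integers p)" for x y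
  proof (rule padic_memI)
    fix k
    have "(x (Suc k) + y (Suc k)) mod int p ^ k = (x k + y k) mod int p ^ k"
      using padic_memD(3)[OF x, of k] padic_memD(3)[OF y, of k] by (metis mod_add_eq)
    then show "0 \<le> (x \<oplus>\<^bsub>padic_integers p\<^esub> y) k \<and> (x \<oplus>\<^bsub>padic_integers p\<^esub> y) k < int p ^ k \<and>
        (x \<oplus>\<^bsub>padic_integers p\<^esub> y) (Suc k) mod int p ^ k = (x \<oplus>\<^bsub>padic_integers p\<^esub> y) k"
      using pos by (simp add: padic_integers_def red del: power_Suc)
  qed
  show "\<one>\<^bsub>padic_integers p\<^esub> \<in> carrier (padic_integers p)"
    by (rule padic_memI) (use pos in \<open>simp add: padic_integers_def red del: power_Suc\<close>)
  show "padic_scale p t x \<in> carrier (padic_integers p)" if x: "x \<in> carrier (padic_integers p)" for x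
  proof (rule padic_memI)
    fix k
    have "(int t * x (Suc k)) mod int p ^ k = (int t * x k) mod int p ^ k"
      using padic_memD(3)[OF x, of k] by (metis mod_mult_right_eq)
    then show "0 \<le> padic_scale p t x k \<and> padic_scale p t x k < int p ^ k \<and>
        padic_scale p t x (Suc k) mod int p ^ k = padic_scale p t x k"
      using pos by (simp add: padic_scale_def red del: power_Suc)
  qed
qed

lemma padic_scale_Suc: "padic_scale p (Suc t) z = padic_scale p t z \<oplus>\<^bsub>padic_integers p\<^esub> z"
  unfolding padic_scale_def padic_integers_def by (simp add: fun_eq_iff mod_add_right_eq algebra_simps)

lemma padic_one_mult: "\<one>\<^bsub>padic_integers p\<^esub> \<otimes>\<^bsub>padic_integers p\<^esub> \<one>\<^bsub>padic_integers p\<^esub> = \<one>\<^bsub>padic_integers p\<^esub>"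
  unfolding padic_integers_def by (simp add: fun_eq_iff mod_mult_eq)

text \<open>The integer N is the residue of z modulo p^i, and the difference is divisible by
  p^i.\<close>

lemma padic_split:
  assumes p: "p > 0" and z: "z \<in> carrier (padic_integers p)"
  shows "\<exists>N. \<exists>w\<in>carrier (padic_integers p).
    z = padic_scale p N \<one>\<^bsub>padic_integers p\<^esub> \<oplus>\<^bsub>padic_integers p\<^esub> padic_scale p (p ^ i) w"
proof -
  \<comment> \<open>Division by p^i costs i digits of precision, so the k-th residue of the quotient
    is taken from the residue k + i of z.\<close>
  define v where "v k = (z (k + i) - z i) div int p ^ i" for k
  have v: "int p ^ i * v k = z (k + i) - z i" for k
  proof -
    have "z (k + i) mod int p ^ i = z i mod int p ^ i"
      using padic_mod[OF z, of i k] padic_memD[OF z, of i] by (simp add: add.commute)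
    then have "int p ^ i dvd z (k + i) - z i" by (simp add: mod_eq_dvd_iff)
    then show ?thesis unfolding v_def by simp
  qed
  define w where "w k = v k mod int p ^ k" for k
  have w: "w \<in> carrier (padic_integers p)"
  proof (rule padic_memI)
    fix k
    have "z (Suc k + i) mod int p ^ (k + i) = z (k + i) mod int p ^ (k + i)"
      using padic_mod[OF z, of "k + i" 1] padic_memD[OF z, of "k + i"] by simp
    then have "int p ^ (k + i) dvd z (Suc k + i) - z (k + i)" by (simp add: mod_eq_dvd_iff)
    also have "z (Suc k + i) - z (k + i) = int p ^ i * (v (Suc k) - v k)" using v[of "Suc k"] v[of k] by (simp add: right_diff_distrib)
    finally have "int p ^ k dvd v (Suc k) - v k" using p by (simp add: power_add mult.commute)
    then have "v (Suc k) mod int p ^ k = v k mod int p ^ k" by (simp add: mod_eq_dvd_iff)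
    moreover have "v (Suc k) mod int p ^ Suc k mod int p ^ k = v (Suc k) mod int p ^ k" by (rule mod_mod_cancel) simp
    ultimately show "0 \<le> w k \<and> w k < int p ^ k \<and> w (Suc k) mod int p ^ k = w k" unfolding w_def using p by simp
  qed
  have "z k = (padic_scale p (nat (z i)) \<one>\<^bsub>padic_integers p\<^esub> \<oplus>\<^bsub>padic_integers p\<^esub> padic_scale p (p ^ i) w) k" for k
  proof -
    have "(z i * (1 mod int p ^ k) mod int p ^ k + int p ^ i * (v k mod int p ^ k) mod int p ^ k) mod int p ^ k
        = (z i + int p ^ i * v k) mod int p ^ k" by (simp add: mod_simps)
    also have "\<dots> = z k" unfolding v using padic_mod[OF z, of k i] by simp
    finally show ?thesis using padic_memD(1)[OF z, of i] by (simp add: padic_scale_def padic_integers_def w_def)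
  qed
  then show ?thesis using w by blast
qed

section \<open>Restriction of subrings of the tensor product to the ring of integers\<close>

context number_field_ring
begin

context
  fixes p i :: nat
  assumes p: "prime p"
begin

abbreviation Zp where "Zp \<equiv> padic_integers p"

lemmas Zp_closed = padic_closed[OF prime_gt_0_nat[OF p]]

lemma carrier_ints: "carrier (ring_of_integers K) = ints"
  by (simp add: ring_of_integers_def ints_def)

lemma add_ints: "x \<oplus>\<^bsub>ring_of_integers K\<^esub> y = x + y"
  by (simp add: ring_of_integers_def)

interpretation T: tensor_pair "ring_of_integers K" Zp
proof
  show "x \<oplus>\<^bsub>ring_of_integers K\<^esub> y \<in> carrier (ring_of_integers K)"
    if "x \<in> carrier (ring_of_integers K)" "y \<in> carrier (ring_of_integers K)" for x y
    using that add_subgroupD(4)[OF ints_subring(1)] unfolding carrier_ints add_ints by blast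
  show "\<one>\<^bsub>ring_of_integers K\<^esub> \<in> carrier (ring_of_integers K)"
    using ints_subring(2) unfolding carrier_ints by (simp add: ring_of_integers_def)
qed (use Zp_closed in auto)

abbreviation \<phi> :: "'a \<Rightarrow> ('a \<times> (nat \<Rightarrow> int) \<Rightarrow>\<^sub>0 int)" where "\<phi> a \<equiv> frag_of (a, \<one>\<^bsub>Zp\<^esub>)"

lemma \<phi>_F: "a \<in> ints \<Longrightarrow> \<phi> a \<in> T.F"
  using T.frag_of_F[OF _ Zp_closed(2)] unfolding carrier_ints by blast

lemma \<phi>_add: "a \<in> ints \<Longrightarrow> b \<in> ints \<Longrightarrow> \<phi> (a + b) - \<phi> a - \<phi> b \<in> T.G"
  using T.rel_left[OF _ _ Zp_closed(2), of a b] unfolding carrier_ints add_ints .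

lemma \<phi>_diff:
  assumes "a \<in> ints" "b \<in> ints"
  shows "\<phi> (a - b) - (\<phi> a - \<phi> b) \<in> T.G"
proof -
  have "\<phi> (a - b + b) - \<phi> (a - b) - \<phi> b \<in> T.G" by (rule \<phi>_add[OF add_subgroupD(2)[OF ints_subring(1) assms] assms(2)])
  from add_subgroupD(3)[OF T.G_sub this] show ?thesis by (simp add: algebra_simps)
qed

lemma \<phi>_0: "\<phi> 0 \<in> T.G"
  using \<phi>_diff[of 0 0] add_subgroupD(1)[OF ints_subring(1)] by simp

lemma \<phi>_scale:
  assumes "a \<in> ints"
  shows "\<phi> (of_nat t * a) - frag_cmul (int t) (\<phi> a) \<in> T.G"
proof (induction t)
  case 0
  then show ?case using \<phi>_0 by simp
next
  case (Suc t)
  have "\<phi> (of_nat t * a + a) - \<phi> (of_nat t * a) - \<phi> a \<in> T.G"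
    by (rule \<phi>_add[OF add_subgroup_of_nat[OF ints_subring(1) assms] assms])
  from add_subgroupD(4)[OF T.G_sub this Suc] show ?case by (simp add: frag_cmul_distrib algebra_simps)
qed

lemma frag_scale:
  assumes a: "a \<in> ints" and z: "z \<in> carrier Zp"
  shows "frag_of (a, padic_scale p t z) - frag_cmul (int t) (frag_of (a, z)) \<in> T.G"
proof (induction t)
  case 0
  let ?o = "padic_scale p 0 z"
  \<comment> \<open>An element z with z + z = z; biadditivity then puts its tensors into the
    kernel.\<close>
  have "?o \<oplus>\<^bsub>Zp\<^esub> ?o = ?o" by (simp add: padic_scale_def padic_integers_def)
  then have "frag_of (a, ?o) - frag_of (a, ?o) - frag_of (a, ?o) \<in> T.G"
    using T.rel_right[of a ?o ?o] a Zp_closed(3)[OF z] unfolding carrier_ints by simp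
  from add_subgroupD(3)[OF T.G_sub this] show ?case by simp
next
  case (Suc t)
  have "frag_of (a, padic_scale p (Suc t) z) - frag_of (a, padic_scale p t z) - frag_of (a, z) \<in> T.G"
    unfolding padic_scale_Suc by (rule T.rel_right) (use a z Zp_closed(3)[OF z] in \<open>simp_all add: carrier_ints\<close>)
  from add_subgroupD(4)[OF T.G_sub this Suc] show ?case by (simp add: frag_cmul_distrib algebra_simps)
qed

text \<open>By density of the integers, every element of the tensor product is a tensor 1 plus p^i
  times another element; it suffices to check pure tensors and differences.\<close>

lemma approximation:
  assumes "x \<in> T.F"
  shows "\<exists>a\<in>ints. \<exists>y\<in>T.F. x - (\<phi> a + frag_cmul (int (p ^ i)) y) \<in> T.G"
proof -
  have "Poly_Mapping.keys x \<subseteq> ints \<times> carrier Zp" using assms unfolding carrier_ints by simp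
  then show ?thesis
  proof (induction x rule: frag_induction)
    case zero
    show ?case
      using \<phi>_0 add_subgroupD(3)[OF T.G_sub] add_subgroupD(1)[OF T.F_sub] add_subgroupD(1)[OF ints_subring(1)]
      by (intro bexI[of _ 0]) auto
  next
    case (one x)
    then obtain a z where x: "x = (a, z)" and a: "a \<in> ints" and z: "z \<in> carrier Zp" by blast
    obtain N w where w: "w \<in> carrier Zp" "z = padic_scale p N \<one>\<^bsub>Zp\<^esub> \<oplus>\<^bsub>Zp\<^esub> padic_scale p (p ^ i) w"
      using padic_split[OF prime_gt_0_nat[OF p] z] by blast
    let ?u = "padic_scale p N \<one>\<^bsub>Zp\<^esub>" and ?v = "padic_scale p (p ^ i) w"
    have 1: "frag_of (a, z) - frag_of (a, ?u) - frag_of (a, ?v) \<in> T.G"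
      unfolding w(2) by (rule T.rel_right) (use a w(1) Zp_closed in \<open>simp_all add: carrier_ints\<close>)
    have 2: "frag_of (a, ?u) - frag_cmul (int N) (\<phi> a) \<in> T.G" by (rule frag_scale[OF a Zp_closed(2)])
    have 3: "frag_of (a, ?v) - frag_cmul (int (p ^ i)) (frag_of (a, w)) \<in> T.G" by (rule frag_scale[OF a w(1)])
    have 4: "\<phi> (of_nat N * a) - frag_cmul (int N) (\<phi> a) \<in> T.G" by (rule \<phi>_scale[OF a])
    have "(frag_of (a, z) - frag_of (a, ?u) - frag_of (a, ?v)) + (frag_of (a, ?u) - frag_cmul (int N) (\<phi> a))
       + (frag_of (a, ?v) - frag_cmul (int (p ^ i)) (frag_of (a, w))) - (\<phi> (of_nat N * a) - frag_cmul (int N) (\<phi> a)) \<in> T.G"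
      by (intro add_subgroupD(2)[OF T.G_sub] add_subgroupD(4)[OF T.G_sub] 1 2 3 4)
    then have "frag_of (a, z) - (\<phi> (of_nat N * a) + frag_cmul (int (p ^ i)) (frag_of (a, w))) \<in> T.G"
      by (simp add: algebra_simps)
    moreover have "frag_of (a, w) \<in> T.F" using a w(1) by (intro T.frag_of_F) (simp_all add: carrier_ints)
    ultimately show ?case unfolding x using add_subgroup_of_nat[OF ints_subring(1) a] by blast
  next
    case (diff x x')
    then obtain a y a' y' where a: "a \<in> ints" "a' \<in> ints" and y: "y \<in> T.F" "y' \<in> T.F"
      and 1: "x - (\<phi> a + frag_cmul (int (p ^ i)) y) \<in> T.G" and 2: "x' - (\<phi> a' + frag_cmul (int (p ^ i)) y') \<in> T.G" by blast
    have "(x - (\<phi> a + frag_cmul (int (p ^ i)) y)) - (x' - (\<phi> a' + frag_cmul (int (p ^ i)) y'))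
        - (\<phi> (a - a') - (\<phi> a - \<phi> a')) \<in> T.G"
      by (intro add_subgroupD(2)[OF T.G_sub] 1 2 \<phi>_diff a)
    then have "(x - x') - (\<phi> (a - a') + (frag_cmul (int (p ^ i)) y - frag_cmul (int (p ^ i)) y')) \<in> T.G"
      by (simp add: algebra_simps)
    moreover have "frag_cmul (int (p ^ i)) (y - y') = frag_cmul (int (p ^ i)) y - frag_cmul (int (p ^ i)) y'"
      by (rule poly_mapping_eqI) (simp add: lookup_minus right_diff_distrib)
    ultimately have "(x - x') - (\<phi> (a - a') + frag_cmul (int (p ^ i)) (y - y')) \<in> T.G" by (simp only:)
    then show ?case using add_subgroupD(2)[OF ints_subring(1) a] add_subgroupD(2)[OF T.F_sub y] by blast
  qed
qed

text \<open>Trace in the sense of restriction: the preimage of L under the map a to a tensor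
  1.\<close>

definition trace :: "('a \<times> (nat \<Rightarrow> int) \<Rightarrow>\<^sub>0 int) set set \<Rightarrow> 'a set" where
  "trace L = {a \<in> ints. \<phi> a \<in> T.lift L}"

context
  fixes L
  assumes L: "subring L T.M" and ind: "additive_index T.M L = p ^ i"
begin

lemmas l_sub = T.lift_sub[OF L]

lemma idx_lift: "idx T.F (T.lift L) = p ^ i"
  using ind unfolding T.additive_index_lift[OF L] .

lemma \<phi>_lift_diff:
  assumes "a \<in> ints" "b \<in> ints"
  shows "\<phi> (a - b) \<in> T.lift L \<longleftrightarrow> \<phi> a - \<phi> b \<in> T.lift L"
proof -
  have "\<phi> (a - b) - (\<phi> a - \<phi> b) \<in> T.lift L" using \<phi>_diff[OF assms] T.G_lift[OF L] by blast
  from add_subgroupD(2)[OF l_sub _ this, of "\<phi> (a - b)"] add_subgroupD(4)[OF l_sub this, of "\<phi> a - \<phi> b"]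
  show ?thesis by auto
qed

lemma multiple_lift: "y \<in> T.F \<Longrightarrow> frag_cmul (int (p ^ i)) y \<in> T.lift L"
  using frag_cmul_idx_mem[OF l_sub T.F_sub] unfolding idx_lift .

lemma approximation_lift:
  assumes "a \<in> ints" "y \<in> T.F" "x - (\<phi> a + frag_cmul (int (p ^ i)) y) \<in> T.G"
  shows "x - \<phi> a \<in> T.lift L"
proof -
  have "x - (\<phi> a + frag_cmul (int (p ^ i)) y) + frag_cmul (int (p ^ i)) y \<in> T.lift L"
    by (rule add_subgroupD(4)[OF l_sub subsetD[OF T.G_lift[OF L] assms(3)] multiple_lift[OF assms(2)]])
  then show ?thesis by (simp add: algebra_simps)
qed

text \<open>L contains p^i times the whole tensor product, so by \<open>approximation\<close> it is
  recovered from its trace; this makes the restriction injective.\<close>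

lemma lift_eq_trace:
  "T.lift L = {x \<in> T.F. \<exists>a\<in>trace L. \<exists>y\<in>T.F. x - (\<phi> a + frag_cmul (int (p ^ i)) y) \<in> T.G}"
proof (intro equalityI subsetI)
  fix x assume x: "x \<in> T.lift L"
  then have xF: "x \<in> T.F" using T.lift_F[OF L] by blast
  obtain a y where a: "a \<in> ints" "y \<in> T.F" "x - (\<phi> a + frag_cmul (int (p ^ i)) y) \<in> T.G"
    using approximation[OF xF] by blast
  have "x - (x - \<phi> a) \<in> T.lift L" by (rule add_subgroupD(2)[OF l_sub x approximation_lift[OF a]])
  then have "a \<in> trace L" unfolding trace_def using a(1) by simp
  then show "x \<in> {x \<in> T.F. \<exists>a\<in>trace L. \<exists>y\<in>T.F. x - (\<phi> a + frag_cmul (int (p ^ i)) y) \<in> T.G}" using xF a by blast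
next
  fix x assume "x \<in> {x \<in> T.F. \<exists>a\<in>trace L. \<exists>y\<in>T.F. x - (\<phi> a + frag_cmul (int (p ^ i)) y) \<in> T.G}"
  then obtain a y where a: "a \<in> trace L" "y \<in> T.F" "x - (\<phi> a + frag_cmul (int (p ^ i)) y) \<in> T.G" by blast
  have a': "a \<in> ints" "\<phi> a \<in> T.lift L" using a(1) unfolding trace_def by auto
  from add_subgroupD(4)[OF l_sub approximation_lift[OF a'(1) a(2,3)] a'(2)] show "x \<in> T.lift L" by simp
qed

lemma trace_sub: "add_subgroup (trace L)"
  unfolding add_subgroup_def
proof (intro conjI ballI)
  show "0 \<in> trace L" unfolding trace_def using add_subgroupD(1)[OF ints_subring(1)] \<phi>_0 T.G_lift[OF L] by blast
  fix a b assume ab: "a \<in> trace L" "b \<in> trace L"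
  then have i: "a \<in> ints" "b \<in> ints" and l: "\<phi> a \<in> T.lift L" "\<phi> b \<in> T.lift L" unfolding trace_def by auto
  have "\<phi> (a - b) \<in> T.lift L" unfolding \<phi>_lift_diff[OF i] by (rule add_subgroupD(2)[OF l_sub l])
  then show "a - b \<in> trace L" unfolding trace_def using add_subgroupD(2)[OF ints_subring(1) i] by blast
qed

lemma trace_one: "1 \<in> trace L"
  using T.lift_one[OF L] ints_subring(2) unfolding trace_def by (simp add: ring_of_integers_def)

lemma trace_mult:
  assumes "a \<in> trace L" "b \<in> trace L"
  shows "a * b \<in> trace L"
proof -
  have i: "a \<in> ints" "b \<in> ints" and l: "\<phi> a \<in> T.lift L" "\<phi> b \<in> T.lift L" using assms unfolding trace_def by auto
  have m: "a \<otimes>\<^bsub>ring_of_integers K\<^esub> b = a * b" by (simp add: ring_of_integers_def)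
  have "\<phi> (a * b) \<in> T.lift L"
    using T.lift_mult[OF L l] Zp_closed(2) ints_subring(3)[OF i] unfolding m padic_one_mult carrier_ints by blast
  then show ?thesis unfolding trace_def using ints_subring(3)[OF i] by blast
qed

text \<open>By \<open>approximation\<close> every coset of L contains some a tensor 1, so the ring
  of integers modulo the trace is the whole quotient.\<close>

lemma idx_trace: "idx ints (trace L) = p ^ i"
proof -
  let ?f = "\<lambda>a. (+) (\<phi> a) ` T.lift L"
  have "cosets T.F (T.lift L) = ?f ` ints"
  proof (intro equalityI subsetI)
    fix c assume "c \<in> cosets T.F (T.lift L)"
    then obtain x where x: "x \<in> T.F" "c = (+) x ` T.lift L" unfolding cosets_def by blast
    obtain a y where a: "a \<in> ints" "y \<in> T.F" "x - (\<phi> a + frag_cmul (int (p ^ i)) y) \<in> T.G"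
      using approximation[OF x(1)] by blast
    have "c = ?f a" unfolding x(2) coset_eq_iff[OF l_sub] by (rule approximation_lift[OF a])
    then show "c \<in> ?f ` ints" using a(1) by blast
  next
    fix c assume "c \<in> ?f ` ints"
    then show "c \<in> cosets T.F (T.lift L)" unfolding cosets_def using \<phi>_F by blast
  qed
  moreover have "card (?f ` ints) = card (cosets ints (trace L))"
  proof -
    have iff: "?f a = ?f b \<longleftrightarrow> (+) a ` trace L = (+) b ` trace L" if "a \<in> ints" "b \<in> ints" for a b
      unfolding coset_eq_iff[OF l_sub] coset_eq_iff[OF trace_sub] \<phi>_lift_diff[OF that, symmetric]
      using add_subgroupD(2)[OF ints_subring(1) that] unfolding trace_def by simp
    let ?r = "inv_into ints (\<lambda>a. (+) a ` trace L)"
    have r: "?r ((+) a ` trace L) \<in> ints" "(+) (?r ((+) a ` trace L)) ` trace L = (+) a ` trace L" if "a \<in> ints" for a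
      using that inv_into_into[of "(+) a ` trace L" "\<lambda>a. (+) a ` trace L" ints]
        f_inv_into_f[of "(+) a ` trace L" "\<lambda>a. (+) a ` trace L" ints] by auto
    have "bij_betw (\<lambda>c. ?f (?r c)) (cosets ints (trace L)) (?f ` ints)"
    proof (rule bij_betwI')
      fix c d assume "c \<in> cosets ints (trace L)" "d \<in> cosets ints (trace L)"
      then obtain a b where ab: "a \<in> ints" "b \<in> ints" "c = (+) a ` trace L" "d = (+) b ` trace L" unfolding cosets_def by blast
      show "?f (?r c) = ?f (?r d) \<longleftrightarrow> c = d"
        unfolding ab(3,4) iff[OF r(1)[OF ab(1)] r(1)[OF ab(2)]] r(2)[OF ab(1)] r(2)[OF ab(2)] ..
    next
      fix c assume "c \<in> cosets ints (trace L)"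
      then obtain a where a: "a \<in> ints" "c = (+) a ` trace L" unfolding cosets_def by blast
      show "?f (?r c) \<in> ?f ` ints" unfolding a(2) by (intro imageI r(1) a(1))
    next
      fix e assume "e \<in> ?f ` ints"
      then obtain a where a: "a \<in> ints" "e = ?f a" by blast
      have "e = ?f (?r ((+) a ` trace L))" unfolding a(2) iff[OF a(1) r(1)[OF a(1)]] r(2)[OF a(1)] ..
      moreover have "(+) a ` trace L \<in> cosets ints (trace L)" unfolding cosets_def using a(1) by blast
      ultimately show "\<exists>c\<in>cosets ints (trace L). e = ?f (?r c)" by blast
    qed
    then show ?thesis by (rule bij_betw_same_card[symmetric])
  qed
  ultimately show ?thesis using idx_lift unfolding idx_def by simp
qed

end

text \<open>Restriction is injective by \<open>lift_eq_trace\<close> and preserves the index by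
  \<open>idx_trace\<close>.\<close>

lemma subring_count_le:
  assumes fin: "finite {L. prime_reduced.subring_of ints L \<and> idx ints L = p ^ i}"
    and red: "prime_reduced ints p n"
  shows "subring_count K p i \<le> card {L. prime_reduced.subring_of ints L \<and> idx ints L = p ^ i}"
proof -
  let ?S = "{L. subring L T.M \<and> full_rank_sublattice Zp T.M L \<and> additive_index T.M L = p ^ i}"
  have "card ?S \<le> card {L. prime_reduced.subring_of ints L \<and> idx ints L = p ^ i}"
  proof (rule card_inj_on_le[OF _ _ fin])
    show "inj_on trace ?S"
    proof (rule inj_onI)
      fix L L' assume L: "L \<in> ?S" and L': "L' \<in> ?S" and e: "trace L = trace L'"
      have "T.lift L = T.lift L'" using lift_eq_trace[of L] lift_eq_trace[of L'] L L' e by simp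
      then have "T.q ` T.lift L = T.q ` T.lift L'" by (rule arg_cong)
      from box_equals[OF this T.q_lift T.q_lift] show "L = L'" using L L' by blast
    qed
    show "trace ` ?S \<subseteq> {L. prime_reduced.subring_of ints L \<and> idx ints L = p ^ i}"
    proof safe
      fix L assume L: "subring L T.M" "additive_index T.M L = p ^ i"
      show "prime_reduced.subring_of ints (trace L)"
        unfolding prime_reduced.subring_of_def[OF red]
      proof (intro conjI ballI)
        show "trace L \<subseteq> ints" unfolding trace_def by blast
      qed (rule trace_sub[OF L] trace_one[OF L] trace_mult[OF L]; assumption?)+
      show "idx ints (trace L) = p ^ i" by (rule idx_trace[OF L])
    qed
  qed
  then show ?thesis unfolding subring_count_def Let_def .
qed

end

end

section \<open>Convergence\<close>

lemma summable_power_times_geometric: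
  fixes r :: real
  assumes r: "0 \<le> r" "r < 1"
  shows "summable (\<lambda>i. real (i + 1) ^ k * r ^ i)"
proof -
  have "(\<lambda>i. (1 + inverse (real (Suc i))) ^ k * r) \<longlonglongrightarrow> 1 ^ k * r"
    by (intro tendsto_intros LIMSEQ_inverse_real_of_nat_add)
  then have "\<forall>\<^sub>F i in sequentially. (1 + inverse (real (Suc i))) ^ k * r < (1 + r) / 2"
    by (rule order_tendstoD(2)) (use r in simp)
  then obtain N where N: "\<And>i. i \<ge> N \<Longrightarrow> (1 + inverse (real (Suc i))) ^ k * r < (1 + r) / 2"
    unfolding eventually_sequentially by blast
  show ?thesis
  proof (rule summable_ratio_test[of "(1 + r) / 2" N])
    fix i assume i: "i \<ge> N"
    have "real (Suc i + 1) = (1 + inverse (real (Suc i))) * real (i + 1)" by (simp add: field_simps)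
    then have "real (Suc i + 1) ^ k * r ^ Suc i = ((1 + inverse (real (Suc i))) ^ k * r) * (real (i + 1) ^ k * r ^ i)"
      by (simp add: power_mult_distrib)
    also have "\<dots> \<le> (1 + r) / 2 * (real (i + 1) ^ k * r ^ i)"
      using N[OF i] r by (intro mult_right_mono) auto
    finally show "norm (real (Suc i + 1) ^ k * r ^ Suc i) \<le> (1 + r) / 2 * norm (real (i + 1) ^ k * r ^ i)"
      using r by simp
  qed (use r in simp)
qed

lemma (in number_field_ring) subring_count_bound:
  assumes "prime p" "prime_reduced ints p n" "n \<ge> 6" "2 * n \<le> p" "i \<ge> 1"
  shows "real (subring_count K p i) \<le>
    real (i + 1) ^ (2 * n) * (2 ^ Suc n * real p powr ((real n / 2 - 7/6) * real i - 1))"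
proof -
  have "real (subring_count K p i) \<le> real (card {L. prime_reduced.subring_of ints L \<and> idx ints L = p ^ i})"
    unfolding of_nat_le_iff
    by (rule subring_count_le[OF assms(1) prime_reduced.finite_subrings_of_index[OF assms(2)] assms(2)])
  also note prime_reduced.subring_bound[OF assms(2-5)]
  finally show ?thesis .
qed

text \<open>Only the part of the exponent beyond i = 2 is moved to the base 2; this separates p from
  i.\<close>

lemma powr_tail_bound:
  fixes p :: real
  assumes "p \<ge> 2" "i \<ge> 2" "\<epsilon> > 0"
  shows "p powr (- 1 - real i * \<epsilon>) \<le> p powr (- 1 - 2 * \<epsilon>) * (2 powr (2 * \<epsilon>) * (2 powr (- \<epsilon>)) ^ i)"
proof -
  have "p powr (- 1 - real i * \<epsilon>) = p powr (- 1 - 2 * \<epsilon>) * p powr (- ((real i - 2) * \<epsilon>))"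
    unfolding powr_add[symmetric] by (simp add: algebra_simps)
  also have "p powr (- ((real i - 2) * \<epsilon>)) \<le> 2 powr (- ((real i - 2) * \<epsilon>))"
    using assms by (intro powr_mono2') auto
  also have "2 powr (- ((real i - 2) * \<epsilon>)) = 2 powr (2 * \<epsilon>) * (2 powr (- \<epsilon>)) ^ i"
    by (simp add: powr_realpow[symmetric] powr_powr powr_add[symmetric] algebra_simps)
  finally show ?thesis by (simp add: mult_left_mono)
qed

text \<open>Domination by a product w p * u i, where u is a polynomial times a geometric sequence
  and w is summable over all natural numbers p.\<close>

lemma double_series_summable:
  fixes a :: "nat \<Rightarrow> nat \<Rightarrow> real" and P :: "nat set"
  assumes a: "\<And>p i. p \<in> P \<Longrightarrow> i \<ge> 2 \<Longrightarrow> 0 \<le> a p i \<and>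
      a p i \<le> C * real (i + 1) ^ k * real p powr (\<theta> * real i - 1)"
    and P: "\<And>p. p \<in> P \<Longrightarrow> p \<ge> 2" and C: "C \<ge> 0" and \<sigma>: "\<sigma> > \<theta>"
  shows "\<forall>p\<in>P. (\<lambda>i. a p i / real p powr (real i * \<sigma>)) summable_on {2..}"
    and "(\<lambda>p. \<Sum>\<^sub>\<infinity>i\<in>{2..}. a p i / real p powr (real i * \<sigma>)) summable_on P"
proof -
  define \<epsilon> where "\<epsilon> = \<sigma> - \<theta>"
  have \<epsilon>: "\<epsilon> > 0" unfolding \<epsilon>_def using \<sigma> by simp
  define u where "u i = C * 2 powr (2 * \<epsilon>) * (real (i + 1) ^ k * (2 powr (- \<epsilon>)) ^ i)" for i
  define w where "w p = real p powr (- 1 - 2 * \<epsilon>)" for p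
  have "2 powr (- \<epsilon>) < (1 :: real)" using \<epsilon> by (simp add: powr_less_one)
  then have "summable (\<lambda>i. real (i + 1) ^ k * (2 powr (- \<epsilon>)) ^ i)" by (intro summable_power_times_geometric) auto
  then have "summable u" unfolding u_def by (rule summable_mult)
  moreover have "0 \<le> u i" for i unfolding u_def using C by simp
  ultimately have "u summable_on UNIV" by (intro summable_nonneg_imp_summable_on)
  then have u: "u summable_on {2..}" by (rule summable_on_subset_banach) simp
  have t: "0 \<le> a p i / real p powr (real i * \<sigma>) \<and> a p i / real p powr (real i * \<sigma>) \<le> w p * u i"
    if p: "p \<in> P" and i: "i \<in> {2..}" for p i
  proof -
    have i2: "i \<ge> 2" using i by simp
    have "a p i / real p powr (real i * \<sigma>) \<le> C * real (i + 1) ^ k * real p powr (\<theta> * real i - 1) / real p powr (real i * \<sigma>)"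
      using a[OF p i2] by (intro divide_right_mono) auto
    also have "\<dots> = C * real (i + 1) ^ k * real p powr (- 1 - real i * \<epsilon>)"
    proof -
      have "real p powr (\<theta> * real i - 1) / real p powr (real i * \<sigma>) = real p powr (- 1 - real i * \<epsilon>)"
        unfolding powr_diff[symmetric] \<epsilon>_def by (simp add: algebra_simps)
      then show ?thesis unfolding times_divide_eq_right[symmetric] by simp
    qed
    also have "\<dots> \<le> C * real (i + 1) ^ k * (real p powr (- 1 - 2 * \<epsilon>) * (2 powr (2 * \<epsilon>) * (2 powr (- \<epsilon>)) ^ i))"
      using powr_tail_bound[of "real p" i \<epsilon>] P[OF p] i2 \<epsilon> C by (intro mult_left_mono) auto
    also have "\<dots> = w p * u i" unfolding w_def u_def by (simp add: mult_ac)
    finally show ?thesis using a[OF p i2] by simp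
  qed
  have wu: "(\<lambda>i. w p * u i) summable_on {2..}" for p by (rule summable_on_cmult_right[OF u])
  have s: "(\<lambda>i. a p i / real p powr (real i * \<sigma>)) summable_on {2..}" if p: "p \<in> P" for p
    by (rule summable_on_comparison_test[OF wu[of p]]) (use t[OF p] in blast)+
  then show "\<forall>p\<in>P. (\<lambda>i. a p i / real p powr (real i * \<sigma>)) summable_on {2..}" by blast
  have "summable (\<lambda>p. real p powr (- 1 - 2 * \<epsilon>))" using \<epsilon> by (simp add: summable_real_powr_iff)
  then have "w summable_on UNIV" unfolding w_def by (intro summable_nonneg_imp_summable_on) auto
  then have "w summable_on P" by (rule summable_on_subset_banach) simp
  then have W: "(\<lambda>p. w p * infsum u {2..}) summable_on P" by (rule summable_on_cmult_left)
  show "(\<lambda>p. \<Sum>\<^sub>\<infinity>i\<in>{2..}. a p i / real p powr (real i * \<sigma>)) summable_on P"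
  proof (rule summable_on_comparison_test[OF W])
    fix p assume p: "p \<in> P"
    show "0 \<le> (\<Sum>\<^sub>\<infinity>i\<in>{2..}. a p i / real p powr (real i * \<sigma>))" by (rule infsum_nonneg) (use t[OF p] in blast)
    have "(\<Sum>\<^sub>\<infinity>i\<in>{2..}. a p i / real p powr (real i * \<sigma>)) \<le> (\<Sum>\<^sub>\<infinity>i\<in>{2..}. w p * u i)"
      by (rule infsum_mono[OF s[OF p] wu]) (use t[OF p] in blast)
    also have "\<dots> = w p * infsum u {2..}" by (rule infsum_cmult_right) (rule u)
    finally show "(\<Sum>\<^sub>\<infinity>i\<in>{2..}. a p i / real p powr (real i * \<sigma>)) \<le> w p * infsum u {2..}" .
  qed
qed

theorem theorem1p6:
  fixes K :: "'a::field_char_0 set" and n :: nat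
  assumes "number_field K" and "field_degree K = n" and "n > 5"
  shows "\<exists>S :: nat set. finite S \<and> (\<forall>p\<in>S. prime p) \<and>
    (\<forall>\<sigma>::real. \<sigma> > real n / 2 - 7 / 6 \<longrightarrow>
      (\<forall>p. prime p \<and> p \<notin> S \<longrightarrow>
        (\<lambda>i. real (subring_count K p i) / real p powr (real i * \<sigma>)) summable_on {2..}) \<and>
      (\<lambda>p. \<Sum>\<^sub>\<infinity>i\<in>{2..}. real (subring_count K p i) / real p powr (real i * \<sigma>))
        summable_on {p. prime p \<and> p \<notin> S})"
proof -
  interpret number_field_ring K n by unfold_locales (rule assms)+
  obtain m :: int where m: "m \<noteq> 0" "\<And>p. prime p \<Longrightarrow> \<not> int p dvd m \<Longrightarrow> prime_reduced ints p n"
    using prime_reduced_ints by blast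
  \<comment> \<open>The primes where the ring of integers may fail to be reduced modulo p, and those
    too small for \<open>many_nondegenerate\<close>.\<close>
  define S where "S = {p. prime p \<and> (p < 2 * n \<or> int p dvd m)}"
  have "S \<subseteq> {..2 * n} \<union> {..nat \<bar>m\<bar>}"
  proof
    fix p assume "p \<in> S"
    then consider "p < 2 * n" | "int p dvd m" unfolding S_def by blast
    then show "p \<in> {..2 * n} \<union> {..nat \<bar>m\<bar>}"
    proof cases
      case 2
      then have "int p \<le> \<bar>m\<bar>" using dvd_imp_le_int[OF m(1) 2] by simp
      then show ?thesis by auto
    qed simp
  qed
  then have "finite S" by (rule finite_subset) simp
  moreover have "\<forall>p\<in>S. prime p" unfolding S_def by simp
  moreover have "(\<forall>p\<in>{p. prime p \<and> p \<notin> S}.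
        (\<lambda>i. real (subring_count K p i) / real p powr (real i * \<sigma>)) summable_on {2..}) \<and>
      (\<lambda>p. \<Sum>\<^sub>\<infinity>i\<in>{2..}. real (subring_count K p i) / real p powr (real i * \<sigma>))
        summable_on {p. prime p \<and> p \<notin> S}" if \<sigma>: "\<sigma> > real n / 2 - 7 / 6" for \<sigma> :: real
  proof -
    have bound: "0 \<le> real (subring_count K p i) \<and> real (subring_count K p i) \<le>
        2 ^ Suc n * real (i + 1) ^ (2 * n) * real p powr ((real n / 2 - 7 / 6) * real i - 1)"
      if p: "p \<in> {p. prime p \<and> p \<notin> S}" and i: "i \<ge> 2" for p i
    proof -
      have p': "prime p" "\<not> int p dvd m" "2 * n \<le> p" using p unfolding S_def by auto
      show ?thesis
        using subring_count_bound[OF p'(1) m(2)[OF p'(1,2)] _ p'(3), of i] assms(3) i by (simp add: mult_ac)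
    qed
    have two: "p \<ge> 2" if "p \<in> {p. prime p \<and> p \<notin> S}" for p using that prime_ge_2_nat by blast
    show ?thesis by (intro conjI double_series_summable[OF bound two _ \<sigma>]) auto
  qed
  ultimately show ?thesis by (intro exI[of _ S]) simp
qed

end
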